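(* Let $\mathbb H$ be a graded affine Hecke algebra, $\Pi_M\subset\Pi$, and let $\sigma=\sigma_0\otimes\mathbb C_\nu$ be a finite dimensional $\mathbb H_M$-module with central character $\mathrm{cc}(\sigma)$, where $\sigma_0$ is an $\mathbb H_M^0$-module, carrying a $\bullet$-invariant hermitian form $\langle\ ,\ \rangle_{\sigma,\bullet}$, and suppose that $\nu\in(V^{\perp,\vee}_{M,\mathrm{reg}})_{\mathbb C}$. Then the induced $\bullet$-invariant hermitian form $\langle\ ,\ \rangle_\bullet$ on $X(M,\sigma)=\mathbb H\otimes_{\mathbb H_M}U_\sigma$ (and hence its signature) is given, for $x,y\in\mathcal J_M$ and $v_1,v_2\in U_\sigma$, by $$\langle \mathcal R_x\otimes v_1,\mathcal R_y\otimes v_2\rangle_\bullet=\begin{cases}0,&x\ne y,\\ f(\mathrm{cc}(\sigma))\Big\langle\sigma\Big(\prod_{\alpha>0,\ x\alpha<0}\frac{\alpha-k_\alpha}{\alpha+k_\alpha}\Big)v_1,v_2\Big\rangle_{\sigma,\bullet},&x=y,\end{cases}$$ where $$f(\mathrm{cc}(\sigma))=(-1)^{|R^+\setminus R_M^+|}\prod_{\alpha\in R^+\setminus R_M^+}\frac{\langle\alpha,\mathrm{cc}(\sigma)\rangle}{k_\alpha+\langle\alpha,\mathrm{cc}(\sigma)\rangle}.$$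
   Context: Root data and algebra: $V,V^\vee$ are finite dimensional real vector spaces with a perfect pairing; $R\subset V$, $R^\vee\subset V^\vee$ form a reduced root system with Weyl group $W$, simple roots $\Pi$, positive roots $R^+$; $k:\Pi\to\mathbb R$ is constant on $W$-conjugate simple roots and is extended $W$-invariantly to $R$. $V_{\mathbb C}$ is the complexification of $V$ with conjugation $\bar{\ }$. The graded affine Hecke algebra $\mathbb H$ is the unital associative $\mathbb C$-algebra generated by $S(V_{\mathbb C})$ and $\{t_w:w\in W\}$ such that $w\otimes a\mapsto t_wa$ is an isomorphism $\mathbb C[W]\otimes S(V_{\mathbb C})\cong\mathbb H$ of $(\mathbb C[W],S(V_{\mathbb C}))$-bimodules and $a\,t_{s_\alpha}=t_{s_\alpha}s_\alpha(a)+k_\alpha\frac{a-s_\alpha(a)}{\alpha}$ for $\alpha\in\Pi$. The star operation $\bullet$ is the conjugate-linear anti-automorphism with $t_w^\bullet=t_{w^{-1}}$, $\omega^\bullet=\overline\omega$ ($\omega\in V_{\mathbb C}$). A form (linear in the first, conjugate-linear in the second variable) is $\bullet$-invariant if $\langle\pi(h)x,y\rangle=\langle x,\pi(h^\bullet)y\rangle$ for all $h$. Parabolic subalgebras: for $\Pi_M\subset\Pi$, $W_M$ is generated by $s_\alpha$, $\alpha\in\Pi_M$, with longest element $w_{0,M}$; $\mathbb H_M$ is the subalgebra generated by $t_w$ ($w\in W_M$) and $S(V_{\mathbb C})$; its center is $S(V_{\mathbb C})^{W_M}$ and central characters $\mathrm{cc}(\sigma)$ are $W_M$-orbits in $V^\vee_{\mathbb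 C}$ (or representatives thereof). $R_M$, $R_M^+$ are the roots, positive roots, spanned by $\Pi_M$; $V_M$, $V_M^\vee$ are the real spans of $R_M$, $R_M^\vee$; $V_M^\perp=\{v\in V:(v,\alpha^\vee)=0\ \forall\alpha\in R_M\}$, $V_M^{\vee,\perp}=V_M^{\perp,\vee}=\{v^\vee\in V^\vee:(\alpha,v^\vee)=0\ \forall\alpha\in R_M\}$. $\mathbb H_M^0$ is the graded affine Hecke algebra of $(V_M,R_M,V_M^\vee,R_M^\vee)$, $\mathbb H_M=\mathbb H_M^0\otimes S((V_M^\perp)_{\mathbb C})$, and $S((V_M^\perp)_{\mathbb C})$ acts on $\mathbb C_\nu$ by $\nu\in(V_M^{\vee,\perp})_{\mathbb C}$. $\mathcal J_M$ is the set of minimal length representatives of $W/W_M$. Every $h\in\mathbb H$ is uniquely $h=\sum_{w\in\mathcal J_M}t_wm_w$, $m_w\in\mathbb H_M$, and $\epsilon_M(h):=m_1$ (also for elements with rational coefficients). With $w_0$ the longest element of $W$, $\delta(\alpha)=-w_0(\alpha)$, $\Pi_{\delta(M)}=\delta(\Pi_M)$, $w^0=w^0_M=w_0w_{0,\delta(M)}=w_{0,M}w_0$. The map $\phi(t_m)=t_{(w^0)^{-1}mw^0}$, $\phi(\omega)=(w^0)^{-1}(\omega)$ is an isomorphism $\mathbb H_M\to\mathbb H_{\delta(M)}$, and $a\sigma$ is the $\mathbb H_{\delta(M)}$-module on $U_\sigma$ with $(a\sigma)(m')=\sigma(\phi^{-1}(m'))$. Two families of elements of $\mathbb H\otimes_{S(V_{\mathbb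 C})}\mathrm{Frac}\,S(V_{\mathbb C})$: for $\alpha\in\Pi$, $R_{s_\alpha}=(t_{s_\alpha}\alpha-k_\alpha)(k_\alpha-\alpha)^{-1}$ and $\mathcal R_{s_\alpha}=(t_{s_\alpha}\alpha-k_\alpha)(k_\alpha+\alpha)^{-1}$; for $x\in W$ with reduced expression $x=s_{\alpha_1}\cdots s_{\alpha_k}$, $R_x=R_{s_{\alpha_1}}\cdots R_{s_{\alpha_k}}$ and $\mathcal R_x=\mathcal R_{s_{\alpha_1}}\cdots\mathcal R_{s_{\alpha_k}}$ (independent of the choice). If $\mathcal R_x=\sum_y t_ya_y$ with $a_y$ rational, $\mathcal R_x\otimes v:=\sum_y t_y\otimes\sigma(a_y)v$. Put $R^0=R_{w^0}$. The induced form is $\langle h_1\otimes v_1,h_2\otimes v_2\rangle_\bullet=\langle a\sigma[\epsilon_{\delta(M)}(t_{(w^0)^{-1}}h_2^\bullet h_1R^0)]v_1,v_2\rangle_{\sigma,\bullet}$. $(V^{\perp,\vee}_{M,\mathrm{reg}})_{\mathbb C}$ denotes the set of $\nu\in(V_M^{\vee,\perp})_{\mathbb C}$ for which all $\mathcal R_x\otimes v_i$ ($x\in\mathcal J_M$, $\{v_i\}$ a basis of $U_\sigma$) are well defined and form a basis of $X(M,\sigma)$. *)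

theory Defs
  imports
    Complex_Main
    "HOL-Analysis.Product_Vector"
    "HOL-Library.Poly_Mapping"
    "HOL-Computational_Algebra.Polynomial"
    "HOL-Computational_Algebra.Fraction_Field"
begin

section \<open>Complexification and the symmetric algebra\<close>

text \<open>The pair \<open>(x, y)\<close> stands for \<open>x + i y\<close>.\<close>

type_synonym 'a cpx = "'a \<times> 'a"

definition cscale :: "complex \<Rightarrow> 'a::real_vector cpx \<Rightarrow> 'a cpx" where
  "cscale c z = (Re c *\<^sub>R fst z - Im c *\<^sub>R snd z, Re c *\<^sub>R snd z + Im c *\<^sub>R fst z)"

definition cconj :: "'a::real_vector cpx \<Rightarrow> 'a cpx" where
  "cconj z = (fst z, - snd z)"

definition cfunctional :: "('a::real_vector cpx \<Rightarrow> complex) \<Rightarrow> bool" where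
  "cfunctional f \<longleftrightarrow> (\<forall>x y. f (x + y) = f x + f y) \<and> (\<forall>c x. f (cscale c x) = c * f x)"

text \<open>
  When \<open>'d\<close> is the finite dimensional space \<open>V\<^sup>\<or>\<close>, perfectly paired with \<open>V\<close>, the
  complex-linear functionals on its complexification are the elements of the complexification of
  \<open>V\<close>, and \<open>'d sym\<close> is the symmetric algebra of the latter, realised as the algebra of
  polynomial functions on the complexification of \<open>V\<^sup>\<or>\<close>.
\<close>

inductive_set polyfuns :: "('d::real_vector cpx \<Rightarrow> complex) set" where
  const: "(\<lambda>_. c) \<in> polyfuns"
| lin: "cfunctional f \<Longrightarrow> f \<in> polyfuns"
| add: "f \<in> polyfuns \<Longrightarrow> g \<in> polyfuns \<Longrightarrow> (\<lambda>z. f z + g z) \<in> polyfuns"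
| mult: "f \<in> polyfuns \<Longrightarrow> g \<in> polyfuns \<Longrightarrow> (\<lambda>z. f z * g z) \<in> polyfuns"

typedef (overloaded) ('d::real_vector) sym = "polyfuns :: ('d cpx \<Rightarrow> complex) set"
  morphisms ev Sym
  using polyfuns.const by blast

lemma polyfun_on_line:
  assumes "f \<in> polyfuns"
  shows "\<exists>P. \<forall>z. f (a + cscale z b) = poly P z"
  using assms
proof (induction rule: polyfuns.induct)
  case (const c)
  show ?case by (rule exI[of _ "[:c:]"]) simp
next
  case (lin f)
  then show ?case
    by (intro exI[of _ "[:f a, f b:]"]) (simp add: cfunctional_def del: split_paired_All)
next
  case (add f g)
  then obtain P Q where "\<forall>z. f (a + cscale z b) = poly P z" "\<forall>z. g (a + cscale z b) = poly Q z"
    by blast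
  then show ?case by (intro exI[of _ "P + Q"]) simp
next
  case (mult f g)
  then obtain P Q where "\<forall>z. f (a + cscale z b) = poly P z" "\<forall>z. g (a + cscale z b) = poly Q z"
    by blast
  then show ?case by (intro exI[of _ "P * Q"]) simp
qed

lemma polyfuns_no_zero_divisors:
  assumes "f \<in> polyfuns" "g \<in> polyfuns" "f \<noteq> (\<lambda>_. 0)" "g \<noteq> (\<lambda>_. 0)"
  shows "(\<lambda>z. f z * g z) \<noteq> (\<lambda>_. 0)"
proof
  assume prod0: "(\<lambda>z. f z * g z) = (\<lambda>_. 0)"
  obtain a b where ab: "f a \<noteq> 0" "g b \<noteq> 0"
    using assms(3,4) by blast
  obtain P Q where P: "\<And>z. f (a + cscale z (b - a)) = poly P z"
    and Q: "\<And>z. g (a + cscale z (b - a)) = poly Q z"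
    using polyfun_on_line[OF assms(1)] polyfun_on_line[OF assms(2)] by metis
  have "a + cscale 0 (b - a) = a" "a + cscale 1 (b - a) = b"
    by (simp_all add: cscale_def prod_eq_iff)
  then have "poly P 0 \<noteq> 0" "poly Q 1 \<noteq> 0"
    using ab P[of 0] Q[of 1] by simp_all
  moreover have "poly (P * Q) = poly 0"
    using fun_cong[OF prod0] by (simp add: fun_eq_iff flip: P Q)
  ultimately show False
    by (metis mult_eq_0_iff poly_0 poly_eq_poly_eq_iff)
qed

instantiation sym :: (real_vector) idom
begin

definition zero_sym :: "'a sym" where "0 = Sym (\<lambda>_. 0)"
definition one_sym :: "'a sym" where "1 = Sym (\<lambda>_. 1)"
definition plus_sym :: "'a sym \<Rightarrow> 'a sym \<Rightarrow> 'a sym" where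
  "p + q = Sym (\<lambda>z. ev p z + ev q z)"
definition uminus_sym :: "'a sym \<Rightarrow> 'a sym" where
  "- p = Sym (\<lambda>z. - ev p z)"
definition minus_sym :: "'a sym \<Rightarrow> 'a sym \<Rightarrow> 'a sym" where
  "p - q = Sym (\<lambda>z. ev p z - ev q z)"
definition times_sym :: "'a sym \<Rightarrow> 'a sym \<Rightarrow> 'a sym" where
  "p * q = Sym (\<lambda>z. ev p z * ev q z)"

lemma polyfuns_uminus: "f \<in> polyfuns \<Longrightarrow> (\<lambda>z. - f z) \<in> polyfuns"
  using polyfuns.mult[OF polyfuns.const[of "-1"]] by simp

lemma polyfuns_diff: "f \<in> polyfuns \<Longrightarrow> g \<in> polyfuns \<Longrightarrow> (\<lambda>z. f z - g z) \<in> polyfuns"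
  using polyfuns.add[OF _ polyfuns_uminus] by fastforce

lemma ev_simps [simp]:
  "ev 0 z = 0" "ev 1 z = 1" "ev (p + q) z = ev p z + ev q z" "ev (- p) z = - ev p z"
  "ev (p - q) z = ev p z - ev q z" "ev (p * q) z = ev p z * ev q z"
  by (simp_all add: zero_sym_def one_sym_def plus_sym_def uminus_sym_def minus_sym_def
      times_sym_def Sym_inverse polyfuns.const polyfuns.add polyfuns.mult polyfuns_uminus
      polyfuns_diff ev)

lemma sym_eqI: "(\<And>z. ev p z = ev q z) \<Longrightarrow> p = q"
  by (metis ev_inject ext)

instance
proof
  fix p q r :: "'a sym"
  show "p \<noteq> 0 \<Longrightarrow> q \<noteq> 0 \<Longrightarrow> p * q \<noteq> 0"
  proof -
    assume "p \<noteq> 0" "q \<noteq> 0"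
    then have "ev p \<noteq> (\<lambda>_. 0)" "ev q \<noteq> (\<lambda>_. 0)"
      by (metis ev_inverse zero_sym_def)+
    from polyfuns_no_zero_divisors[OF ev ev this] show ?thesis
      by (metis ev_simps(1,6) ext)
  qed
  show "(0::'a sym) \<noteq> 1"
    by (metis ev_simps(1,2) zero_neq_one)
qed (rule sym_eqI; simp add: algebra_simps)+

end

definition cst :: "complex \<Rightarrow> 'd::real_vector sym" where
  "cst c = Sym (\<lambda>_. c)"

text \<open>Elements of the fraction field act as rational functions; \<open>rat_ev r \<mu>\<close> is meaningful
  when some representation \<open>p / q\<close> of \<open>r\<close> has \<open>q \<mu> \<noteq> 0\<close>.\<close>

definition rat :: "'d::real_vector sym \<Rightarrow> 'd sym fract" where
  "rat p = Fract p 1"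

definition rat_ev :: "'d::real_vector sym fract \<Rightarrow> 'd cpx \<Rightarrow> complex" where
  "rat_ev r \<mu> = (THE z. \<exists>p q. r = Fract p q \<and> ev q \<mu> \<noteq> 0 \<and> z = ev p \<mu> / ev q \<mu>)"


section \<open>Root data and Weyl groups\<close>

record ('v, 'd) root_data =
  pairing :: "'v \<Rightarrow> 'd \<Rightarrow> real"
  roots :: "'v set"
  coroot :: "'v \<Rightarrow> 'd"
  simples :: "'v set"
  kpar :: "'v \<Rightarrow> real"

definition refl :: "('v::real_vector, 'd::real_vector, 'z) root_data_scheme \<Rightarrow> 'v \<Rightarrow> 'v \<Rightarrow> 'v" where
  "refl D \<alpha> v = v - pairing D v (coroot D \<alpha>) *\<^sub>R \<alpha>"

definition corefl :: "('v::real_vector, 'd::real_vector, 'z) root_data_scheme \<Rightarrow> 'v \<Rightarrow> 'd \<Rightarrow> 'd" where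
  "corefl D \<alpha> \<mu> = \<mu> - pairing D \<alpha> \<mu> *\<^sub>R coroot D \<alpha>"

inductive_set refl_group ::
  "('v::real_vector, 'd::real_vector, 'z) root_data_scheme \<Rightarrow> 'v set \<Rightarrow> ('v \<Rightarrow> 'v) set"
  for D A where
  id: "id \<in> refl_group D A"
| refl: "\<alpha> \<in> A \<Longrightarrow> w \<in> refl_group D A \<Longrightarrow> refl D \<alpha> \<circ> w \<in> refl_group D A"

definition weyl :: "('v::real_vector, 'd::real_vector, 'z) root_data_scheme \<Rightarrow> ('v \<Rightarrow> 'v) set" where
  "weyl D = refl_group D (roots D)"

definition pos_roots :: "('v::real_vector, 'd::real_vector, 'z) root_data_scheme \<Rightarrow> 'v set" where
  "pos_roots D = {\<alpha> \<in> roots D. \<exists>c. (\<forall>\<beta>\<in>simples D. 0 \<le> c \<beta>) \<and> \<alpha> = (\<Sum>\<beta>\<in>simples D. c \<beta> *\<^sub>R \<beta>)}"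

text \<open>
  Root systems are real ones: integrality of \<open>(\<beta>, \<alpha>\<^sup>\<or>)\<close> is not required, so crystallographic and
  non-crystallographic systems are both covered.  The parameter function \<open>kpar\<close> is the
  \<open>W\<close>-invariant extension to all roots.
\<close>

definition root_datum :: "('v::real_vector, 'd::real_vector, 'z) root_data_scheme \<Rightarrow> bool" where
  "root_datum D \<longleftrightarrow>
     (\<exists>B::'v set. finite B \<and> span B = UNIV) \<and> (\<exists>B::'d set. finite B \<and> span B = UNIV) \<and>
     (\<forall>\<mu>. linear (\<lambda>v. pairing D v \<mu>)) \<and> (\<forall>v. linear (pairing D v)) \<and>
     (\<forall>f. linear f \<longrightarrow> (\<exists>!\<mu>. \<forall>v. f v = pairing D v \<mu>)) \<and>
     (\<forall>f. linear f \<longrightarrow> (\<exists>!v. \<forall>\<mu>. f \<mu> = pairing D v \<mu>)) \<and>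
     finite (roots D) \<and> 0 \<notin> roots D \<and> inj_on (coroot D) (roots D) \<and>
     (\<forall>\<alpha>\<in>roots D. pairing D \<alpha> (coroot D \<alpha>) = 2 \<and>
        refl D \<alpha> ` roots D = roots D \<and>
        corefl D \<alpha> ` coroot D ` roots D = coroot D ` roots D \<and>
        (\<forall>c. c *\<^sub>R \<alpha> \<in> roots D \<longrightarrow> c = 1 \<or> c = -1)) \<and>
     simples D \<subseteq> roots D \<and> independent (simples D) \<and>
     (\<forall>\<alpha>\<in>roots D. \<alpha> \<in> pos_roots D \<or> - \<alpha> \<in> pos_roots D) \<and>
     (\<forall>w\<in>weyl D. \<forall>\<alpha>\<in>roots D. kpar D (w \<alpha>) = kpar D \<alpha>)"

definition word_prod :: "('v::real_vector, 'd::real_vector, 'z) root_data_scheme \<Rightarrow> 'v list \<Rightarrow> 'v \<Rightarrow> 'v" where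
  "word_prod D as = foldr (\<circ>) (map (refl D) as) id"

definition len :: "('v::real_vector, 'd::real_vector, 'z) root_data_scheme \<Rightarrow> ('v \<Rightarrow> 'v) \<Rightarrow> nat" where
  "len D w = (LEAST n. \<exists>as. set as \<subseteq> simples D \<and> length as = n \<and> word_prod D as = w)"

definition reduced_word :: "('v::real_vector, 'd::real_vector, 'z) root_data_scheme \<Rightarrow> ('v \<Rightarrow> 'v) \<Rightarrow> 'v list \<Rightarrow> bool" where
  "reduced_word D w as \<longleftrightarrow> set as \<subseteq> simples D \<and> word_prod D as = w \<and> length as = len D w"

definition longest :: "('v::real_vector, 'd::real_vector, 'z) root_data_scheme \<Rightarrow> ('v \<Rightarrow> 'v) set \<Rightarrow> 'v \<Rightarrow> 'v" where
  "longest D G = (THE w. w \<in> G \<and> (\<forall>u\<in>G. len D u \<le> len D w))"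

text \<open>In the following \<open>M \<subseteq> simples D\<close> plays the role of \<open>\<Pi>\<^sub>M\<close>.\<close>

definition weyl_par :: "('v::real_vector, 'd::real_vector, 'z) root_data_scheme \<Rightarrow> 'v set \<Rightarrow> ('v \<Rightarrow> 'v) set" where
  "weyl_par D M = refl_group D M"

definition roots_par :: "('v::real_vector, 'd::real_vector, 'z) root_data_scheme \<Rightarrow> 'v set \<Rightarrow> 'v set" where
  "roots_par D M = roots D \<inter> span M"

definition pos_roots_par :: "('v::real_vector, 'd::real_vector, 'z) root_data_scheme \<Rightarrow> 'v set \<Rightarrow> 'v set" where
  "pos_roots_par D M = pos_roots D \<inter> roots_par D M"

definition V_par :: "('v::real_vector, 'd::real_vector, 'z) root_data_scheme \<Rightarrow> 'v set \<Rightarrow> 'v set" where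
  "V_par D M = span (roots_par D M)"

definition V_perp :: "('v::real_vector, 'd::real_vector, 'z) root_data_scheme \<Rightarrow> 'v set \<Rightarrow> 'v set" where
  "V_perp D M = {v. \<forall>\<alpha>\<in>roots_par D M. pairing D v (coroot D \<alpha>) = 0}"

definition Vdual_perp :: "('v::real_vector, 'd::real_vector, 'z) root_data_scheme \<Rightarrow> 'v set \<Rightarrow> 'd set" where
  "Vdual_perp D M = {\<mu>. \<forall>\<alpha>\<in>roots_par D M. pairing D \<alpha> \<mu> = 0}"

definition min_reps :: "('v::real_vector, 'd::real_vector, 'z) root_data_scheme \<Rightarrow> 'v set \<Rightarrow> ('v \<Rightarrow> 'v) set" where
  "min_reps D M = {w \<in> weyl D. \<forall>u\<in>weyl_par D M. len D w \<le> len D (w \<circ> u)}"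

definition delta :: "('v::real_vector, 'd::real_vector, 'z) root_data_scheme \<Rightarrow> 'v set \<Rightarrow> 'v set" where
  "delta D M = (\<lambda>\<alpha>. - longest D (weyl D) \<alpha>) ` M"

definition w_up :: "('v::real_vector, 'd::real_vector, 'z) root_data_scheme \<Rightarrow> 'v set \<Rightarrow> 'v \<Rightarrow> 'v" where
  "w_up D M = longest D (weyl_par D M) \<circ> longest D (weyl D)"

definition cpair :: "('v::real_vector, 'd::real_vector, 'z) root_data_scheme \<Rightarrow> 'v cpx \<Rightarrow> 'd cpx \<Rightarrow> complex" where
  "cpair D \<omega> \<mu> =
     Complex (pairing D (fst \<omega>) (fst \<mu>) - pairing D (snd \<omega>) (snd \<mu>))
             (pairing D (fst \<omega>) (snd \<mu>) + pairing D (snd \<omega>) (fst \<mu>))"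

definition lin :: "('v::real_vector, 'd::real_vector, 'z) root_data_scheme \<Rightarrow> 'v cpx \<Rightarrow> 'd sym" where
  "lin D \<omega> = Sym (cpair D \<omega>)"

definition root_fn :: "('v::real_vector, 'd::real_vector, 'z) root_data_scheme \<Rightarrow> 'v \<Rightarrow> 'd sym" where
  "root_fn D \<alpha> = lin D (\<alpha>, 0)"

text \<open>\<open>w\<close> acts on polynomial functions by precomposition with its transpose, which extends
  the action \<open>\<omega> \<mapsto> w \<omega>\<close> on linear functions.\<close>

definition transp :: "('v::real_vector, 'd::real_vector, 'z) root_data_scheme \<Rightarrow> ('v \<Rightarrow> 'v) \<Rightarrow> 'd \<Rightarrow> 'd" where
  "transp D w \<mu> = (THE \<mu>'. \<forall>v. pairing D v \<mu>' = pairing D (w v) \<mu>)"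

definition sact :: "('v::real_vector, 'd::real_vector, 'z) root_data_scheme \<Rightarrow> ('v \<Rightarrow> 'v) \<Rightarrow> 'd sym \<Rightarrow> 'd sym" where
  "sact D w p = Sym (\<lambda>z. ev p (map_prod (transp D w) (transp D w) z))"


section \<open>Graded affine Hecke algebras\<close>

inductive_set subring_gen :: "'h::ring_1 set \<Rightarrow> 'h set" for X where
  incl: "x \<in> X \<Longrightarrow> x \<in> subring_gen X"
| one: "1 \<in> subring_gen X"
| diff: "x \<in> subring_gen X \<Longrightarrow> y \<in> subring_gen X \<Longrightarrow> x - y \<in> subring_gen X"
| mult: "x \<in> subring_gen X \<Longrightarrow> y \<in> subring_gen X \<Longrightarrow> x * y \<in> subring_gen X"

definition ring_hom :: "('a::ring_1 \<Rightarrow> 'b::ring_1) \<Rightarrow> bool" where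
  "ring_hom f \<longleftrightarrow> f 1 = 1 \<and> (\<forall>x y. f (x + y) = f x + f y) \<and> (\<forall>x y. f (x * y) = f x * f y)"

record (overloaded) ('v, 'd, 'h) hecke_data = "('v, 'd) root_data" +
  emb :: "'d sym \<Rightarrow> 'h"
  tw :: "('v \<Rightarrow> 'v) \<Rightarrow> 'h"
  star :: "'h \<Rightarrow> 'h"

text \<open>
  The complex algebra structure on \<open>'h\<close> is given by \<open>c \<mapsto> emb H (cst c)\<close>; these elements are
  central by the cross relation with \<open>q = 0\<close>.  In the cross relation, \<open>q\<close> is the quotient
  \<open>(p - s\<^sub>\<alpha>(p)) / \<alpha>\<close>.
\<close>

definition graded_hecke_algebra ::
  "('v::real_vector, 'd::real_vector, 'h::ring_1, 'z) hecke_data_scheme \<Rightarrow> bool" where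
  "graded_hecke_algebra H \<longleftrightarrow>
     root_datum H \<and> ring_hom (emb H) \<and>
     tw H id = 1 \<and> (\<forall>w\<in>weyl H. \<forall>w'\<in>weyl H. tw H (w \<circ> w') = tw H w * tw H w') \<and>
     (\<forall>h. \<exists>!a. (\<forall>w. w \<notin> weyl H \<longrightarrow> a w = 0) \<and> h = (\<Sum>w\<in>weyl H. tw H w * emb H (a w))) \<and>
     (\<forall>\<alpha>\<in>simples H. \<forall>p q. root_fn H \<alpha> * q = p - sact H (refl H \<alpha>) p \<longrightarrow>
        emb H p * tw H (refl H \<alpha>) =
          tw H (refl H \<alpha>) * emb H (sact H (refl H \<alpha>) p) + emb H (cst (of_real (kpar H \<alpha>)) * q))"

definition star_operation ::
  "('v::real_vector, 'd::real_vector, 'h::ring_1, 'z) hecke_data_scheme \<Rightarrow> bool" where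
  "star_operation H \<longleftrightarrow>
     bij (star H) \<and> star H 1 = 1 \<and>
     (\<forall>x y. star H (x + y) = star H x + star H y) \<and>
     (\<forall>c x. star H (emb H (cst c) * x) = emb H (cst (cnj c)) * star H x) \<and>
     (\<forall>x y. star H (x * y) = star H y * star H x) \<and>
     (\<forall>w\<in>weyl H. star H (tw H w) = tw H (inv w)) \<and>
     (\<forall>\<omega>. star H (emb H (lin H \<omega>)) = emb H (lin H (cconj \<omega>)))"

definition coeff_of :: "('v::real_vector, 'd::real_vector, 'h::ring_1, 'z) hecke_data_scheme \<Rightarrow> 'h \<Rightarrow> ('v \<Rightarrow> 'v) \<Rightarrow> 'd sym" where
  "coeff_of H h = (THE a. (\<forall>w. w \<notin> weyl H \<longrightarrow> a w = 0) \<and> h = (\<Sum>w\<in>weyl H. tw H w * emb H (a w)))"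

definition hecke_par :: "('v::real_vector, 'd::real_vector, 'h::ring_1, 'z) hecke_data_scheme \<Rightarrow> 'v set \<Rightarrow> 'h set" where
  "hecke_par H M = subring_gen (tw H ` weyl_par H M \<union> range (emb H))"

text \<open>The subalgebras \<open>\<bbbH>\<^sub>M\<^sup>0\<close> of \<open>\<bbbH>\<^sub>M\<close> and \<open>S((V\<^sub>M\<^sup>\<bottom>)\<^sub>\<complex>)\<close> of \<open>S(V\<^sub>\<complex>)\<close>.\<close>

definition hecke_par0 :: "('v::real_vector, 'd::real_vector, 'h::ring_1, 'z) hecke_data_scheme \<Rightarrow> 'v set \<Rightarrow> 'h set" where
  "hecke_par0 H M =
     subring_gen (tw H ` weyl_par H M \<union> emb H ` (range cst \<union> lin H ` (V_par H M \<times> V_par H M)))"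

definition sym_perp :: "('v::real_vector, 'd::real_vector, 'z) root_data_scheme \<Rightarrow> 'v set \<Rightarrow> 'd sym set" where
  "sym_perp D M = subring_gen (range cst \<union> lin D ` (V_perp D M \<times> V_perp D M))"


section \<open>Rational coefficients\<close>

record (overloaded) ('v, 'd, 'h, 'g) rat_hecke_data = "('v, 'd, 'h) hecke_data" +
  loc :: "'h \<Rightarrow> 'g"
  remb :: "'d sym fract \<Rightarrow> 'g"

text \<open>
  \<open>'g\<close> is \<open>\<bbbH> \<otimes>\<^bsub>S(V\<^sub>\<complex>)\<^esub> Frac S(V\<^sub>\<complex>)\<close>, i.e. the free right module over
  the fraction field on the \<open>t\<^sub>w\<close>, with the ring structure extending that of \<open>\<bbbH>\<close>
  and of the fraction field.
\<close>

definition rational_hecke ::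
  "('v::real_vector, 'd::real_vector, 'h::ring_1, 'g::ring_1, 'z) rat_hecke_data_scheme \<Rightarrow> bool" where
  "rational_hecke H \<longleftrightarrow>
     ring_hom (loc H) \<and> ring_hom (remb H) \<and> (\<forall>p. loc H (emb H p) = remb H (rat p)) \<and>
     (\<forall>g. \<exists>!a. (\<forall>w. w \<notin> weyl H \<longrightarrow> a w = 0) \<and> g = (\<Sum>w\<in>weyl H. loc H (tw H w) * remb H (a w)))"

definition rcoeff_of :: "('v::real_vector, 'd::real_vector, 'h::ring_1, 'g::ring_1, 'z) rat_hecke_data_scheme \<Rightarrow> 'g \<Rightarrow> ('v \<Rightarrow> 'v) \<Rightarrow> 'd sym fract" where
  "rcoeff_of H g =
     (THE a. (\<forall>w. w \<notin> weyl H \<longrightarrow> a w = 0) \<and> g = (\<Sum>w\<in>weyl H. loc H (tw H w) * remb H (a w)))"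

definition rhecke_par :: "('v::real_vector, 'd::real_vector, 'h::ring_1, 'g::ring_1, 'z) rat_hecke_data_scheme \<Rightarrow> 'v set \<Rightarrow> 'g set" where
  "rhecke_par H M = subring_gen (loc H ` tw H ` weyl_par H M \<union> range (remb H))"

definition eps :: "('v::real_vector, 'd::real_vector, 'h::ring_1, 'g::ring_1, 'z) rat_hecke_data_scheme \<Rightarrow> 'v set \<Rightarrow> 'g \<Rightarrow> 'g" where
  "eps H M g =
     (THE m. \<exists>ms. (\<forall>w\<in>min_reps H M. ms w \<in> rhecke_par H M) \<and>
        g = (\<Sum>w\<in>min_reps H M. loc H (tw H w) * ms w) \<and> m = ms id)"

definition rroot :: "('v::real_vector, 'd::real_vector, 'z) root_data_scheme \<Rightarrow> 'v \<Rightarrow> 'd sym fract" where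
  "rroot D \<alpha> = rat (root_fn D \<alpha>)"

definition rk :: "('v::real_vector, 'd::real_vector, 'z) root_data_scheme \<Rightarrow> 'v \<Rightarrow> 'd sym fract" where
  "rk D \<alpha> = rat (cst (of_real (kpar D \<alpha>)))"

text \<open>\<open>Rs\<close> and \<open>Rel\<close> give the elements \<open>R\<^sub>x\<close>; \<open>cRs\<close> and \<open>cRel\<close> give the
  calligraphic ones.  The products do not depend on the chosen reduced word.\<close>

definition Rs :: "('v::real_vector, 'd::real_vector, 'h::ring_1, 'g::ring_1, 'z) rat_hecke_data_scheme \<Rightarrow> 'v \<Rightarrow> 'g" where
  "Rs H \<alpha> = (loc H (tw H (refl H \<alpha>)) * remb H (rroot H \<alpha>) - remb H (rk H \<alpha>))
              * remb H (inverse (rk H \<alpha> - rroot H \<alpha>))"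

definition cRs :: "('v::real_vector, 'd::real_vector, 'h::ring_1, 'g::ring_1, 'z) rat_hecke_data_scheme \<Rightarrow> 'v \<Rightarrow> 'g" where
  "cRs H \<alpha> = (loc H (tw H (refl H \<alpha>)) * remb H (rroot H \<alpha>) - remb H (rk H \<alpha>))
              * remb H (inverse (rk H \<alpha> + rroot H \<alpha>))"

definition Rel :: "('v::real_vector, 'd::real_vector, 'h::ring_1, 'g::ring_1, 'z) rat_hecke_data_scheme \<Rightarrow> ('v \<Rightarrow> 'v) \<Rightarrow> 'g" where
  "Rel H x = prod_list (map (Rs H) (SOME as. reduced_word H x as))"

definition cRel :: "('v::real_vector, 'd::real_vector, 'h::ring_1, 'g::ring_1, 'z) rat_hecke_data_scheme \<Rightarrow> ('v \<Rightarrow> 'v) \<Rightarrow> 'g" where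
  "cRel H x = prod_list (map (cRs H) (SOME as. reduced_word H x as))"


section \<open>Modules and induction\<close>

text \<open>A representation of the subalgebra \<open>A\<close> on the complex vector space \<open>('u, sU)\<close>.
  The values of \<open>\<sigma>\<close> outside \<open>A\<close> are irrelevant.\<close>

definition hecke_rep ::
  "('v::real_vector, 'd::real_vector, 'h::ring_1, 'z) hecke_data_scheme \<Rightarrow> 'h set \<Rightarrow>
   (complex \<Rightarrow> 'u::ab_group_add \<Rightarrow> 'u) \<Rightarrow> ('h \<Rightarrow> 'u \<Rightarrow> 'u) \<Rightarrow> bool" where
  "hecke_rep H A sU \<sigma> \<longleftrightarrow>
     vector_space sU \<and> (\<forall>h\<in>A. Vector_Spaces.linear sU sU (\<sigma> h)) \<and>
     (\<forall>c u. \<sigma> (emb H (cst c)) u = sU c u) \<and>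
     (\<forall>h\<in>A. \<forall>h'\<in>A. \<forall>u. \<sigma> (h + h') u = \<sigma> h u + \<sigma> h' u) \<and>
     (\<forall>h\<in>A. \<forall>h'\<in>A. \<forall>u. \<sigma> (h * h') u = \<sigma> h (\<sigma> h' u))"

definition finite_dim :: "(complex \<Rightarrow> 'u::ab_group_add \<Rightarrow> 'u) \<Rightarrow> bool" where
  "finite_dim sU \<longleftrightarrow> (\<exists>B. finite B \<and> module.span sU B = UNIV)"

text \<open>\<open>\<sigma> = \<sigma>\<^sub>0 \<otimes> \<complex>\<^sub>\<nu>\<close> as a module of
  \<open>\<bbbH>\<^sub>M = \<bbbH>\<^sub>M\<^sup>0 \<otimes> S((V\<^sub>M\<^sup>\<bottom>)\<^sub>\<complex>)\<close>.\<close>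

definition is_twist ::
  "('v::real_vector, 'd::real_vector, 'h::ring_1, 'z) hecke_data_scheme \<Rightarrow> 'v set \<Rightarrow>
   (complex \<Rightarrow> 'u::ab_group_add \<Rightarrow> 'u) \<Rightarrow> ('h \<Rightarrow> 'u \<Rightarrow> 'u) \<Rightarrow> 'd cpx \<Rightarrow> ('h \<Rightarrow> 'u \<Rightarrow> 'u) \<Rightarrow> bool" where
  "is_twist H M sU \<sigma>0 \<nu> \<sigma> \<longleftrightarrow>
     (\<forall>h\<in>hecke_par0 H M. \<forall>p\<in>sym_perp H M. \<forall>u. \<sigma> (h * emb H p) u = sU (ev p \<nu>) (\<sigma>0 h u))"

text \<open>The centre of \<open>\<bbbH>\<^sub>M\<close> is the algebra of \<open>W\<^sub>M\<close>-invariants; \<open>cc\<close> is a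
  representative of the orbit of \<open>\<sigma>\<close>.\<close>

definition central_character ::
  "('v::real_vector, 'd::real_vector, 'h::ring_1, 'z) hecke_data_scheme \<Rightarrow> 'v set \<Rightarrow>
   (complex \<Rightarrow> 'u::ab_group_add \<Rightarrow> 'u) \<Rightarrow> ('h \<Rightarrow> 'u \<Rightarrow> 'u) \<Rightarrow> 'd cpx \<Rightarrow> bool" where
  "central_character H M sU \<sigma> cc \<longleftrightarrow>
     (\<forall>p. (\<forall>w\<in>weyl_par H M. sact H w p = p) \<longrightarrow> (\<forall>u. \<sigma> (emb H p) u = sU (ev p cc) u))"

definition sesquilinear ::
  "(complex \<Rightarrow> 'u::ab_group_add \<Rightarrow> 'u) \<Rightarrow> ('u \<Rightarrow> 'u \<Rightarrow> complex) \<Rightarrow> bool" where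
  "sesquilinear sU b \<longleftrightarrow>
     (\<forall>x x' y. b (x + x') y = b x y + b x' y) \<and> (\<forall>x y y'. b x (y + y') = b x y + b x y') \<and>
     (\<forall>c x y. b (sU c x) y = c * b x y) \<and> (\<forall>c x y. b x (sU c y) = cnj c * b x y)"

definition hermitian_form ::
  "(complex \<Rightarrow> 'u::ab_group_add \<Rightarrow> 'u) \<Rightarrow> ('u \<Rightarrow> 'u \<Rightarrow> complex) \<Rightarrow> bool" where
  "hermitian_form sU b \<longleftrightarrow> sesquilinear sU b \<and> (\<forall>x y. b y x = cnj (b x y))"

definition star_invariant ::
  "('v::real_vector, 'd::real_vector, 'h::ring_1, 'z) hecke_data_scheme \<Rightarrow> 'h set \<Rightarrow>
   ('h \<Rightarrow> 'u \<Rightarrow> 'u) \<Rightarrow> ('u \<Rightarrow> 'u \<Rightarrow> complex) \<Rightarrow> bool" where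
  "star_invariant H A \<sigma> b \<longleftrightarrow> (\<forall>h\<in>A. \<forall>x y. b (\<sigma> h x) y = b x (\<sigma> (star H h) y))"

text \<open>The action of a rational element is defined when it can be written \<open>p / q\<close> with
  \<open>q\<close> acting invertibly.\<close>

definition rat_defined ::
  "('v::real_vector, 'd::real_vector, 'h::ring_1, 'z) hecke_data_scheme \<Rightarrow>
   ('h \<Rightarrow> 'u \<Rightarrow> 'u) \<Rightarrow> 'd sym fract \<Rightarrow> bool" where
  "rat_defined H \<sigma> r \<longleftrightarrow> (\<exists>p q. q \<noteq> 0 \<and> r = Fract p q \<and> bij (\<sigma> (emb H q)))"

definition rat_act ::
  "('v::real_vector, 'd::real_vector, 'h::ring_1, 'z) hecke_data_scheme \<Rightarrow>
   ('h \<Rightarrow> 'u \<Rightarrow> 'u) \<Rightarrow> 'd sym fract \<Rightarrow> 'u \<Rightarrow> 'u" where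
  "rat_act H \<sigma> r u =
     (THE u'. \<exists>p q. q \<noteq> 0 \<and> r = Fract p q \<and> bij (\<sigma> (emb H q)) \<and> \<sigma> (emb H q) u' = \<sigma> (emb H p) u)"

definition rhecke_act ::
  "('v::real_vector, 'd::real_vector, 'h::ring_1, 'g::ring_1, 'z) rat_hecke_data_scheme \<Rightarrow> 'v set \<Rightarrow>
   ('h \<Rightarrow> 'u::ab_group_add \<Rightarrow> 'u) \<Rightarrow> 'g \<Rightarrow> 'u \<Rightarrow> 'u" where
  "rhecke_act H M \<sigma> g u = (\<Sum>w\<in>weyl_par H M. \<sigma> (tw H w) (rat_act H \<sigma> (rcoeff_of H g w) u))"

text \<open>The isomorphism \<open>\<phi>\<close> from \<open>\<bbbH>\<^sub>M\<close> to \<open>\<bbbH>\<^bsub>\<delta>(M)\<^esub>\<close> in terms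
  of the basis \<open>t\<^sub>w\<close>, and the transported module \<open>a\<sigma>\<close>.\<close>

definition phi :: "('v::real_vector, 'd::real_vector, 'h::ring_1, 'z) hecke_data_scheme \<Rightarrow> 'v set \<Rightarrow> 'h \<Rightarrow> 'h" where
  "phi H M h = (\<Sum>w\<in>weyl_par H M.
     tw H (inv (w_up H M) \<circ> w \<circ> w_up H M) * emb H (sact H (inv (w_up H M)) (coeff_of H h w)))"

definition a_twist ::
  "('v::real_vector, 'd::real_vector, 'h::ring_1, 'z) hecke_data_scheme \<Rightarrow> 'v set \<Rightarrow>
   ('h \<Rightarrow> 'u \<Rightarrow> 'u) \<Rightarrow> 'h \<Rightarrow> 'u \<Rightarrow> 'u" where
  "a_twist H M \<sigma> m' = \<sigma> (inv_into (hecke_par H M) (phi H M) m')"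

inductive_set subgroup_gen :: "'a::ab_group_add set \<Rightarrow> 'a set" for X where
  zero: "0 \<in> subgroup_gen X"
| incl: "x \<in> X \<Longrightarrow> x \<in> subgroup_gen X"
| diff: "x \<in> subgroup_gen X \<Longrightarrow> y \<in> subgroup_gen X \<Longrightarrow> x - y \<in> subgroup_gen X"

text \<open>The relations defining \<open>\<bbbH> \<otimes>\<^bsub>A\<^esub> U\<close> as a quotient of the free abelian group on
  \<open>\<bbbH> \<times> U\<close>, which is the type of integer-valued finitely supported functions.\<close>

definition tensor_relations ::
  "'h::ring_1 set \<Rightarrow> ('h \<Rightarrow> 'u::ab_group_add \<Rightarrow> 'u) \<Rightarrow> ('h \<times> 'u \<Rightarrow>\<^sub>0 int) set" where
  "tensor_relations A \<sigma> = subgroup_gen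
     ({Poly_Mapping.single (h + h', u) 1 - Poly_Mapping.single (h, u) 1 - Poly_Mapping.single (h', u) 1 | h h' u. True} \<union>
      {Poly_Mapping.single (h, u + u') 1 - Poly_Mapping.single (h, u) 1 - Poly_Mapping.single (h, u') 1 | h u u'. True} \<union>
      {Poly_Mapping.single (h * m, u) 1 - Poly_Mapping.single (h, \<sigma> m u) 1 | h m u. m \<in> A})"

definition formal_eval ::
  "(complex \<Rightarrow> 'x::ab_group_add \<Rightarrow> 'x) \<Rightarrow> ('h \<Rightarrow> 'u \<Rightarrow> 'x) \<Rightarrow> ('h \<times> 'u \<Rightarrow>\<^sub>0 int) \<Rightarrow> 'x" where
  "formal_eval sX tens c = (\<Sum>(h, u)\<in>Poly_Mapping.keys c. sX (of_int (Poly_Mapping.lookup c (h, u))) (tens h u))"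

text \<open>\<open>('x, sX)\<close> with \<open>tens h u = h \<otimes> u\<close> is the tensor product \<open>\<bbbH> \<otimes>\<^bsub>A\<^esub> U\<close>: it is the
  quotient of the free abelian group by the relations above.\<close>

definition is_tensor_product ::
  "('v::real_vector, 'd::real_vector, 'h::ring_1, 'z) hecke_data_scheme \<Rightarrow> 'h set \<Rightarrow>
   ('h \<Rightarrow> 'u::ab_group_add \<Rightarrow> 'u) \<Rightarrow> (complex \<Rightarrow> 'x::ab_group_add \<Rightarrow> 'x) \<Rightarrow> ('h \<Rightarrow> 'u \<Rightarrow> 'x) \<Rightarrow> bool" where
  "is_tensor_product H A \<sigma> sX tens \<longleftrightarrow>
     vector_space sX \<and> (\<forall>c h u. tens (emb H (cst c) * h) u = sX c (tens h u)) \<and>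
     surj (formal_eval sX tens) \<and>
     (\<forall>c. formal_eval sX tens c = 0 \<longleftrightarrow> c \<in> tensor_relations A \<sigma>)"

text \<open>\<open>cR_tens H \<sigma> tens x v\<close> is the (calligraphic) \<open>R\<^sub>x \<otimes> v\<close>.\<close>

definition cR_tens ::
  "('v::real_vector, 'd::real_vector, 'h::ring_1, 'g::ring_1, 'z) rat_hecke_data_scheme \<Rightarrow>
   ('h \<Rightarrow> 'u \<Rightarrow> 'u) \<Rightarrow> ('h \<Rightarrow> 'u \<Rightarrow> 'x::ab_group_add) \<Rightarrow> ('v \<Rightarrow> 'v) \<Rightarrow> 'u \<Rightarrow> 'x" where
  "cR_tens H \<sigma> tens x v = (\<Sum>y\<in>weyl H. tens (tw H y) (rat_act H \<sigma> (rcoeff_of H (cRel H x) y) v))"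

definition is_basis :: "(complex \<Rightarrow> 'u::ab_group_add \<Rightarrow> 'u) \<Rightarrow> 'u set \<Rightarrow> bool" where
  "is_basis sU B \<longleftrightarrow> \<not> module.dependent sU B \<and> module.span sU B = UNIV"

definition regular_parameter ::
  "('v::real_vector, 'd::real_vector, 'h::ring_1, 'g::ring_1, 'z) rat_hecke_data_scheme \<Rightarrow> 'v set \<Rightarrow>
   (complex \<Rightarrow> 'u::ab_group_add \<Rightarrow> 'u) \<Rightarrow> ('h \<Rightarrow> 'u \<Rightarrow> 'u) \<Rightarrow>
   (complex \<Rightarrow> 'x::ab_group_add \<Rightarrow> 'x) \<Rightarrow> ('h \<Rightarrow> 'u \<Rightarrow> 'x) \<Rightarrow> 'd cpx \<Rightarrow> bool" where
  "regular_parameter H M sU \<sigma> sX tens \<nu> \<longleftrightarrow>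
     \<nu> \<in> Vdual_perp H M \<times> Vdual_perp H M \<and>
     (\<forall>x\<in>min_reps H M. \<forall>y\<in>weyl H. rat_defined H \<sigma> (rcoeff_of H (cRel H x) y)) \<and>
     (\<exists>B. is_basis sU B \<and>
        inj_on (\<lambda>(x, v). cR_tens H \<sigma> tens x v) (min_reps H M \<times> B) \<and>
        is_basis sX ((\<lambda>(x, v). cR_tens H \<sigma> tens x v) ` (min_reps H M \<times> B)))"

definition induced_form ::
  "('v::real_vector, 'd::real_vector, 'h::ring_1, 'g::ring_1, 'z) rat_hecke_data_scheme \<Rightarrow> 'v set \<Rightarrow>
   ('h \<Rightarrow> 'u::ab_group_add \<Rightarrow> 'u) \<Rightarrow> ('u \<Rightarrow> 'u \<Rightarrow> complex) \<Rightarrow>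
   (complex \<Rightarrow> 'x::ab_group_add \<Rightarrow> 'x) \<Rightarrow> ('h \<Rightarrow> 'u \<Rightarrow> 'x) \<Rightarrow> 'x \<Rightarrow> 'x \<Rightarrow> complex" where
  "induced_form H M \<sigma> b sX tens =
     (THE B. sesquilinear sX B \<and>
        (\<forall>h1 h2 v1 v2. B (tens h1 v1) (tens h2 v2) =
           b (rhecke_act H (delta H M) (a_twist H M \<sigma>)
                (eps H (delta H M)
                   (loc H (tw H (inv (w_up H M)) * star H h2 * h1) * Rel H (w_up H M))) v1) v2))"

text \<open>The factor \<open>\<langle>\<alpha>, cc\<rangle> / (k\<^sub>\<alpha> + \<langle>\<alpha>, cc\<rangle>)\<close> is read as the value at \<open>cc\<close> of the rational
  function \<open>\<alpha> / (k\<^sub>\<alpha> + \<alpha>)\<close>: see \<open>f_factor_eq\<close> below.  The only difference from the quotient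
  of complex numbers is that the factor is \<open>1\<close>, and not \<open>0 / 0\<close>, when \<open>k\<^sub>\<alpha> = 0\<close> and
  \<open>\<langle>\<alpha>, cc\<rangle> = 0\<close>.\<close>

definition f_factor :: "('v::real_vector, 'd::real_vector, 'z) root_data_scheme \<Rightarrow> 'v \<Rightarrow> 'd cpx \<Rightarrow> complex" where
  "f_factor D \<alpha> cc = rat_ev (rroot D \<alpha> / (rk D \<alpha> + rroot D \<alpha>)) cc"

definition f_cc :: "('v::real_vector, 'd::real_vector, 'z) root_data_scheme \<Rightarrow> 'v set \<Rightarrow> 'd cpx \<Rightarrow> complex" where
  "f_cc D M cc =
     (-1) ^ card (pos_roots D - pos_roots_par D M) *
     (\<Prod>\<alpha>\<in>pos_roots D - pos_roots_par D M. f_factor D \<alpha> cc)"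

lemma rat_ev_Fract:
  assumes "ev q \<mu> \<noteq> 0"
  shows "rat_ev (Fract p q) \<mu> = ev p \<mu> / ev q \<mu>"
  unfolding rat_ev_def
proof (rule the_equality)
  show "\<exists>p' q'. Fract p q = Fract p' q' \<and> ev q' \<mu> \<noteq> 0 \<and> ev p \<mu> / ev q \<mu> = ev p' \<mu> / ev q' \<mu>"
    using assms by blast
next
  fix z assume "\<exists>p' q'. Fract p q = Fract p' q' \<and> ev q' \<mu> \<noteq> 0 \<and> z = ev p' \<mu> / ev q' \<mu>"
  then obtain p' q' where pq: "Fract p q = Fract p' q'" "ev q' \<mu> \<noteq> 0" "z = ev p' \<mu> / ev q' \<mu>"
    by blast
  from assms pq(2) have "q \<noteq> 0" "q' \<noteq> 0" by auto
  with pq(1) have "p * q' = p' * q" by (simp add: eq_fract)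
  then have "ev p \<mu> * ev q' \<mu> = ev p' \<mu> * ev q \<mu>" by (metis ev_simps(6))
  with assms pq(2,3) show "z = ev p \<mu> / ev q \<mu>" by (simp add: frac_eq_eq)
qed

lemma ev_cst [simp]: "ev (cst c) \<mu> = c"
  by (simp add: cst_def Sym_inverse polyfuns.const)

lemma ev_lin:
  assumes "root_datum D"
  shows "ev (lin D \<omega>) \<mu> = cpair D \<omega> \<mu>"
proof -
  from assms have "linear (pairing D v)" for v by (simp add: root_datum_def)
  then have "cfunctional (cpair D \<omega>)"
    by (auto simp: cfunctional_def cpair_def cscale_def complex_eq_iff linear_add linear_diff
        linear_scale algebra_simps)
  then show ?thesis by (simp add: lin_def Sym_inverse polyfuns.lin)
qed

lemma f_factor_eq:
  assumes "root_datum D" "of_real (kpar D \<alpha>) + cpair D (\<alpha>, 0) cc \<noteq> 0"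
  shows "f_factor D \<alpha> cc = cpair D (\<alpha>, 0) cc / (of_real (kpar D \<alpha>) + cpair D (\<alpha>, 0) cc)"
proof -
  let ?p = "root_fn D \<alpha>" and ?q = "cst (of_real (kpar D \<alpha>)) + root_fn D \<alpha>"
  have "rroot D \<alpha> / (rk D \<alpha> + rroot D \<alpha>) = Fract ?p ?q"
    by (simp add: rroot_def rk_def rat_def)
  with assms show ?thesis
    by (simp add: f_factor_def rat_ev_Fract root_fn_def ev_lin)
qed

end

theory Submission
  imports Defs
begin

text \<open>
  The induced form is the value of \<open>\<sigma>\<close> on a projection of \<open>h\<^sub>2\<^sup>\<bullet> h\<^sub>1\<close> from the Hecke algebra to its
  parabolic subalgebra, and the proof identifies this projection.  Write \<open>cR w\<close> for the calligraphic
  elements.  They satisfy \<open>cR u cR w = cR (u w)\<close> for all \<open>u\<close> and \<open>w\<close>, and moving a rational function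
  from the right to the left of \<open>cR w\<close> turns it into its \<open>w\<close>-translate.  So the algebra with
  rational coefficients is a twisted group algebra of the Weyl group over the rational functions
  with basis \<open>cR w\<close>, and the rational parabolic subalgebra is the part spanned by \<open>w\<close> in \<open>W\<^sub>M\<close>.

  The element \<open>R\<^sup>0\<close> is the intertwiner of \<open>c = w\<^sup>0\<close> times a factor that is invariant under the dual
  parabolic group.  Transported back by conjugation with \<open>R\<^sup>0\<close>, the map
  \<open>g \<mapsto> \<epsilon> (t\<^bsub>c\<inverse>\<^esub> g R\<^sup>0)\<close> becomes \<open>Psi\<close>, and \<open>Psi_cR\<close> says that \<open>Psi\<close> is the coordinate projection onto
  the part \<open>w \<in> W\<^sub>M\<close> followed by multiplication with the central function
  \<open>F0 = \<Prod> - \<beta> / (k + \<beta>)\<close>, the product over the positive roots outside the parabolic.  The vanishing on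
  the other \<open>cR w\<close> comes from the Bruhat order: \<open>\<epsilon> (t\<^bsub>c\<inverse>\<^esub> -)\<close> looks only at the coset of \<open>c\<close>, which is
  an upper set, while \<open>cR w R\<^sup>0\<close> is supported below \<open>w c\<close>.  The scalar is the leading coefficient of
  \<open>R\<^sup>0\<close>.

  On the other side, \<open>t\<^sub>s \<alpha> - k\<close> is anti-selfadjoint, so the adjoint of \<open>cR y\<close> is \<open>cR\<close> of \<open>y\<inverse>\<close> times
  \<open>\<Prod> (\<gamma> - k) / (\<gamma> + k)\<close> over the inversions \<open>\<gamma>\<close> of \<open>y\<close> (\<open>loc_star\<close>).  Hence the form of
  \<open>cR x \<otimes> v\<^sub>1\<close> and \<open>cR y \<otimes> v\<^sub>2\<close> involves only \<open>Psi\<close> of a multiple of the intertwiner of \<open>y\<inverse> x\<close>.  For minimal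
  coset representatives \<open>y\<inverse> x\<close> lies in \<open>W\<^sub>M\<close> only if \<open>x = y\<close>, and then the product over inversions and
  the value of \<open>F0\<close> at the central character remain.

  Denominators need care because \<open>\<sigma>\<close> is defined on polynomial coefficients only.  Those of \<open>Psi\<close> divide
  the \<open>W\<^sub>M\<close>-invariant product of the factors \<open>k + \<beta>\<close> with \<open>k \<noteq> 0\<close>; it acts by a scalar, and regularity of
  the parameter makes each factor act invertibly (\<open>bij_dfac\<close>).  Those of \<open>cR x\<close> are absorbed into the
  vector (\<open>cR_tens_integral\<close>), so that only elements of the Hecke algebra itself meet the form.
\<close>

section \<open>Reflections and the Weyl group\<close>

locale root_system =
  fixes D :: "('v::real_vector, 'd::real_vector, 'z) root_data_scheme"
  assumes rd: "root_datum D"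
begin

lemma linear_pairing_left: "linear (\<lambda>v. pairing D v \<mu>)"
  and linear_pairing_right: "linear (pairing D v)"
  using rd by (auto simp: root_datum_def)

lemmas pairing_simps =
  linear_add[OF linear_pairing_left] linear_diff[OF linear_pairing_left]
  linear_scale[OF linear_pairing_left] linear_neg[OF linear_pairing_left]
  linear_0[OF linear_pairing_left] linear_sum[OF linear_pairing_left]
  linear_add[OF linear_pairing_right] linear_diff[OF linear_pairing_right]
  linear_scale[OF linear_pairing_right] linear_neg[OF linear_pairing_right]
  linear_0[OF linear_pairing_right]

lemma finite_roots: "finite (roots D)"
  and zero_notin_roots: "0 \<notin> roots D"
  and pairing_coroot: "\<alpha> \<in> roots D \<Longrightarrow> pairing D \<alpha> (coroot D \<alpha>) = 2"
  and refl_roots: "\<alpha> \<in> roots D \<Longrightarrow> refl D \<alpha> ` roots D = roots D"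
  and corefl_coroots:
    "\<alpha> \<in> roots D \<Longrightarrow> corefl D \<alpha> ` coroot D ` roots D = coroot D ` roots D"
  and reduced: "\<alpha> \<in> roots D \<Longrightarrow> c *\<^sub>R \<alpha> \<in> roots D \<Longrightarrow> c = 1 \<or> c = -1"
  and simples_roots: "simples D \<subseteq> roots D"
  and independent_simples: "independent (simples D)"
  and roots_pos_or_neg: "\<alpha> \<in> roots D \<Longrightarrow> \<alpha> \<in> pos_roots D \<or> - \<alpha> \<in> pos_roots D"
  and kpar_weyl: "w \<in> weyl D \<Longrightarrow> \<alpha> \<in> roots D \<Longrightarrow> kpar D (w \<alpha>) = kpar D \<alpha>"
  using rd by (auto simp: root_datum_def)

lemma finite_simples: "finite (simples D)"
  using finite_subset[OF simples_roots finite_roots] .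

lemma linear_refl: "linear (refl D \<alpha>)"
  by (rule linearI) (auto simp: refl_def pairing_simps algebra_simps)

lemma refl_self: "\<alpha> \<in> roots D \<Longrightarrow> refl D \<alpha> \<alpha> = - \<alpha>"
  by (simp add: refl_def pairing_coroot scaleR_2)

lemma refl_refl [simp]: "\<alpha> \<in> roots D \<Longrightarrow> refl D \<alpha> (refl D \<alpha> v) = v"
  by (simp add: refl_def pairing_simps pairing_coroot algebra_simps)

lemma refl_comp_refl [simp]: "\<alpha> \<in> roots D \<Longrightarrow> refl D \<alpha> \<circ> refl D \<alpha> = id"
  by (auto simp: fun_eq_iff)

lemma neg_root: "\<alpha> \<in> roots D \<Longrightarrow> - \<alpha> \<in> roots D"
  using refl_roots[of \<alpha>] refl_self[of \<alpha>] by (metis imageI)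

text \<open>A finite sum over the coroots in place of a choice of Euclidean structure.  Every reflection
permutes the coroots, so it preserves the form.  The form may vanish on vectors orthogonal to all
coroots, but it is positive on each root, which is all that a Euclidean structure is used for.\<close>

definition bform :: "'v \<Rightarrow> 'v \<Rightarrow> real" where
  "bform u v = (\<Sum>\<mu>\<in>coroot D ` roots D. pairing D u \<mu> * pairing D v \<mu>)"

lemma pairing_refl: "pairing D (refl D \<alpha> v) \<mu> = pairing D v (corefl D \<alpha> \<mu>)"
  by (simp add: refl_def corefl_def pairing_simps)

lemma bform_refl:
  assumes "\<alpha> \<in> roots D"
  shows "bform (refl D \<alpha> u) (refl D \<alpha> v) = bform u v"
proof -
  have "inj_on (corefl D \<alpha>) (coroot D ` roots D)"
    using corefl_coroots[OF assms] finite_roots by (simp add: eq_card_imp_inj_on)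
  then have "bform u v = (\<Sum>\<mu>\<in>coroot D ` roots D.
      pairing D u (corefl D \<alpha> \<mu>) * pairing D v (corefl D \<alpha> \<mu>))"
    unfolding bform_def
    by (subst corefl_coroots[OF assms, symmetric]) (simp add: sum.reindex)
  then show ?thesis by (simp add: bform_def pairing_refl)
qed

lemma bform_sym: "bform u v = bform v u"
  by (simp add: bform_def mult.commute)

lemma linear_bform: "linear (\<lambda>u. bform u v)"
  by (rule linearI)
    (auto simp: bform_def pairing_simps algebra_simps sum.distrib sum_distrib_left)

lemma bform_root_pos:
  assumes "\<alpha> \<in> roots D"
  shows "0 < bform \<alpha> \<alpha>"
proof -
  have "0 < pairing D \<alpha> (coroot D \<alpha>) * pairing D \<alpha> (coroot D \<alpha>)"
    using assms by (simp add: pairing_coroot)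
  also have "\<dots> \<le> bform \<alpha> \<alpha>"
    unfolding bform_def using assms finite_roots
    by (intro member_le_sum[where f = "\<lambda>\<mu>. pairing D \<alpha> \<mu> * pairing D \<alpha> \<mu>"]) auto
  finally show ?thesis .
qed

lemma pairing_coroot_bform:
  assumes "\<alpha> \<in> roots D"
  shows "pairing D v (coroot D \<alpha>) * bform \<alpha> \<alpha> = 2 * bform v \<alpha>"
proof -
  have "bform v \<alpha> = bform (refl D \<alpha> v) (- \<alpha>)"
    using bform_refl[OF assms, of v \<alpha>] by (simp add: refl_self assms)
  also have "\<dots> = - bform v \<alpha> + pairing D v (coroot D \<alpha>) * bform \<alpha> \<alpha>"
    by (simp add: refl_def bform_def pairing_simps algebra_simps sum.distrib
        sum_subtractf sum_negf sum_distrib_left)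
  finally show ?thesis by simp
qed

lemma refl_group_comp:
  "u \<in> refl_group D A \<Longrightarrow> w \<in> refl_group D A \<Longrightarrow> u \<circ> w \<in> refl_group D A"
  by (induction u rule: refl_group.induct) (auto simp: comp_assoc intro: refl_group.refl)

lemma refl_in_group: "\<alpha> \<in> A \<Longrightarrow> refl D \<alpha> \<in> refl_group D A"
  using refl_group.refl[OF _ refl_group.id, of \<alpha> A] by simp

lemma refl_group_mono: "A \<subseteq> B \<Longrightarrow> refl_group D A \<subseteq> refl_group D B"
proof
  fix w assume "w \<in> refl_group D A" "A \<subseteq> B"
  then show "w \<in> refl_group D B"
    by (induction w rule: refl_group.induct) (auto intro: refl_group.id refl_group.refl)
qed

lemma refl_group_bij_inv:
  assumes "w \<in> refl_group D A" "A \<subseteq> roots D"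
  shows "bij w \<and> inv w \<in> refl_group D A"
  using assms
proof (induction w rule: refl_group.induct)
  case id
  then show ?case by (metis bij_id inv_id refl_group.id)
next
  case (refl \<alpha> w)
  then have a: "\<alpha> \<in> roots D" by auto
  then have b: "bij (refl D \<alpha>)" by (intro o_bij[of "refl D \<alpha>"]) auto
  have "inv (refl D \<alpha>) = refl D \<alpha>"
    using a by (intro inv_unique_comp) auto
  with b refl show ?case
    by (metis bij_comp o_inv_distrib refl_group_comp refl_in_group)
qed

lemma refl_group_linear: "w \<in> refl_group D A \<Longrightarrow> linear w"
proof (induction w rule: refl_group.induct)
  case id
  show ?case by (rule linear_id)
next
  case (refl \<alpha> w)
  then show ?case by (intro linear_compose linear_refl)
qed

abbreviation W where "W \<equiv> weyl D"

lemma id_W [simp]: "id \<in> W"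
  by (simp add: weyl_def refl_group.id)
lemma comp_W: "u \<in> W \<Longrightarrow> w \<in> W \<Longrightarrow> u \<circ> w \<in> W"
  by (simp add: weyl_def refl_group_comp)
lemma inv_W: "w \<in> W \<Longrightarrow> inv w \<in> W"
  and bij_W: "w \<in> W \<Longrightarrow> bij w"
  using refl_group_bij_inv[of w "roots D"] by (auto simp: weyl_def)
lemma refl_W: "\<alpha> \<in> roots D \<Longrightarrow> refl D \<alpha> \<in> W"
  by (simp add: weyl_def refl_in_group)
lemma linear_W: "w \<in> W \<Longrightarrow> linear w"
  by (simp add: weyl_def refl_group_linear)
lemma inv_comp_W [simp]: "w \<in> W \<Longrightarrow> inv w \<circ> w = id"
  by (simp add: bij_W bij_is_inj)
lemma comp_inv_W [simp]: "w \<in> W \<Longrightarrow> w \<circ> inv w = id"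
  using bij_W[of w] by (metis bij_is_surj surj_iff)
lemma inv_W_app [simp]: "w \<in> W \<Longrightarrow> inv w (w v) = v" "w \<in> W \<Longrightarrow> w (inv w v) = v"
  by (auto simp: bij_W bij_is_inj bij_is_surj surj_f_inv_f)
lemma inv_comp_cancel [simp]:
  "w \<in> W \<Longrightarrow> inv w \<circ> (w \<circ> u) = u" "w \<in> W \<Longrightarrow> w \<circ> (inv w \<circ> u) = u"
  by (simp_all add: fun_eq_iff)
lemma inv_inv_W: "w \<in> W \<Longrightarrow> inv (inv w) = w"
  by (simp add: bij_W inv_inv_eq)
lemma inv_comp_distrib: "u \<in> W \<Longrightarrow> w \<in> W \<Longrightarrow> inv (u \<circ> w) = inv w \<circ> inv u"
  by (simp add: bij_W o_inv_distrib)
lemma neg_W: "w \<in> W \<Longrightarrow> w (- v) = - w v"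
  using linear_W[of w] by (simp add: linear_neg)
lemma inv_refl: "\<alpha> \<in> roots D \<Longrightarrow> inv (refl D \<alpha>) = refl D \<alpha>"
  by (intro inv_unique_comp) auto

lemma weyl_image_roots: "w \<in> W \<Longrightarrow> w ` roots D = roots D"
  unfolding weyl_def
proof (induction w rule: refl_group.induct)
  case id
  show ?case by simp
next
  case (refl \<alpha> w)
  then show ?case by (metis image_comp refl_roots)
qed

lemma weyl_root: "w \<in> W \<Longrightarrow> \<alpha> \<in> roots D \<Longrightarrow> w \<alpha> \<in> roots D"
  using weyl_image_roots by blast

lemma bform_weyl: "w \<in> W \<Longrightarrow> bform (w u) (w v) = bform u v"
  unfolding weyl_def
  by (induction w rule: refl_group.induct) (auto simp: bform_refl)

text \<open>The coroot of \<open>\<alpha>\<close> is determined by the form and \<open>\<alpha>\<close>, and the Weyl group preserves the form.  The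
axioms only ask that the set of coroots be stable under reflections, so the equivariance of the
individual coroots has to be derived.\<close>

lemma pairing_weyl:
  assumes "w \<in> W" "\<alpha> \<in> roots D"
  shows "pairing D (w v) (coroot D (w \<alpha>)) = pairing D v (coroot D \<alpha>)"
  using pairing_coroot_bform[OF assms(2), of v]
    pairing_coroot_bform[OF weyl_root[OF assms], of "w v"] bform_root_pos[OF assms(2)]
  by (metis assms bform_weyl mult_cancel_right order_less_irrefl)

lemma refl_weyl:
  assumes "w \<in> W" "\<alpha> \<in> roots D"
  shows "refl D (w \<alpha>) \<circ> w = w \<circ> refl D \<alpha>"
  using assms linear_W[OF assms(1)]
  by (auto simp: fun_eq_iff refl_def pairing_weyl linear_diff linear_scale)

lemma refl_weyl_conj: "w \<in> W \<Longrightarrow> \<alpha> \<in> roots D \<Longrightarrow> refl D (w \<alpha>) = w \<circ> refl D \<alpha> \<circ> inv w"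
proof -
  assume a: "w \<in> W" "\<alpha> \<in> roots D"
  have "refl D (w \<alpha>) v = (refl D (w \<alpha>) \<circ> w) (inv w v)" for v
    using a by simp
  then show ?thesis unfolding refl_weyl[OF a] by (simp add: fun_eq_iff)
qed

section \<open>Positive roots and parabolic subgroups\<close>

abbreviation P where "P \<equiv> pos_roots D"

text \<open>The coefficient of a vector at a simple root; it is \<open>0\<close> for vectors outside the span of the
simple roots.\<close>

definition co :: "'v \<Rightarrow> 'v \<Rightarrow> real" where
  "co v \<gamma> = representation (simples D) v \<gamma>"

lemma simples_pos: "simples D \<subseteq> P"
proof
  fix \<alpha> assume a: "\<alpha> \<in> simples D"
  have "\<alpha> = (\<Sum>\<beta>\<in>simples D. (if \<beta> = \<alpha> then 1 else 0) *\<^sub>R \<beta>)"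
    using a finite_simples by (simp add: if_distrib[of "\<lambda>c. c *\<^sub>R _"] sum.delta cong: if_cong)
  then show "\<alpha> \<in> P"
    using a simples_roots unfolding pos_roots_def
    by (auto intro!: exI[of _ "\<lambda>\<beta>. if \<beta> = \<alpha> then 1 else 0"])
qed

lemma P_roots: "P \<subseteq> roots D"
  by (auto simp: pos_roots_def)

lemma P_span: "P \<subseteq> span (simples D)"
  by (auto simp: pos_roots_def intro!: span_sum span_scale intro: span_base)

lemma roots_span: "roots D \<subseteq> span (simples D)"
  using P_span roots_pos_or_neg by (metis add.inverse_inverse span_neg subset_iff)

lemma co_add: "u \<in> span (simples D) \<Longrightarrow> v \<in> span (simples D) \<Longrightarrow> co (u + v) \<gamma> = co u \<gamma> + co v \<gamma>"
  and co_diff: "u \<in> span (simples D) \<Longrightarrow> v \<in> span (simples D) \<Longrightarrow> co (u - v) \<gamma> = co u \<gamma> - co v \<gamma>"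
  and co_neg: "u \<in> span (simples D) \<Longrightarrow> co (- u) \<gamma> = - co u \<gamma>"
  and co_scale: "u \<in> span (simples D) \<Longrightarrow> co (c *\<^sub>R u) \<gamma> = c * co u \<gamma>"
  using independent_simples
  by (auto simp: co_def representation_add representation_diff representation_neg representation_scale)

lemma co_simple: "\<alpha> \<in> simples D \<Longrightarrow> co \<alpha> \<gamma> = (if \<gamma> = \<alpha> then 1 else 0)"
  using independent_simples by (simp add: co_def representation_basis)

lemma co_outside: "\<gamma> \<notin> simples D \<Longrightarrow> co v \<gamma> = 0"
  using representation_ne_zero[of "simples D" v \<gamma>] by (auto simp: co_def)

lemma co_expand: "v \<in> span (simples D) \<Longrightarrow> v = (\<Sum>\<gamma>\<in>simples D. co v \<gamma> *\<^sub>R \<gamma>)"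
  using sum_representation_eq[OF independent_simples _ finite_simples order.refl]
  by (simp add: co_def)

lemma co_sum: "\<gamma> \<in> simples D \<Longrightarrow> co (\<Sum>\<beta>\<in>simples D. c \<beta> *\<^sub>R \<beta>) \<gamma> = c \<gamma>"
proof -
  assume g: "\<gamma> \<in> simples D"
  have "co (\<Sum>\<beta>\<in>A. c \<beta> *\<^sub>R \<beta>) \<gamma> = (\<Sum>\<beta>\<in>A. c \<beta> * co \<beta> \<gamma>)" if "finite A" "A \<subseteq> simples D" for A
    using that
  proof (induction A rule: finite_induct)
    case empty
    show ?case using independent_simples by (simp add: co_def representation_zero)
  next
    case (insert x A)
    then show ?case
      by (simp add: co_add co_scale span_base span_scale span_sum subset_iff)
  qed
  from this[OF finite_simples order.refl] show ?thesis
    using g finite_simples by (simp add: co_simple if_distrib[of "\<lambda>x. _ * x"] sum.delta' cong: if_cong)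
qed

lemma P_iff: "\<alpha> \<in> P \<longleftrightarrow> \<alpha> \<in> roots D \<and> (\<forall>\<gamma>. 0 \<le> co \<alpha> \<gamma>)"
proof
  assume "\<alpha> \<in> P"
  then obtain c where "\<forall>\<beta>\<in>simples D. 0 \<le> c \<beta>" "\<alpha> = (\<Sum>\<beta>\<in>simples D. c \<beta> *\<^sub>R \<beta>)" "\<alpha> \<in> roots D"
    by (auto simp: pos_roots_def)
  then show "\<alpha> \<in> roots D \<and> (\<forall>\<gamma>. 0 \<le> co \<alpha> \<gamma>)"
    using co_sum co_outside by (metis order.refl)
next
  assume "\<alpha> \<in> roots D \<and> (\<forall>\<gamma>. 0 \<le> co \<alpha> \<gamma>)"
  moreover from this have "\<alpha> = (\<Sum>\<beta>\<in>simples D. co \<alpha> \<beta> *\<^sub>R \<beta>)"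
    using co_expand roots_span by blast
  ultimately show "\<alpha> \<in> P" unfolding pos_roots_def by blast
qed

lemma co_eq_0: "v \<in> span (simples D) \<Longrightarrow> (\<forall>\<gamma>. co v \<gamma> = 0) \<Longrightarrow> v = 0"
  by (subst co_expand) simp_all

lemma pos_not_neg: "\<alpha> \<in> P \<Longrightarrow> - \<alpha> \<notin> P"
proof
  assume a: "\<alpha> \<in> P" "- \<alpha> \<in> P"
  have "co \<alpha> \<gamma> = 0" for \<gamma>
  proof -
    have "0 \<le> co \<alpha> \<gamma>" "0 \<le> co (- \<alpha>) \<gamma>" using a P_iff by blast+
    then show ?thesis using co_neg[of \<alpha> \<gamma>] P_span a by force
  qed
  then have "\<alpha> = 0" using co_eq_0 P_span a by blast
  with a P_roots zero_notin_roots show False by blast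
qed

lemma not_pos_iff: "\<alpha> \<in> roots D \<Longrightarrow> \<alpha> \<notin> P \<longleftrightarrow> - \<alpha> \<in> P"
  using roots_pos_or_neg pos_not_neg by blast

lemma finite_P: "finite P"
  using finite_subset[OF P_roots finite_roots] .

lemma pos_other_coeff:
  assumes "\<beta> \<in> P" "\<alpha> \<in> simples D" "\<beta> \<noteq> \<alpha>"
  obtains \<gamma> where "\<gamma> \<in> simples D" "\<gamma> \<noteq> \<alpha>" "0 < co \<beta> \<gamma>"
proof -
  have "\<exists>\<gamma>. \<gamma> \<noteq> \<alpha> \<and> co \<beta> \<gamma> \<noteq> 0"
  proof (rule ccontr)
    assume "\<not> ?thesis"
    then have "co \<beta> \<gamma> *\<^sub>R \<gamma> = (if \<gamma> = \<alpha> then co \<beta> \<alpha> *\<^sub>R \<alpha> else 0)" for \<gamma> by auto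
    then have "(\<Sum>\<gamma>\<in>simples D. co \<beta> \<gamma> *\<^sub>R \<gamma>) =
        (\<Sum>\<gamma>\<in>simples D. if \<gamma> = \<alpha> then co \<beta> \<alpha> *\<^sub>R \<alpha> else 0)"
      by (intro sum.cong) auto
    also have "\<dots> = co \<beta> \<alpha> *\<^sub>R \<alpha>"
      using assms finite_simples by (simp add: sum.delta)
    finally have "(\<Sum>\<gamma>\<in>simples D. co \<beta> \<gamma> *\<^sub>R \<gamma>) = co \<beta> \<alpha> *\<^sub>R \<alpha>" .
    then have e: "\<beta> = co \<beta> \<alpha> *\<^sub>R \<alpha>"
      using co_expand[of \<beta>] assms P_span by force
    have "co \<beta> \<alpha> *\<^sub>R \<alpha> \<in> roots D" using assms P_roots by (metis e subsetD)
    then have "co \<beta> \<alpha> = 1 \<or> co \<beta> \<alpha> = -1"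
      using reduced simples_roots assms(2) by blast
    moreover have "co \<beta> \<alpha> \<noteq> -1" using assms P_iff[of \<beta>] by (metis neg_0_le_iff_le not_one_le_zero)
    ultimately show False using e assms(3) by (metis scaleR_one)
  qed
  then obtain \<gamma> where "\<gamma> \<noteq> \<alpha>" "co \<beta> \<gamma> \<noteq> 0" by blast
  moreover have "0 \<le> co \<beta> \<gamma>" using assms P_iff by blast
  ultimately show thesis using that[of \<gamma>] co_outside[of \<gamma> \<beta>] by force
qed

lemma co_refl:
  assumes "\<alpha> \<in> simples D" "v \<in> span (simples D)"
  shows "co (refl D \<alpha> v) \<gamma> = co v \<gamma> - (if \<gamma> = \<alpha> then pairing D v (coroot D \<alpha>) else 0)"
  using assms by (simp add: refl_def co_diff co_scale co_simple span_base span_scale)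

text \<open>The reflection changes only the coefficient at \<open>\<alpha>\<close>.  Since the root system is reduced, \<open>\<beta> \<noteq> \<alpha>\<close> has
a positive coefficient elsewhere, and it stays positive.\<close>

lemma simple_refl_pos:
  assumes "\<alpha> \<in> simples D" "\<beta> \<in> P" "\<beta> \<noteq> \<alpha>"
  shows "refl D \<alpha> \<beta> \<in> P"
proof (rule ccontr)
  assume n: "refl D \<alpha> \<beta> \<notin> P"
  obtain \<gamma> where g: "\<gamma> \<in> simples D" "\<gamma> \<noteq> \<alpha>" "0 < co \<beta> \<gamma>"
    using pos_other_coeff assms by blast
  have r: "refl D \<alpha> \<beta> \<in> roots D"
    using assms simples_roots P_roots refl_roots by blast
  with n have "- refl D \<alpha> \<beta> \<in> P" using not_pos_iff by blast
  then have "0 \<le> co (- refl D \<alpha> \<beta>) \<gamma>" using P_iff by blast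
  moreover have "co (- refl D \<alpha> \<beta>) \<gamma> = - co \<beta> \<gamma>"
    using r roots_span assms g P_span by (simp add: co_neg co_refl subset_iff)
  ultimately show False using g by simp
qed

lemma span_par_iff:
  assumes "M \<subseteq> simples D"
  shows "v \<in> span M \<longleftrightarrow> v \<in> span (simples D) \<and> (\<forall>\<gamma>. \<gamma> \<notin> M \<longrightarrow> co v \<gamma> = 0)"
proof
  assume v: "v \<in> span M"
  have i: "independent M" using assms independent_simples independent_mono by blast
  have "co v \<gamma> = representation M v \<gamma>" for \<gamma>
    unfolding co_def
    using representation_extend[OF independent_simples v assms] by simp
  then have "co v \<gamma> = 0" if "\<gamma> \<notin> M" for \<gamma>
    using that representation_ne_zero[of M v \<gamma>] by metis
  then show "v \<in> span (simples D) \<and> (\<forall>\<gamma>. \<gamma> \<notin> M \<longrightarrow> co v \<gamma> = 0)"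
    using v span_mono[OF assms] by (meson subsetD)
next
  assume v: "v \<in> span (simples D) \<and> (\<forall>\<gamma>. \<gamma> \<notin> M \<longrightarrow> co v \<gamma> = 0)"
  then have "v = (\<Sum>\<gamma>\<in>simples D. co v \<gamma> *\<^sub>R \<gamma>)" using co_expand by blast
  also have "\<dots> \<in> span M"
  proof (intro span_sum)
    fix \<gamma> assume "\<gamma> \<in> simples D"
    show "co v \<gamma> *\<^sub>R \<gamma> \<in> span M"
      using v by (cases "\<gamma> \<in> M") (auto intro: span_base span_scale span_zero)
  qed
  finally show "v \<in> span M" .
qed

abbreviation WP where "WP M \<equiv> weyl_par D M"
abbreviation RP where "RP M \<equiv> roots_par D M"

lemma RP_iff: "M \<subseteq> simples D \<Longrightarrow> \<beta> \<in> RP M \<longleftrightarrow> \<beta> \<in> roots D \<and> (\<forall>\<gamma>. \<gamma> \<notin> M \<longrightarrow> co \<beta> \<gamma> = 0)"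
  unfolding roots_par_def using span_par_iff[of M \<beta>] roots_span by blast

lemma RP_neg: "M \<subseteq> simples D \<Longrightarrow> \<beta> \<in> RP M \<Longrightarrow> - \<beta> \<in> RP M"
  by (auto simp: roots_par_def neg_root span_neg)

lemma M_RP: "M \<subseteq> simples D \<Longrightarrow> M \<subseteq> RP M"
  using simples_roots by (auto simp: roots_par_def span_base)

lemma RP_simples: "RP (simples D) = roots D"
  using roots_span by (auto simp: roots_par_def)

lemma WP_W: "M \<subseteq> simples D \<Longrightarrow> u \<in> WP M \<Longrightarrow> u \<in> W"
  unfolding weyl_par_def weyl_def using refl_group_mono simples_roots by blast

lemma id_WP [simp]: "id \<in> WP M"
  by (simp add: weyl_par_def refl_group.id)
lemma comp_WP: "u \<in> WP M \<Longrightarrow> w \<in> WP M \<Longrightarrow> u \<circ> w \<in> WP M"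
  by (simp add: weyl_par_def refl_group_comp)
lemma inv_WP: "M \<subseteq> simples D \<Longrightarrow> w \<in> WP M \<Longrightarrow> inv w \<in> WP M"
  using refl_group_bij_inv[of w M] simples_roots by (auto simp: weyl_par_def)
lemma refl_WP: "\<alpha> \<in> M \<Longrightarrow> refl D \<alpha> \<in> WP M"
  by (simp add: weyl_par_def refl_in_group)

lemma comp_WP_iff:
  assumes "M \<subseteq> simples D" "u \<in> WP M" "w \<in> W"
  shows "w \<circ> u \<in> WP M \<longleftrightarrow> w \<in> WP M" "u \<circ> w \<in> WP M \<longleftrightarrow> w \<in> WP M"
proof -
  have u: "u \<in> W" using assms WP_W by blast
  have "w = (w \<circ> u) \<circ> inv u" "w = inv u \<circ> (u \<circ> w)"
    using u by (auto simp: fun_eq_iff)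
  then show "w \<circ> u \<in> WP M \<longleftrightarrow> w \<in> WP M" "u \<circ> w \<in> WP M \<longleftrightarrow> w \<in> WP M"
    using assms comp_WP inv_WP by metis+
qed

lemma span_simples_W: "w \<in> W \<Longrightarrow> v \<in> span (simples D) \<Longrightarrow> w v \<in> span (simples D)"
proof -
  assume w: "w \<in> W" and v: "v \<in> span (simples D)"
  have "w ` span (simples D) = span (w ` simples D)"
    using linear_W[OF w] by (simp add: linear_span_image)
  also have "\<dots> \<subseteq> span (simples D)"
    using w roots_span weyl_root simples_roots by (intro span_minimal) (auto simp: subset_iff)
  finally show ?thesis using v by blast
qed

text \<open>Each generating reflection subtracts a multiple of a simple root in \<open>M\<close>.\<close>

lemma co_WP:
  assumes "M \<subseteq> simples D" "u \<in> WP M" "v \<in> span (simples D)" "\<gamma> \<notin> M"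
  shows "co (u v) \<gamma> = co v \<gamma>"
  using assms(2) unfolding weyl_par_def
proof (induction u rule: refl_group.induct)
  case id
  show ?case by simp
next
  case (refl \<alpha> w)
  have "w v \<in> span (simples D)"
    using refl.hyps(2) assms span_simples_W WP_W unfolding weyl_par_def by blast
  with refl assms show ?case by (auto simp: co_refl subset_iff)
qed

lemma WP_RP:
  assumes "M \<subseteq> simples D" "u \<in> WP M" "\<beta> \<in> roots D"
  shows "u \<beta> \<in> RP M \<longleftrightarrow> \<beta> \<in> RP M"
  using assms co_WP[OF assms(1,2), of \<beta>] weyl_root[OF WP_W] roots_span
  by (auto simp: RP_iff subset_iff)

lemma WP_pos:
  assumes "M \<subseteq> simples D" "u \<in> WP M" "\<beta> \<in> P" "\<beta> \<notin> RP M"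
  shows "u \<beta> \<in> P - RP M"
proof -
  have b: "\<beta> \<in> roots D" "\<beta> \<in> span (simples D)" using assms P_roots roots_span by auto
  have u: "u \<beta> \<in> roots D" using assms b WP_W weyl_root by blast
  obtain \<gamma> where g: "\<gamma> \<notin> M" "co \<beta> \<gamma> \<noteq> 0" using assms b RP_iff by blast
  then have "0 < co (u \<beta>) \<gamma>"
    using co_WP[OF assms(1,2) b(2)] assms(3) P_iff by (metis order_less_le)
  then have "- u \<beta> \<notin> P"
    using u roots_span P_iff[of "- u \<beta>"] co_neg[of "u \<beta>" \<gamma>]
    by (metis neg_0_le_iff_le not_le subsetD)
  then show ?thesis using u not_pos_iff WP_RP assms b by blast
qed

text \<open>In the orbit of a positive root under \<open>W\<^sub>M\<close> take one of least height.  Being a nonnegative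
combination of \<open>M\<close> of positive norm, it pairs positively with some \<open>\<alpha>\<close> in \<open>M\<close>.  Reflecting in \<open>\<alpha>\<close>
lowers the height, so the root has to be \<open>\<alpha>\<close> itself and its reflection a conjugate of a generator.\<close>

lemma refl_RP_WP:
  assumes M: "M \<subseteq> simples D" and b: "\<beta> \<in> RP M"
  shows "refl D \<beta> \<in> WP M"
proof -
  have main: "refl D \<beta> \<in> WP M" if b: "\<beta> \<in> RP M" "\<beta> \<in> P" for \<beta>
  proof -
    define S where "S = (\<lambda>u. u \<beta>) ` WP M \<inter> P"
    define ht where "ht v = (\<Sum>\<gamma>\<in>simples D. co v \<gamma>)" for v
    have "finite S" using finite_P by (simp add: S_def)
    moreover have "\<beta> \<in> S" using b by (auto simp: S_def intro: image_eqI[of _ _ id])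
    ultimately obtain \<beta>' where m: "\<beta>' \<in> S" "\<forall>x\<in>S. ht \<beta>' \<le> ht x"
      by (metis (no_types, lifting) arg_min_if_finite(1,2) empty_iff linorder_not_less)
    then obtain u where u: "u \<in> WP M" "\<beta>' = u \<beta>" and b': "\<beta>' \<in> P" by (auto simp: S_def)
    have uW: "u \<in> W" using u M WP_W by blast
    have bR: "\<beta> \<in> roots D" using b P_roots by blast
    have b'R: "\<beta>' \<in> roots D" "\<beta>' \<in> RP M" using b' P_roots WP_RP M u b by auto
    have "\<exists>\<alpha>\<in>M. 0 < bform \<alpha> \<beta>'"
    proof (rule ccontr)
      assume "\<not> ?thesis"
      then have n: "bform \<alpha> \<beta>' \<le> 0" if "\<alpha> \<in> M" for \<alpha> using that by (meson not_less)
      have "bform \<beta>' \<beta>' = (\<Sum>\<gamma>\<in>simples D. co \<beta>' \<gamma> * bform \<gamma> \<beta>')"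
      proof -
        have e: "\<beta>' = (\<Sum>\<gamma>\<in>simples D. co \<beta>' \<gamma> *\<^sub>R \<gamma>)"
          using co_expand roots_span b'R by blast
        have "bform (\<Sum>\<gamma>\<in>simples D. co \<beta>' \<gamma> *\<^sub>R \<gamma>) \<beta>' = (\<Sum>\<gamma>\<in>simples D. co \<beta>' \<gamma> * bform \<gamma> \<beta>')"
          by (simp add: linear_sum[OF linear_bform] linear_scale[OF linear_bform])
        then show ?thesis by (simp only: e[symmetric])
      qed
      also have "\<dots> \<le> 0"
      proof (intro sum_nonpos)
        fix \<gamma> assume "\<gamma> \<in> simples D"
        show "co \<beta>' \<gamma> * bform \<gamma> \<beta>' \<le> 0"
          using n[of \<gamma>] b' P_iff b'R RP_iff[OF M] by (cases "\<gamma> \<in> M") (auto simp: mult_nonneg_nonpos)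
      qed
      finally show False using bform_root_pos[OF b'R(1)] by simp
    qed
    then obtain \<alpha> where a: "\<alpha> \<in> M" "0 < bform \<alpha> \<beta>'" by blast
    have aR: "\<alpha> \<in> roots D" "\<alpha> \<in> simples D" using a M simples_roots by auto
    have "\<beta>' = \<alpha>"
    proof (rule ccontr)
      assume ne: "\<beta>' \<noteq> \<alpha>"
      then have p: "refl D \<alpha> \<beta>' \<in> P" using simple_refl_pos aR b' by blast
      have "refl D \<alpha> \<circ> u \<in> WP M" using a u refl_WP comp_WP by blast
      then have "refl D \<alpha> \<beta>' \<in> S" using p u by (auto simp: S_def intro!: image_eqI[of _ _ "refl D \<alpha> \<circ> u"])
      then have "ht \<beta>' \<le> ht (refl D \<alpha> \<beta>')" using m by blast
      also have "\<dots> = ht \<beta>' - pairing D \<beta>' (coroot D \<alpha>)"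
        using aR b'R roots_span finite_simples
        by (simp add: ht_def co_refl subset_iff sum_subtractf sum.delta)
      finally have "pairing D \<beta>' (coroot D \<alpha>) \<le> 0" by simp
      moreover have "0 < pairing D \<beta>' (coroot D \<alpha>) * bform \<alpha> \<alpha>"
        using pairing_coroot_bform[OF aR(1), of \<beta>'] a bform_sym by simp
      ultimately show False
        using bform_root_pos[OF aR(1)] by (simp add: zero_less_mult_iff)
    qed
    then have "refl D \<alpha> = u \<circ> refl D \<beta> \<circ> inv u" using u refl_weyl_conj[OF uW bR] by simp
    then have "refl D \<beta> = inv u \<circ> refl D \<alpha> \<circ> u" using uW by (simp add: fun_eq_iff)
    then show ?thesis using u a M inv_WP refl_WP comp_WP by metis
  qed
  have bR: "\<beta> \<in> roots D" using b by (simp add: roots_par_def)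
  show ?thesis
  proof (cases "\<beta> \<in> P")
    case False
    then have n: "- \<beta> \<in> P" "- \<beta> \<in> RP M" using bR not_pos_iff RP_neg M b by auto
    have "refl D \<beta> = refl D (- \<beta>)"
    proof -
      have "refl D (- \<beta>) = refl D (refl D \<beta> \<beta>)" by (simp add: refl_self bR)
      also have "\<dots> = refl D \<beta> \<circ> refl D \<beta> \<circ> inv (refl D \<beta>)"
        by (rule refl_weyl_conj[OF refl_W[OF bR] bR])
      also have "\<dots> = refl D \<beta>" using bR by (simp add: inv_refl)
      finally show ?thesis by simp
    qed
    then show ?thesis using main[OF n(2,1)] by simp
  next
    case True
    then show ?thesis using main[OF b] by simp
  qed
qed

lemma WP_simples: "WP (simples D) = W"
proof
  show "W \<subseteq> WP (simples D)"
  proof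
    fix w assume "w \<in> W"
    then show "w \<in> WP (simples D)"
      unfolding weyl_def
    proof (induction w rule: refl_group.induct)
      case id
      show ?case by (rule id_WP)
    next
      case (refl \<alpha> w)
      then show ?case using refl_RP_WP[of "simples D" \<alpha>] RP_simples comp_WP by blast
    qed
  qed
qed (use WP_W in blast)

end

context root_system
begin

section \<open>Inversions and length\<close>

definition Inv :: "('v \<Rightarrow> 'v) \<Rightarrow> 'v set" where
  "Inv w = {\<gamma> \<in> P. - w \<gamma> \<in> P}"

abbreviation N where "N w \<equiv> card (Inv w)"

lemma finite_Inv: "finite (Inv w)"
  using finite_P by (simp add: Inv_def)

lemma pos_or_neg_W: "w \<in> W \<Longrightarrow> \<gamma> \<in> roots D \<Longrightarrow> - w \<gamma> \<in> P \<longleftrightarrow> w \<gamma> \<notin> P"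
  using not_pos_iff[OF weyl_root] by blast

lemma Inv_W: "w \<in> W \<Longrightarrow> Inv w = {\<gamma> \<in> P. w \<gamma> \<notin> P}"
  using pos_or_neg_W P_roots by (auto simp: Inv_def)

lemma Inv_id: "Inv id = {}"
  using pos_not_neg by (auto simp: Inv_def)

text \<open>The reflection \<open>s\<^sub>\<alpha>\<close> permutes the positive roots other than \<open>\<alpha>\<close>.\<close>

lemma Inv_refl_right:
  assumes w: "w \<in> W" and a: "\<alpha> \<in> simples D" "w \<alpha> \<in> P"
  shows "Inv (w \<circ> refl D \<alpha>) = insert \<alpha> (refl D \<alpha> ` Inv w)" "\<alpha> \<notin> refl D \<alpha> ` Inv w"
proof -
  have aR: "\<alpha> \<in> roots D" "\<alpha> \<in> P" using a simples_roots simples_pos by auto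
  have sa: "refl D \<alpha> \<alpha> = - \<alpha>" by (simp add: refl_self aR)
  have wn: "w (- \<alpha>) = - w \<alpha>" by (simp add: neg_W w)
  have an: "\<alpha> \<notin> Inv w" using a pos_not_neg by (auto simp: Inv_def)
  show "\<alpha> \<notin> refl D \<alpha> ` Inv w"
  proof
    assume "\<alpha> \<in> refl D \<alpha> ` Inv w"
    then obtain \<gamma> where "\<gamma> \<in> Inv w" "\<alpha> = refl D \<alpha> \<gamma>" by blast
    then have "\<gamma> = - \<alpha>" using sa aR refl_refl by metis
    with \<open>\<gamma> \<in> Inv w\<close> pos_not_neg aR show False by (auto simp: Inv_def)
  qed
  show "Inv (w \<circ> refl D \<alpha>) = insert \<alpha> (refl D \<alpha> ` Inv w)"
  proof (intro equalityI subsetI)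
    fix \<gamma> assume g: "\<gamma> \<in> Inv (w \<circ> refl D \<alpha>)"
    show "\<gamma> \<in> insert \<alpha> (refl D \<alpha> ` Inv w)"
    proof (cases "\<gamma> = \<alpha>")
      case False
      then have "refl D \<alpha> \<gamma> \<in> P" using g a simple_refl_pos by (auto simp: Inv_def)
      then have "refl D \<alpha> \<gamma> \<in> Inv w" using g by (auto simp: Inv_def)
      then show ?thesis using refl_refl[OF aR(1), of \<gamma>] by (metis imageI insertI2)
    qed simp
  next
    fix \<gamma> assume "\<gamma> \<in> insert \<alpha> (refl D \<alpha> ` Inv w)"
    then consider "\<gamma> = \<alpha>" | \<delta> where "\<delta> \<in> Inv w" "\<gamma> = refl D \<alpha> \<delta>" by blast
    then show "\<gamma> \<in> Inv (w \<circ> refl D \<alpha>)"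
    proof cases
      case 1
      then show ?thesis using a aR by (simp add: Inv_def sa wn)
    next
      case 2
      then have "\<delta> \<noteq> \<alpha>" using an by blast
      then show ?thesis using 2 a simple_refl_pos aR by (auto simp: Inv_def)
    qed
  qed
qed

lemma N_refl_right:
  assumes "w \<in> W" "\<alpha> \<in> simples D" "w \<alpha> \<in> P"
  shows "N (w \<circ> refl D \<alpha>) = Suc (N w)"
proof -
  have "inj_on (refl D \<alpha>) (Inv w)"
    using assms simples_roots by (metis inj_onI refl_refl subsetD)
  then show ?thesis
    using Inv_refl_right[OF assms] finite_Inv by (simp add: card_image)
qed

lemma N_refl_right_neg:
  assumes "w \<in> W" "\<alpha> \<in> simples D" "w \<alpha> \<notin> P"
  shows "N w = Suc (N (w \<circ> refl D \<alpha>))"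
proof -
  have aR: "\<alpha> \<in> roots D" using assms simples_roots by auto
  let ?u = "w \<circ> refl D \<alpha>"
  have "?u \<in> W" using assms aR comp_W refl_W by blast
  moreover have "?u \<alpha> \<in> P"
    using assms aR not_pos_iff[OF weyl_root] by (simp add: refl_self neg_W)
  moreover have "?u \<circ> refl D \<alpha> = w" using aR by (simp add: comp_assoc)
  ultimately show ?thesis using N_refl_right[of ?u \<alpha>] assms by simp
qed

lemma co_linear_expand:
  assumes f: "linear f" and fs: "\<And>\<gamma>. \<gamma> \<in> simples D \<Longrightarrow> f \<gamma> \<in> span (simples D)"
    and v: "v \<in> span (simples D)"
  shows "co (f v) \<delta> = (\<Sum>\<gamma>\<in>simples D. co v \<gamma> * co (f \<gamma>) \<delta>)"
proof -
  have "f v = f (\<Sum>\<gamma>\<in>simples D. co v \<gamma> *\<^sub>R \<gamma>)" using co_expand[OF v] by simp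
  also have "\<dots> = (\<Sum>\<gamma>\<in>simples D. co v \<gamma> *\<^sub>R f \<gamma>)"
    using f by (simp add: linear_sum linear_scale)
  finally have e: "f v = (\<Sum>\<gamma>\<in>simples D. co v \<gamma> *\<^sub>R f \<gamma>)" .
  have "co (\<Sum>\<gamma>\<in>A. co v \<gamma> *\<^sub>R f \<gamma>) \<delta> = (\<Sum>\<gamma>\<in>A. co v \<gamma> * co (f \<gamma>) \<delta>) \<and>
      (\<Sum>\<gamma>\<in>A. co v \<gamma> *\<^sub>R f \<gamma>) \<in> span (simples D)"
    if "finite A" "A \<subseteq> simples D" for A
    using that
  proof (induction A rule: finite_induct)
    case empty
    then show ?case
      using independent_simples by (simp add: co_def representation_zero span_zero)
  next
    case (insert x A)
    then have "f x \<in> span (simples D)" using fs by auto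
    with insert show ?case by (simp add: co_add co_scale span_scale span_add)
  qed
  from this[OF finite_simples order.refl] show ?thesis unfolding e by blast
qed

lemma co_W_expand:
  assumes w: "w \<in> W" and v: "v \<in> span (simples D)"
  shows "co (w v) \<delta> = (\<Sum>\<gamma>\<in>simples D. co v \<gamma> * co (w \<gamma>) \<delta>)"
  by (rule co_linear_expand[OF linear_W[OF w] _ v]) (simp add: span_simples_W[OF w] span_base)

lemma RP_pos_mono:
  assumes M: "M \<subseteq> simples D" and w: "w \<in> W" and p: "\<And>\<alpha>. \<alpha> \<in> M \<Longrightarrow> w \<alpha> \<in> P"
    and b: "\<beta> \<in> RP M" "\<beta> \<in> P"
  shows "w \<beta> \<in> P"
proof -
  have bs: "\<beta> \<in> span (simples D)" "\<beta> \<in> roots D" using b P_span P_roots by auto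
  have "0 \<le> co \<beta> \<gamma> * co (w \<gamma>) \<delta>" for \<gamma> \<delta>
    using p[of \<gamma>] P_iff b RP_iff[OF M] by (cases "\<gamma> \<in> M") auto
  then have "0 \<le> co (w \<beta>) \<delta>" for \<delta>
    unfolding co_W_expand[OF w bs(1)] by (intro sum_nonneg) auto
  then show ?thesis using P_iff weyl_root[OF w bs(2)] by auto
qed

lemma RP_neg_mono:
  assumes M: "M \<subseteq> simples D" and w: "w \<in> W" and p: "\<And>\<alpha>. \<alpha> \<in> M \<Longrightarrow> w \<alpha> \<notin> P"
    and b: "\<beta> \<in> RP M" "\<beta> \<in> P"
  shows "- w \<beta> \<in> P"
proof -
  have bs: "\<beta> \<in> span (simples D)" "\<beta> \<in> roots D" using b P_span P_roots by auto
  have "co \<beta> \<gamma> * co (w \<gamma>) \<delta> \<le> 0" for \<gamma> \<delta>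
  proof (cases "\<gamma> \<in> M")
    case True
    then have g: "\<gamma> \<in> roots D" "\<gamma> \<in> simples D" using M simples_roots by auto
    then have "- w \<gamma> \<in> P" using pos_or_neg_W[OF w] p True by blast
    then have "co (w \<gamma>) \<delta> \<le> 0"
      using P_iff[of "- w \<gamma>"] co_neg[of "w \<gamma>" \<delta>] span_simples_W[OF w] g span_base
      by (metis neg_0_le_iff_le)
    then show ?thesis using b P_iff by (simp add: mult_nonneg_nonpos)
  next
    case False
    then show ?thesis using RP_iff[OF M] b by simp
  qed
  then have "co (w \<beta>) \<delta> \<le> 0" for \<delta>
    unfolding co_W_expand[OF w bs(1)] by (intro sum_nonpos) auto
  then show ?thesis
    using P_iff[of "- w \<beta>"] co_neg[of "w \<beta>"] span_simples_W[OF w bs(1)] neg_root weyl_root[OF w bs(2)]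
    by (metis neg_0_le_iff_le)
qed

lemma N_zero_simple:
  assumes w: "w \<in> W" and p: "\<forall>\<alpha>\<in>simples D. w \<alpha> \<in> P"
  shows "Inv w = {}"
  using RP_pos_mono[OF order.refl w] p RP_simples P_roots Inv_W[OF w] by blast

lemma Inv_simple:
  assumes "w \<in> W" "N w > 0"
  obtains \<alpha> where "\<alpha> \<in> simples D" "w \<alpha> \<notin> P"
  using N_zero_simple assms by fastforce

section \<open>Words\<close>

lemma word_prod_Nil [simp]: "word_prod D [] = id"
  by (simp add: word_prod_def)
lemma word_prod_Cons [simp]: "word_prod D (a # as) = refl D a \<circ> word_prod D as"
  by (simp add: word_prod_def)
lemma word_prod_append: "word_prod D (as @ bs) = word_prod D as \<circ> word_prod D bs"
  by (induction as) (simp_all add: comp_assoc)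

lemma word_prod_W: "set as \<subseteq> simples D \<Longrightarrow> word_prod D as \<in> W"
proof (induction as)
  case Nil
  show ?case using id_W by (simp only: word_prod_Nil)
next
  case (Cons a as)
  then have "refl D a \<in> W" "word_prod D as \<in> W" using simples_roots refl_W by auto
  then show ?case using comp_W by (metis word_prod_Cons)
qed

lemma word_prod_rev: "set as \<subseteq> simples D \<Longrightarrow> word_prod D (rev as) = inv (word_prod D as)"
proof (induction as)
  case Nil
  show ?case by (simp only: rev.simps word_prod_Nil inv_id)
next
  case (Cons a as)
  have a: "a \<in> roots D" "refl D a \<in> W" using Cons simples_roots refl_W by auto
  then show ?case
    using Cons word_prod_W[of as] inv_comp_distrib[OF a(2)] inv_refl[OF a(1)]
    by (simp only: rev.simps word_prod_append word_prod_Cons word_prod_Nil comp_id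
        list.set insert_subset simp_thms)
qed

text \<open>Apply the letters to \<open>\<alpha>\<close> from the right.  At the letter \<open>s\<^sub>a\<close> where the image turns negative it
was equal to \<open>a\<close>, so conjugation by the letters to the right of it carries \<open>s\<^sub>\<alpha>\<close> to \<open>s\<^sub>a\<close>, and the
two cancel.\<close>

lemma exchange:
  assumes "set as \<subseteq> simples D" "\<alpha> \<in> simples D" "word_prod D as \<alpha> \<notin> P"
  obtains bs where "set bs \<subseteq> set as" "length as = Suc (length bs)"
    "word_prod D bs = word_prod D as \<circ> refl D \<alpha>"
proof -
  have "\<exists>bs. set bs \<subseteq> set as \<and> length as = Suc (length bs) \<and>
    word_prod D bs = word_prod D as \<circ> refl D \<alpha>"
    using assms
  proof (induction as)
    case Nil
    then show ?case using simples_pos by auto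
  next
    case (Cons a as)
    define u where "u = word_prod D as"
    have u: "u \<in> W" using Cons word_prod_W by (simp add: u_def)
    have aR: "a \<in> simples D" "a \<in> roots D" "\<alpha> \<in> roots D" using Cons simples_roots by auto
    show ?case
    proof (cases "u \<alpha> \<in> P")
      case False
      then obtain bs where "set bs \<subseteq> set as" "length as = Suc (length bs)"
        "word_prod D bs = u \<circ> refl D \<alpha>"
        using Cons.IH Cons.prems unfolding u_def by (metis insert_subset list.simps(15))
      then show ?thesis
        by (intro exI[of _ "a # bs"]) (auto simp: u_def comp_assoc)
    next
      case True
      have "refl D a (u \<alpha>) \<notin> P" using Cons by (simp add: u_def)
      then have "u \<alpha> = a" using simple_refl_pos True aR by blast
      then have "refl D a \<circ> u = u \<circ> refl D \<alpha>" using refl_weyl[OF u aR(3)] by simp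
      then have "refl D a \<circ> u \<circ> refl D \<alpha> = u" using aR by (simp add: comp_assoc)
      then show ?thesis
        by (intro exI[of _ as]) (auto simp: u_def simp del: comp_apply)
    qed
  qed
  then show thesis using that by blast
qed

lemma N_word_le: "set as \<subseteq> simples D \<Longrightarrow> N (word_prod D as) \<le> length as"
proof (induction as rule: rev_induct)
  case Nil
  have "N id = 0" by (simp only: Inv_id card.empty)
  then show ?case by (simp only: word_prod_Nil list.size)
next
  case (snoc a as)
  let ?u = "word_prod D as"
  have u: "?u \<in> W" using snoc word_prod_W by simp
  have e: "word_prod D (as @ [a]) = ?u \<circ> refl D a" by (simp add: word_prod_append)
  show ?case
    using snoc N_refl_right[OF u, of a] N_refl_right_neg[OF u, of a]
    unfolding e by (cases "?u a \<in> P") (force simp del: comp_apply)+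
qed

lemma WP_word:
  assumes "w \<in> WP M"
  obtains as where "set as \<subseteq> M" "word_prod D as = w"
proof -
  from assms have "\<exists>as. set as \<subseteq> M \<and> word_prod D as = w"
    unfolding weyl_par_def
  proof (induction w rule: refl_group.induct)
    case id
    show ?case using word_prod_Nil by (intro exI[of _ "[]"]) (auto simp only: set_simps)
  next
    case (refl \<alpha> w)
    then obtain as where "set as \<subseteq> M" "word_prod D as = w" by blast
    then show ?case using refl by (intro exI[of _ "\<alpha> # as"]) auto
  qed
  then show thesis using that by blast
qed

lemma W_word:
  assumes "w \<in> W"
  obtains as where "set as \<subseteq> simples D" "word_prod D as = w"
  using WP_word[of w "simples D"] assms WP_simples by auto

text \<open>The last letter of a shortest word for \<open>w\<close> could be removed together with another one by the
exchange condition, because \<open>w\<close> keeps the root of this letter positive.\<close>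

lemma N_eq_0:
  assumes w: "w \<in> W" and n: "Inv w = {}"
  shows "w = id"
proof -
  define Q where "Q as \<longleftrightarrow> set as \<subseteq> simples D \<and> word_prod D as = w" for as
  obtain as0 where "Q as0" using W_word[OF w] unfolding Q_def by blast
  then obtain as where as: "Q as" "\<forall>bs. Q bs \<longrightarrow> length as \<le> length bs"
    using ex_has_least_nat[of Q as0 length] by blast
  show ?thesis
  proof (cases as rule: rev_cases)
    case Nil
    then show ?thesis using as by (auto simp: Q_def)
  next
    case (snoc as' a)
    let ?u = "word_prod D as'"
    have s: "set as' \<subseteq> simples D" "a \<in> simples D" "a \<in> roots D" "a \<in> P"
      using as snoc simples_roots simples_pos by (auto simp: Q_def)
    have e: "w = ?u \<circ> refl D a" using as snoc by (simp add: Q_def word_prod_append)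
    have "w a \<in> P" using n s Inv_W[OF w] by blast
    then have "- ?u a \<in> P"
      using s word_prod_W by (simp add: e refl_self neg_W)
    then have "?u a \<notin> P" using pos_not_neg by blast
    then obtain bs where "set bs \<subseteq> set as'" "length as' = Suc (length bs)"
      "word_prod D bs = ?u \<circ> refl D a"
      using exchange s by blast
    then have "Q bs" "length bs < length as" using s e snoc by (auto simp: Q_def)
    then show ?thesis using as(2) by (meson not_le)
  qed
qed

lemma word_of_length_N:
  assumes "w \<in> W"
  shows "\<exists>as. set as \<subseteq> simples D \<and> word_prod D as = w \<and> length as = N w"
  using assms
proof (induction "N w" arbitrary: w)
  case 0
  then have "w = id" using N_eq_0 finite_Inv by simp
  moreover have "N id = 0" by (simp only: Inv_id card.empty)
  ultimately have "set [] \<subseteq> simples D \<and> word_prod D [] = w \<and> length [] = N w"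
    by (simp only: word_prod_Nil list.size) simp
  then show ?case by blast
next
  case (Suc n)
  then obtain \<alpha> where a: "\<alpha> \<in> simples D" "w \<alpha> \<notin> P" using Inv_simple by (metis zero_less_Suc)
  let ?u = "w \<circ> refl D \<alpha>"
  have aR: "\<alpha> \<in> roots D" using a simples_roots by auto
  have u: "?u \<in> W" using Suc aR comp_W refl_W by blast
  have "n = N ?u" using N_refl_right_neg Suc a by simp
  then obtain as where "set as \<subseteq> simples D" "word_prod D as = ?u" "length as = n"
    using Suc u by metis
  then show ?case using a aR Suc
    by (intro exI[of _ "as @ [\<alpha>]"]) (simp add: word_prod_append comp_assoc)
qed

lemma len_eq_N:
  assumes "w \<in> W"
  shows "len D w = N w"
  unfolding len_def
proof (rule Least_equality)
  show "\<exists>as. set as \<subseteq> simples D \<and> length as = N w \<and> word_prod D as = w"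
    using word_of_length_N[OF assms] by blast
next
  fix n assume "\<exists>as. set as \<subseteq> simples D \<and> length as = n \<and> word_prod D as = w"
  then show "N w \<le> n" using N_word_le by blast
qed

lemma reduced_word_iff:
  "w \<in> W \<Longrightarrow> reduced_word D w as \<longleftrightarrow> set as \<subseteq> simples D \<and> word_prod D as = w \<and> length as = N w"
  by (simp add: reduced_word_def len_eq_N)

lemma reduced_word_exists: "w \<in> W \<Longrightarrow> \<exists>as. reduced_word D w as"
  using word_of_length_N reduced_word_iff by blast

lemma reduced_word_snoc:
  assumes "reduced_word D w (as @ [\<alpha>])" "w \<in> W"
  shows "reduced_word D (word_prod D as) as" "word_prod D as \<alpha> \<in> P" "word_prod D as \<in> W"
    "\<alpha> \<in> simples D" "w = word_prod D as \<circ> refl D \<alpha>"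
proof -
  let ?u = "word_prod D as"
  show s: "\<alpha> \<in> simples D" "w = ?u \<circ> refl D \<alpha>" and u: "?u \<in> W"
    using assms word_prod_W by (auto simp: reduced_word_def word_prod_append)
  have as: "set as \<subseteq> simples D" using assms by (auto simp: reduced_word_def)
  have l: "N w = Suc (length as)" using assms by (simp add: reduced_word_iff)
  have le: "N ?u \<le> length as" using N_word_le as by blast
  then show p: "?u \<alpha> \<in> P"
    using N_refl_right_neg[OF u s(1)] l s(2) by force
  then show "reduced_word D ?u as"
    using N_refl_right[OF u s(1)] l s(2) as u by (simp add: reduced_word_iff)
qed

text \<open>Appending a letter to a reduced word moves the inversions by a reflection and adds one simple
root.  This makes it the right induction for products over inversions.\<close>

lemma reduced_word_induct [consumes 2, case_names Nil snoc]:
  assumes "reduced_word D w as" "w \<in> W"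
    and "Q id []"
    and "\<And>u as \<alpha>. u \<in> W \<Longrightarrow> \<alpha> \<in> simples D \<Longrightarrow> u \<alpha> \<in> P \<Longrightarrow> reduced_word D u as \<Longrightarrow> Q u as \<Longrightarrow>
      Q (u \<circ> refl D \<alpha>) (as @ [\<alpha>])"
  shows "Q w as"
  using assms(1,2)
proof (induction as arbitrary: w rule: rev_induct)
  case Nil
  then have "w = id" by (simp only: reduced_word_def word_prod_Nil)
  then show ?case using assms(3) by blast
next
  case (snoc \<alpha> as)
  note r = reduced_word_snoc[OF snoc.prems]
  show ?case unfolding r(5) using assms(4) r(1-4) snoc.IH by blast
qed

section \<open>Longest elements and coset representatives\<close>

lemma WP_Inv: "M \<subseteq> simples D \<Longrightarrow> u \<in> WP M \<Longrightarrow> Inv u \<subseteq> RP M"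
proof
  fix \<gamma> assume "M \<subseteq> simples D" "u \<in> WP M" "\<gamma> \<in> Inv u"
  then have "\<gamma> \<in> P" "u \<gamma> \<notin> P" using pos_not_neg[of "u \<gamma>"] by (auto simp: Inv_def)
  then show "\<gamma> \<in> RP M" using WP_pos \<open>M \<subseteq> simples D\<close> \<open>u \<in> WP M\<close> by blast
qed

lemma WP_eq_id:
  assumes "M \<subseteq> simples D" "u \<in> WP M" "\<And>\<alpha>. \<alpha> \<in> M \<Longrightarrow> u \<alpha> \<in> P"
  shows "u = id"
proof (rule ccontr)
  assume "u \<noteq> id"
  have u: "u \<in> W" using assms WP_W by blast
  with \<open>u \<noteq> id\<close> have "Inv u \<noteq> {}" using N_eq_0 by blast
  then obtain \<alpha> where a: "\<alpha> \<in> simples D" "u \<alpha> \<notin> P"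
    using Inv_simple[OF u] finite_Inv by (metis card_gt_0_iff)
  then have "\<alpha> \<in> RP M" using WP_Inv[OF assms(1,2)] Inv_W[OF u] simples_pos by blast
  then have "\<alpha> \<in> M" using a RP_iff[OF assms(1)] co_simple by (metis zero_neq_one)
  then show False using assms a by blast
qed

text \<open>An element that fixes every root has no inversions, so an element is determined by the
permutation of the roots.\<close>

lemma finite_W: "finite W"
proof (rule inj_on_finite)
  show "inj_on (\<lambda>w. (\<lambda>r. (r, w r)) ` roots D) W"
  proof (rule inj_onI)
    fix u w assume u: "u \<in> W" and w: "w \<in> W"
      and e: "(\<lambda>r. (r, u r)) ` roots D = (\<lambda>r. (r, w r)) ` roots D"
    then have "u r = w r" if "r \<in> roots D" for r using that by blast
    then have "(inv u \<circ> w) r = r" if "r \<in> roots D" for r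
      using that u by (metis comp_apply inv_W_app(1))
    then have "Inv (inv u \<circ> w) = {}"
      using P_roots pos_not_neg unfolding Inv_def by (metis (no_types, lifting) Collect_empty_eq subsetD)
    then have "inv u \<circ> w = id" using N_eq_0 u w inv_W comp_W by blast
    then have "u \<circ> (inv u \<circ> w) = u" by simp
    then show "u = w" using u by simp
  qed
  show "(\<lambda>w. (\<lambda>r. (r, w r)) ` roots D) ` W \<subseteq> Pow (roots D \<times> roots D)"
    using weyl_root by auto
  show "finite (Pow (roots D \<times> roots D))" using finite_roots by simp
qed

lemma finite_WP: "M \<subseteq> simples D \<Longrightarrow> finite (WP M)"
  by (rule finite_subset[OF _ finite_W]) (auto dest: WP_W)

text \<open>Two elements that make all of \<open>M\<close> negative make all positive roots of the parabolic negative, so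
they differ by an element without inversions.\<close>

lemma WP_neg_unique:
  assumes M: "M \<subseteq> simples D" and w: "w \<in> WP M" "\<forall>\<alpha>\<in>M. w \<alpha> \<notin> P"
    and u: "u \<in> WP M" "\<forall>\<alpha>\<in>M. u \<alpha> \<notin> P"
  shows "w = u"
proof -
  have W: "w \<in> W" "u \<in> W" using M w u WP_W by auto
  have neg: "- x \<beta> \<in> P" if "x \<in> WP M" "\<forall>\<alpha>\<in>M. x \<alpha> \<notin> P" "\<beta> \<in> RP M" "\<beta> \<in> P" for x \<beta>
    using RP_neg_mono[OF M WP_W[OF M that(1)]] that by blast
  have "inv u \<circ> w = id"
  proof (rule WP_eq_id[OF M])
    show g: "inv u \<circ> w \<in> WP M" using M w u comp_WP inv_WP by blast
    fix \<alpha> assume a: "\<alpha> \<in> M"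
    have aP: "\<alpha> \<in> RP M" "\<alpha> \<in> P" "\<alpha> \<in> roots D" using a M M_RP simples_pos simples_roots by auto
    have wa: "- w \<alpha> \<in> P" using neg w aP by blast
    have r: "(inv u \<circ> w) \<alpha> \<in> RP M" using WP_RP[OF M g] aP by blast
    show "(inv u \<circ> w) \<alpha> \<in> P"
    proof (rule ccontr)
      assume "(inv u \<circ> w) \<alpha> \<notin> P"
      then have "- (inv u \<circ> w) \<alpha> \<in> P" using pos_or_neg_W WP_W[OF M g] aP by blast
      moreover have "- (inv u \<circ> w) \<alpha> \<in> RP M" using r RP_neg M by blast
      ultimately have "- u (- (inv u \<circ> w) \<alpha>) \<in> P" using neg u by blast
      then have "w \<alpha> \<in> P" using W by (simp add: neg_W)
      with wa pos_not_neg show False by blast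
    qed
  qed
  then have "u \<circ> (inv u \<circ> w) = u" by simp
  then show ?thesis using W by simp
qed

lemma longest_WP:
  assumes M: "M \<subseteq> simples D"
  shows "longest D (WP M) \<in> WP M" "\<forall>\<alpha>\<in>M. longest D (WP M) \<alpha> \<notin> P"
proof -
  have fM: "finite (WP M)" using M finite_WP by blast
  have l: "len D u = N u" if "u \<in> WP M" for u using that len_eq_N WP_W M by blast
  let ?L = "\<lambda>w. w \<in> WP M \<and> (\<forall>u\<in>WP M. len D u \<le> len D w)"
  have neg: "\<forall>\<alpha>\<in>M. w \<alpha> \<notin> P" if w: "?L w" for w
  proof
    fix \<alpha> assume a: "\<alpha> \<in> M"
    show "w \<alpha> \<notin> P"
    proof
      assume "w \<alpha> \<in> P"
      then have "N (w \<circ> refl D \<alpha>) = Suc (N w)" using N_refl_right w a M WP_W by blast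
      moreover have "w \<circ> refl D \<alpha> \<in> WP M" using w a comp_WP refl_WP by blast
      ultimately show False using w l by (metis not_less_eq_eq order_refl)
    qed
  qed
  have "\<exists>w. ?L w"
  proof -
    have ne: "len D ` WP M \<noteq> {}" using id_WP by blast
    obtain w where "w \<in> WP M" "len D w = Max (len D ` WP M)"
      using Max_in[OF _ ne] fM by (metis finite_imageI imageE)
    then show ?thesis using Max_ge[of "len D ` WP M"] fM by (metis finite_imageI imageI)
  qed
  then have "\<exists>!w. ?L w" using WP_neg_unique[OF M] neg by blast
  then have "?L (longest D (WP M))" unfolding longest_def by (rule theI')
  then show "longest D (WP M) \<in> WP M" "\<forall>\<alpha>\<in>M. longest D (WP M) \<alpha> \<notin> P" using neg by blast+
qed

lemma longest_neg:
  assumes M: "M \<subseteq> simples D" and b: "\<beta> \<in> RP M" "\<beta> \<in> P"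
  shows "- longest D (WP M) \<beta> \<in> P" "- inv (longest D (WP M)) \<beta> \<in> P"
proof -
  let ?l = "longest D (WP M)"
  note L = longest_WP[OF M]
  have lW: "?l \<in> W" using L M WP_W by blast
  have n: "- ?l \<beta> \<in> P" if "\<beta> \<in> RP M" "\<beta> \<in> P" for \<beta>
    using RP_neg_mono[OF M lW] L that by blast
  show "- ?l \<beta> \<in> P" using n b by blast
  have bR: "\<beta> \<in> roots D" using b P_roots by auto
  have "inv ?l \<beta> \<in> RP M" using WP_RP[OF M inv_WP[OF M L(1)] bR] b by blast
  then have "inv ?l \<beta> \<notin> P" using n[of "inv ?l \<beta>"] lW b pos_not_neg by auto
  then show "- inv ?l \<beta> \<in> P" using pos_or_neg_W[OF inv_W[OF lW] bR] by blast
qed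

text \<open>The inverse \<open>g\<close> writes \<open>\<alpha>\<close> as a nonnegative combination of the positive roots \<open>g \<gamma>\<close>, where \<open>\<gamma>\<close> runs
over the simple roots that occur in \<open>f \<alpha>\<close>.  Nothing cancels, so each of them is \<open>\<alpha>\<close>.\<close>

lemma simple_system_image:
  assumes M: "M \<subseteq> simples D" and f: "linear f" and g: "linear g"
    and gf: "\<And>v. g (f v) = v" and fg: "\<And>v. f (g v) = v"
    and gs: "\<And>\<gamma>. \<gamma> \<in> simples D \<Longrightarrow> g \<gamma> \<in> span (simples D)"
    and im: "\<And>\<beta>. \<beta> \<in> RP M \<inter> P \<Longrightarrow> f \<beta> \<in> RP M \<inter> P"
    and im': "\<And>\<beta>. \<beta> \<in> RP M \<inter> P \<Longrightarrow> g \<beta> \<in> RP M \<inter> P"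
    and a: "\<alpha> \<in> M"
  shows "f \<alpha> \<in> M"
proof -
  have aR: "\<alpha> \<in> simples D" "\<alpha> \<in> RP M \<inter> P" using a M M_RP[OF M] simples_pos by auto
  then have b: "f \<alpha> \<in> RP M \<inter> P" using im by blast
  have bs: "f \<alpha> \<in> span (simples D)" using b P_span by auto
  have nn: "0 \<le> co (f \<alpha>) \<gamma>" for \<gamma> using b P_iff by blast
  have "\<exists>\<gamma>. co (f \<alpha>) \<gamma> \<noteq> 0"
  proof (rule ccontr)
    assume "\<not> ?thesis"
    then have "f \<alpha> = 0" using co_eq_0[OF bs] by blast
    then show False using b P_roots zero_notin_roots by auto
  qed
  then obtain \<gamma> where g0: "co (f \<alpha>) \<gamma> \<noteq> 0" by blast
  then have gM: "\<gamma> \<in> M" using b RP_iff[OF M] by blast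
  then have gR: "\<gamma> \<in> RP M \<inter> P" "\<gamma> \<in> simples D" using M M_RP[OF M] simples_pos by auto
  have gi: "g \<gamma> \<in> P" using im' gR by blast
  have nn': "0 \<le> co (f \<alpha>) \<epsilon> * co (g \<epsilon>) \<delta>" for \<epsilon> \<delta>
  proof (cases "\<epsilon> \<in> M")
    case True
    then have "\<epsilon> \<in> RP M \<inter> P" using M M_RP[OF M] simples_pos by auto
    then have "g \<epsilon> \<in> P" using im' by blast
    then show ?thesis using nn P_iff by simp
  next
    case False
    then show ?thesis using RP_iff[OF M] b by simp
  qed
  have "co (g \<gamma>) \<delta> = 0" if "\<delta> \<noteq> \<alpha>" for \<delta>
  proof -
    have "0 = co (g (f \<alpha>)) \<delta>" using gf aR that by (simp add: co_simple)
    also have "\<dots> = (\<Sum>\<epsilon>\<in>simples D. co (f \<alpha>) \<epsilon> * co (g \<epsilon>) \<delta>)"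
      by (rule co_linear_expand[OF g gs bs])
    finally have "(\<Sum>\<epsilon>\<in>simples D. co (f \<alpha>) \<epsilon> * co (g \<epsilon>) \<delta>) = 0" by simp
    then have "co (f \<alpha>) \<gamma> * co (g \<gamma>) \<delta> = 0"
      using sum_nonneg_eq_0_iff[OF finite_simples, of "\<lambda>\<epsilon>. co (f \<alpha>) \<epsilon> * co (g \<epsilon>) \<delta>"] nn' gR by blast
    then show ?thesis using g0 by simp
  qed
  then have "g \<gamma> = \<alpha>" using pos_other_coeff[OF gi aR(1)] by (metis less_irrefl)
  then have "f \<alpha> = \<gamma>" using fg by auto
  then show ?thesis using gM by simp
qed

abbreviation J where "J M \<equiv> min_reps D M"

text \<open>If \<open>x\<close> keeps the positive roots of the parabolic positive, all its inversions lie outside the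
parabolic, where \<open>W\<^sub>M\<close> permutes the positive roots; so \<open>x u\<close> has at least as many inversions.\<close>

lemma J_iff:
  assumes M: "M \<subseteq> simples D"
  shows "x \<in> J M \<longleftrightarrow> x \<in> W \<and> (\<forall>\<beta>\<in>RP M \<inter> P. x \<beta> \<in> P)"
proof
  assume x: "x \<in> J M"
  then have xW: "x \<in> W" by (simp add: min_reps_def)
  have "x \<alpha> \<in> P" if a: "\<alpha> \<in> M" for \<alpha>
  proof (rule ccontr)
    assume "x \<alpha> \<notin> P"
    then have "N x = Suc (N (x \<circ> refl D \<alpha>))" using N_refl_right_neg xW a M by blast
    moreover have "x \<circ> refl D \<alpha> \<in> W" using xW a M simples_roots comp_W refl_W by blast
    moreover have "len D x \<le> len D (x \<circ> refl D \<alpha>)"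
      using x refl_WP a by (auto simp: min_reps_def)
    ultimately show False using xW by (simp add: len_eq_N)
  qed
  then show "x \<in> W \<and> (\<forall>\<beta>\<in>RP M \<inter> P. x \<beta> \<in> P)" using RP_pos_mono[OF M xW] xW by blast
next
  assume x: "x \<in> W \<and> (\<forall>\<beta>\<in>RP M \<inter> P. x \<beta> \<in> P)"
  have "len D x \<le> len D (x \<circ> u)" if u: "u \<in> WP M" for u
  proof -
    have uW: "u \<in> W" "inv u \<in> WP M" using u M WP_W inv_WP by auto
    have sub: "Inv x \<subseteq> P - RP M" using x pos_not_neg by (auto simp: Inv_def)
    have "inv u ` Inv x \<subseteq> Inv (x \<circ> u)"
    proof
      fix \<gamma> assume "\<gamma> \<in> inv u ` Inv x"
      then obtain \<delta> where d: "\<delta> \<in> Inv x" "\<gamma> = inv u \<delta>" by blast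
      then have "\<gamma> \<in> P" using WP_pos[OF M uW(2)] sub by blast
      moreover have "u \<gamma> = \<delta>" using d uW by simp
      ultimately show "\<gamma> \<in> Inv (x \<circ> u)" using d by (auto simp: Inv_def)
    qed
    moreover have "card (inv u ` Inv x) = N x"
      using uW bij_W WP_W M by (intro card_image) (meson bij_is_inj inj_on_subset subset_UNIV)
    ultimately have "N x \<le> N (x \<circ> u)" using card_mono[OF finite_Inv] by metis
    then show ?thesis using x uW comp_W by (simp add: len_eq_N)
  qed
  then show "x \<in> J M" using x by (simp add: min_reps_def)
qed

lemma id_J: "M \<subseteq> simples D \<Longrightarrow> id \<in> J M"
  using J_iff[of M id] id_W by (simp del: id_W)

lemma J_decomp:
  assumes M: "M \<subseteq> simples D" and w: "w \<in> W"
  obtains x where "x \<in> J M" "inv x \<circ> w \<in> WP M"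
proof -
  obtain u where u: "u \<in> WP M" "\<forall>u'\<in>WP M. len D (w \<circ> u) \<le> len D (w \<circ> u')"
    using ex_has_least_nat[of "\<lambda>u. u \<in> WP M" id "\<lambda>u. len D (w \<circ> u)"] id_WP by blast
  have uW: "u \<in> W" using u M WP_W by auto
  have "w \<circ> u \<in> J M"
    unfolding min_reps_def using u w uW comp_W comp_WP by (auto simp: comp_assoc)
  moreover have "inv (w \<circ> u) \<circ> w = inv u"
    using w uW by (simp add: inv_comp_distrib comp_assoc)
  ultimately show thesis using that[of "w \<circ> u"] u inv_WP[OF M] by simp
qed

lemma J_unique:
  assumes M: "M \<subseteq> simples D" and x: "x \<in> J M" and y: "y \<in> J M" and u: "inv y \<circ> x \<in> WP M"
  shows "x = y"
proof -
  have W: "x \<in> W" "y \<in> W" using x y J_iff[OF M] by auto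
  have uW: "inv y \<circ> x \<in> W" using W inv_W comp_W by blast
  have "inv y \<circ> x = id"
  proof (rule WP_eq_id[OF M u])
    fix \<alpha> assume a: "\<alpha> \<in> M"
    have aR: "\<alpha> \<in> RP M \<inter> P" "\<alpha> \<in> roots D" using a M M_RP simples_pos simples_roots by auto
    show "(inv y \<circ> x) \<alpha> \<in> P"
    proof (rule ccontr)
      assume n: "(inv y \<circ> x) \<alpha> \<notin> P"
      then have "- (inv y \<circ> x) \<alpha> \<in> P" using pos_or_neg_W[OF uW aR(2)] by blast
      moreover have "- (inv y \<circ> x) \<alpha> \<in> RP M" using WP_RP[OF M u aR(2)] RP_neg[OF M] aR by blast
      ultimately have "y (- (inv y \<circ> x) \<alpha>) \<in> P" using y J_iff[OF M] by blast
      then have "- x \<alpha> \<in> P" using W by (simp add: neg_W)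
      then show False using x J_iff[OF M] aR pos_not_neg by blast
    qed
  qed
  then have "y \<circ> (inv y \<circ> x) = y" by simp
  then show ?thesis using W by simp
qed

section \<open>The element exchanging a parabolic with its dual\<close>

context
  fixes M
  assumes M: "M \<subseteq> simples D"
begin

abbreviation (input) w0 where "w0 \<equiv> longest D W"
abbreviation (input) cc where "cc \<equiv> w_up D M"
abbreviation (input) dM where "dM \<equiv> delta D M"

lemma w0_W: "w0 \<in> W"
  using longest_WP[OF order.refl] by (simp add: WP_simples)

lemma w0_neg: "\<beta> \<in> P \<Longrightarrow> - w0 \<beta> \<in> P" "\<beta> \<in> P \<Longrightarrow> - inv w0 \<beta> \<in> P"
  using longest_neg[OF order.refl, of \<beta>] P_roots by (auto simp: WP_simples RP_simples)

lemma c_W: "cc \<in> W"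
  unfolding w_up_def using w0_W longest_WP[OF M] WP_W[OF M] comp_W by blast

lemma inv_c: "inv cc = inv w0 \<circ> inv (longest D (WP M))"
  unfolding w_up_def using w0_W longest_WP[OF M] WP_W[OF M] inv_comp_distrib by blast

lemma w0_involution: "inv w0 = w0"
proof (rule WP_neg_unique[OF order.refl])
  show "inv w0 \<in> WP (simples D)" "w0 \<in> WP (simples D)" using w0_W inv_W WP_simples by auto
  show "\<forall>\<alpha>\<in>simples D. inv w0 \<alpha> \<notin> P" "\<forall>\<alpha>\<in>simples D. w0 \<alpha> \<notin> P"
    using w0_neg simples_pos pos_not_neg by blast+
qed

lemma linear_neg_W: "w \<in> W \<Longrightarrow> linear (\<lambda>v. - w v)"
  by (rule linear_compose_neg[OF linear_W])

lemma neg_W_span: "w \<in> W \<Longrightarrow> \<gamma> \<in> simples D \<Longrightarrow> - w \<gamma> \<in> span (simples D)"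
  by (simp add: span_simples_W span_base span_neg)

lemma neg_w0_simple: "\<alpha> \<in> simples D \<Longrightarrow> - w0 \<alpha> \<in> simples D"
  by (rule simple_system_image[OF order.refl, of "\<lambda>v. - w0 v" "\<lambda>v. - inv w0 v"])
    (use w0_W inv_W[OF w0_W] w0_neg P_roots in
      \<open>auto simp: linear_neg_W neg_W_span neg_W RP_simples simp del: fun_Compl_def\<close>)

lemma neg_longest_simple:
  assumes "\<alpha> \<in> M"
  shows "- longest D (WP M) \<alpha> \<in> M" "- inv (longest D (WP M)) \<alpha> \<in> M"
proof -
  let ?l = "longest D (WP M)"
  have l: "?l \<in> WP M" "inv ?l \<in> WP M" "?l \<in> W" "inv ?l \<in> W"
    using longest_WP[OF M] inv_WP[OF M] WP_W[OF M] by auto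
  have im: "- ?l \<beta> \<in> RP M \<inter> P" "- inv ?l \<beta> \<in> RP M \<inter> P" if "\<beta> \<in> RP M \<inter> P" for \<beta>
    using that longest_neg[OF M] RP_neg[OF M] WP_RP[OF M] l P_roots by auto
  show "- ?l \<alpha> \<in> M"
    by (rule simple_system_image[OF M linear_neg_W[OF l(3)] linear_neg_W[OF l(4)]])
      (use l im assms in \<open>auto simp: neg_W neg_W_span\<close>)
  show "- inv ?l \<alpha> \<in> M"
    by (rule simple_system_image[OF M linear_neg_W[OF l(4)] linear_neg_W[OF l(3)]])
      (use l im assms in \<open>auto simp: neg_W neg_W_span\<close>)
qed

lemma delta_simples: "dM \<subseteq> simples D"
  using neg_w0_simple M by (auto simp: delta_def)

lemma c_delta: "\<alpha> \<in> dM \<Longrightarrow> cc \<alpha> \<in> M"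
proof -
  assume "\<alpha> \<in> dM"
  then obtain \<gamma> where g: "\<gamma> \<in> M" "\<alpha> = - w0 \<gamma>" by (auto simp: delta_def)
  have l: "longest D (WP M) \<in> W" using longest_WP[OF M] WP_W[OF M] by blast
  have "cc \<alpha> = - longest D (WP M) (w0 (w0 \<gamma>))" using w0_W l by (simp add: w_up_def g neg_W)
  also have "w0 (w0 \<gamma>) = \<gamma>" using w0_involution w0_W by (metis inv_W_app(1))
  finally show ?thesis using neg_longest_simple g by simp
qed

lemma inv_c_M: "\<alpha> \<in> M \<Longrightarrow> inv cc \<alpha> \<in> dM"
proof -
  assume a: "\<alpha> \<in> M"
  have "inv cc \<alpha> = - w0 (- inv (longest D (WP M)) \<alpha>)"
    using w0_involution w0_W by (simp add: inv_c neg_W)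
  then show ?thesis using neg_longest_simple[OF a] by (auto simp: delta_def)
qed

lemma c_RP: "\<beta> \<in> RP dM \<Longrightarrow> cc \<beta> \<in> RP M"
proof -
  assume b: "\<beta> \<in> RP dM"
  then have "cc \<beta> \<in> cc ` span dM" by (auto simp: roots_par_def)
  also have "\<dots> = span (cc ` dM)" using linear_W[OF c_W] by (simp add: linear_span_image)
  also have "\<dots> \<subseteq> span M" using c_delta by (intro span_mono) auto
  finally show ?thesis using b weyl_root[OF c_W] by (auto simp: roots_par_def)
qed

lemma inv_c_RP: "\<beta> \<in> RP M \<Longrightarrow> inv cc \<beta> \<in> RP dM"
proof -
  assume b: "\<beta> \<in> RP M"
  have ic: "inv cc \<in> W" using c_W inv_W by blast
  have "inv cc \<beta> \<in> inv cc ` span M" using b by (auto simp: roots_par_def)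
  also have "\<dots> = span (inv cc ` M)" using linear_W[OF ic] by (simp add: linear_span_image)
  also have "\<dots> \<subseteq> span dM" using inv_c_M by (intro span_mono) auto
  finally show ?thesis using b weyl_root[OF ic] by (auto simp: roots_par_def)
qed

lemma c_RP_pos: "\<beta> \<in> RP dM \<Longrightarrow> \<beta> \<in> P \<Longrightarrow> cc \<beta> \<in> P"
  using RP_pos_mono[OF delta_simples c_W] c_delta M simples_pos by blast

lemma inv_c_RP_pos: "\<beta> \<in> RP M \<Longrightarrow> \<beta> \<in> P \<Longrightarrow> inv cc \<beta> \<in> P"
  using RP_pos_mono[OF M inv_W[OF c_W]] inv_c_M delta_simples simples_pos by blast

text \<open>The longest element of \<open>W\<close> sends the positive roots outside the dual parabolic to negative roots
outside the parabolic, and the longest element of \<open>W\<^sub>M\<close> does not change signs there.\<close>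

lemma c_neg: "\<gamma> \<in> P - RP dM \<Longrightarrow> - cc \<gamma> \<in> P - RP M"
proof -
  assume g: "\<gamma> \<in> P - RP dM"
  let ?l = "longest D (WP M)"
  have l: "?l \<in> WP M" "?l \<in> W" using longest_WP[OF M] WP_W[OF M] by auto
  have p: "- w0 \<gamma> \<in> P" using g w0_neg by blast
  have e: "?l (- w0 \<gamma>) = - cc \<gamma>" using l by (simp add: w_up_def neg_W)
  have "- w0 \<gamma> \<notin> RP M"
  proof
    assume "- w0 \<gamma> \<in> RP M"
    then have "- cc \<gamma> \<in> RP M" using WP_RP[OF M l(1)] p P_roots e by fastforce
    then have "cc \<gamma> \<in> RP M" using RP_neg[OF M] by fastforce
    then have "inv cc (cc \<gamma>) \<in> RP dM" by (rule inv_c_RP)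
    then show False using g c_W by simp
  qed
  then show ?thesis using WP_pos[OF M l(1) p] e by simp
qed

lemma inv_c_neg: "\<beta> \<in> P - RP M \<Longrightarrow> - inv cc \<beta> \<in> P - RP dM"
proof -
  assume b: "\<beta> \<in> P - RP M"
  let ?l = "longest D (WP M)"
  have l: "inv ?l \<in> WP M" using longest_WP[OF M] inv_WP[OF M] by auto
  have "- inv w0 (inv ?l \<beta>) \<in> P" using w0_neg WP_pos[OF M l] b by blast
  then have "- inv cc \<beta> \<in> P" by (simp add: inv_c)
  moreover have "- inv cc \<beta> \<notin> RP dM"
  proof
    assume "- inv cc \<beta> \<in> RP dM"
    then have "cc (- inv cc \<beta>) \<in> RP M" by (rule c_RP)
    then have "- \<beta> \<in> RP M" using c_W by (simp add: neg_W)
    then show False using b RP_neg[OF M] by fastforce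
  qed
  ultimately show ?thesis by blast
qed

lemma Inv_c: "Inv cc = P - RP dM"
  using c_neg c_RP_pos pos_not_neg by (auto simp: Inv_def)

lemma Inv_inv_c: "Inv (inv cc) = P - RP M"
  using inv_c_neg inv_c_RP_pos pos_not_neg by (auto simp: Inv_def)

text \<open>The inverse of \<open>c\<close> is the longest minimal representative: it makes every positive root outside
the parabolic negative.\<close>

lemma inv_c_J: "inv cc \<in> J M"
  using J_iff[OF M] inv_c_RP_pos inv_W[OF c_W] by auto

lemma conj_c:
  assumes "z \<in> WP dM"
  shows "cc \<circ> z \<circ> inv cc \<in> WP M"
  using assms unfolding weyl_par_def[of D dM]
proof (induction z rule: refl_group.induct)
  case id
  have "cc \<circ> id \<circ> inv cc = id" using c_W by simp
  then show ?case using id_WP by metis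
next
  case (refl \<alpha> z)
  have aR: "\<alpha> \<in> roots D" using refl delta_simples simples_roots by auto
  have "cc \<circ> refl D \<alpha> = refl D (cc \<alpha>) \<circ> cc" using refl_weyl[OF c_W aR] by simp
  then have "cc \<circ> (refl D \<alpha> \<circ> z) \<circ> inv cc = refl D (cc \<alpha>) \<circ> (cc \<circ> z \<circ> inv cc)"
    by (metis comp_assoc)
  then show ?case using refl refl_WP c_delta comp_WP by metis
qed

lemma conj_inv_c:
  assumes "z \<in> WP M"
  shows "inv cc \<circ> z \<circ> cc \<in> WP dM"
  using assms unfolding weyl_par_def[of D M]
proof (induction z rule: refl_group.induct)
  case id
  have "inv cc \<circ> id \<circ> cc = id" using c_W by simp
  then show ?case using id_WP by metis
next
  case (refl \<alpha> z)
  have aR: "\<alpha> \<in> roots D" using refl M simples_roots by auto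
  have "inv cc \<circ> refl D \<alpha> = refl D (inv cc \<alpha>) \<circ> inv cc"
    using refl_weyl[OF inv_W[OF c_W] aR] by simp
  then have "inv cc \<circ> (refl D \<alpha> \<circ> z) \<circ> cc = refl D (inv cc \<alpha>) \<circ> (inv cc \<circ> z \<circ> cc)"
    by (metis comp_assoc)
  then show ?case using refl refl_WP inv_c_M comp_WP by metis
qed

end

section \<open>Bruhat order\<close>

text \<open>The order is generated by ascending reflections in arbitrary positive roots instead of by
subwords.  In this form both the lifting property and the statement on cosets are checked on a
single step.\<close>

inductive bruhat :: "('v \<Rightarrow> 'v) \<Rightarrow> ('v \<Rightarrow> 'v) \<Rightarrow> bool" where
  refl: "bruhat w w"
| step: "\<beta> \<in> P \<Longrightarrow> y \<beta> \<in> P \<Longrightarrow> bruhat (y \<circ> refl D \<beta>) w \<Longrightarrow> bruhat y w"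

lemma bruhat_snoc:
  assumes "bruhat y w" "w \<in> W" "\<alpha> \<in> simples D" "w \<alpha> \<in> P"
  shows "bruhat y (w \<circ> refl D \<alpha>)"
  using assms
proof (induction y w rule: bruhat.induct)
  case (refl w)
  have "\<alpha> \<in> roots D" using refl simples_roots by auto
  moreover have "bruhat (w \<circ> refl D \<alpha>) (w \<circ> refl D \<alpha>)" by (rule bruhat.refl)
  moreover have "\<alpha> \<in> P" using refl simples_pos by auto
  ultimately show ?case using refl bruhat.step[of \<alpha> w] by metis
next
  case (step \<beta> y w)
  then show ?case using bruhat.step by blast
qed

text \<open>The lifting property.  In a step by \<open>\<beta> \<noteq> \<alpha>\<close> the reflection \<open>s\<^sub>\<alpha>\<close> can be moved past
  \<open>s\<^sub>\<beta>\<close> because \<open>s\<^sub>\<alpha> \<beta>\<close> is still positive.\<close>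

lemma bruhat_lift:
  assumes "bruhat y w" "y \<in> W" "w \<in> W" "\<alpha> \<in> simples D" "w \<alpha> \<in> P"
  shows "bruhat (y \<circ> refl D \<alpha>) (w \<circ> refl D \<alpha>)"
proof -
  have "bruhat (y \<circ> refl D \<alpha>) (w \<circ> refl D \<alpha>) \<or> bruhat (y \<circ> refl D \<alpha>) w"
    using assms(1-4)
  proof (induction y w rule: bruhat.induct)
    case (refl w)
    show ?case using bruhat.refl by blast
  next
    case (step \<beta> y w)
    have R: "\<alpha> \<in> roots D" "\<beta> \<in> roots D" using step simples_roots P_roots by auto
    show ?case
    proof (cases "\<beta> = \<alpha>")
      case True
      then show ?thesis using step by blast
    next
      case False
      then have p: "refl D \<alpha> \<beta> \<in> P" using simple_refl_pos step by blast
      have "refl D (refl D \<alpha> \<beta>) \<circ> refl D \<alpha> = refl D \<alpha> \<circ> refl D \<beta>"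
        using refl_weyl[OF refl_W[OF R(1)] R(2)] .
      then have "refl D \<alpha> \<circ> refl D (refl D \<alpha> \<beta>) = refl D \<beta> \<circ> refl D \<alpha>"
        using R by (metis comp_assoc comp_id fun.map_id refl_comp_refl)
      then have e: "y \<circ> refl D \<alpha> \<circ> refl D (refl D \<alpha> \<beta>) = y \<circ> refl D \<beta> \<circ> refl D \<alpha>"
        by (metis comp_assoc)
      have q: "(y \<circ> refl D \<alpha>) (refl D \<alpha> \<beta>) \<in> P" using step R by simp
      have "y \<circ> refl D \<beta> \<in> W" using step R comp_W refl_W by blast
      then have IH: "bruhat (y \<circ> refl D \<beta> \<circ> refl D \<alpha>) (w \<circ> refl D \<alpha>) \<or>
          bruhat (y \<circ> refl D \<beta> \<circ> refl D \<alpha>) w"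
        using step.IH step.prems by blast
      have st: "bruhat (y \<circ> refl D \<alpha>) v"
        if "bruhat (y \<circ> refl D \<beta> \<circ> refl D \<alpha>) v" for v
        using bruhat.step[of "refl D \<alpha> \<beta>" "y \<circ> refl D \<alpha>" v] p q that unfolding e by blast
      show ?thesis using IH st by blast
    qed
  qed
  then show ?thesis using bruhat_snoc assms by blast
qed

text \<open>An element of the coset of \<open>c\<close> makes every positive root outside the dual parabolic negative.
An ascending reflection that starts there therefore belongs to the dual parabolic and does not
leave the coset.\<close>

lemma bruhat_c_upper:
  assumes M: "M \<subseteq> simples D" and b: "bruhat y w" and w: "w \<in> W"
    and y: "y \<circ> inv (w_up D M) \<in> WP M" "y \<in> W"
  shows "w \<circ> inv (w_up D M) \<in> WP M"
  using b w y
proof (induction y w rule: bruhat.induct)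
  case (step \<beta> y w)
  let ?c = "w_up D M"
  have cW: "?c \<in> W" using c_W[OF M] .
  let ?u = "y \<circ> inv ?c"
  have bR: "\<beta> \<in> roots D" using step P_roots by auto
  have "\<beta> \<in> RP (delta D M)"
  proof (rule ccontr)
    assume "\<beta> \<notin> RP (delta D M)"
    then have "- ?c \<beta> \<in> P - RP M" using c_neg[OF M] step by blast
    then have "?u (- ?c \<beta>) \<in> P" using WP_pos[OF M step.prems(2)] by blast
    then have "- y \<beta> \<in> P" using cW step by (simp add: neg_W inv_W)
    then show False using step pos_not_neg by blast
  qed
  then have cb: "?c \<beta> \<in> RP M" using c_RP[OF M] by blast
  then have s: "refl D (?c \<beta>) \<in> WP M" using refl_RP_WP[OF M] by blast
  have "(y \<circ> refl D \<beta>) \<circ> inv ?c = ?u \<circ> refl D (?c \<beta>)"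
    using refl_weyl_conj[OF cW bR] cW by (simp add: comp_assoc)
  then have "(y \<circ> refl D \<beta>) \<circ> inv ?c \<in> WP M" using comp_WP step s by metis
  then show ?case using step bR comp_W refl_W by blast
qed

end

section \<open>Polynomial functions and divisibility by a linear factor\<close>

lemma sym_prod_eval: "ev (\<Prod>i\<in>A. f i) z = (\<Prod>i\<in>A. ev (f i) z)"
  by (induction A rule: infinite_finite_induct) simp_all

lemma cfunctional_polyfun_shift:
  assumes "l \<in> polyfuns" "cfunctional f"
  shows "(\<lambda>z. f (z - cscale (l z) b)) \<in> polyfuns"
proof -
  have "f (z - cscale (l z) b) = f z - f b * l z" for z
  proof -
    have m: "- cscale (l z) b = cscale (- l z) b"
      by (simp add: cscale_def prod_eq_iff)
    have "f (z + cscale (- l z) b) = f z + (- l z) * f b"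
      using assms(2) unfolding cfunctional_def by metis
    then show ?thesis unfolding diff_conv_add_uminus m by (simp add: algebra_simps)
  qed
  then have "(\<lambda>z. f (z - cscale (l z) b)) = (\<lambda>z. f z - f b * l z)" by blast
  also have "\<dots> \<in> polyfuns"
    using assms by (intro polyfuns_diff polyfuns.mult[OF polyfuns.const]) (auto intro: polyfuns.lin)
  finally show ?thesis .
qed

lemma polyfun_precomp:
  assumes "\<And>f. cfunctional f \<Longrightarrow> (\<lambda>z. f (\<phi> z)) \<in> polyfuns" "p \<in> polyfuns"
  shows "(\<lambda>z. p (\<phi> z)) \<in> polyfuns"
  using assms(2) by (induction p rule: polyfuns.induct)
    (auto intro: polyfuns.const polyfuns.add polyfuns.mult assms(1))

text \<open>A shift of the argument along \<open>b\<close> by the value of \<open>l\<close> changes a polynomial by a multiple of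
  \<open>l\<close>.  This contains both divisibility facts needed below: with a reflection as shift it gives
  the quotient in the cross relation, with a projection onto the zero set of \<open>l\<close> it gives the
  factor theorem.\<close>

lemma polyfun_shift_dvd:
  assumes "l \<in> polyfuns" "p \<in> polyfuns"
  shows "\<exists>q\<in>polyfuns. \<forall>z. p z - p (z - cscale (l z) b) = l z * q z"
  using assms(2)
proof (induction p rule: polyfuns.induct)
  case (const c)
  show ?case by (rule bexI[of _ "\<lambda>_. 0"]) (auto intro: polyfuns.const)
next
  case (lin f)
  have "f z - f (z - cscale (l z) b) = l z * f b" for z
  proof -
    have m: "- cscale (l z) b = cscale (- l z) b"
      by (simp add: cscale_def prod_eq_iff)
    have "f (z + cscale (- l z) b) = f z + (- l z) * f b"
      using lin unfolding cfunctional_def by metis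
    then show ?thesis unfolding diff_conv_add_uminus m by (simp add: algebra_simps)
  qed
  then show ?case by (intro bexI[of _ "\<lambda>_. f b"]) (auto intro: polyfuns.const)
next
  case (add f g)
  then obtain q r where "q \<in> polyfuns" "r \<in> polyfuns"
    "\<forall>z. f z - f (z - cscale (l z) b) = l z * q z" "\<forall>z. g z - g (z - cscale (l z) b) = l z * r z"
    by blast
  then show ?case
    by (intro bexI[of _ "\<lambda>z. q z + r z"]) (auto simp: algebra_simps intro: polyfuns.add)
next
  case (mult f g)
  then obtain q r where qr: "q \<in> polyfuns" "r \<in> polyfuns"
    "\<And>z. f z - f (z - cscale (l z) b) = l z * q z" "\<And>z. g z - g (z - cscale (l z) b) = l z * r z"
    by blast
  let ?\<phi> = "\<lambda>z. z - cscale (l z) b"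
  have "f z * g z - f (?\<phi> z) * g (?\<phi> z) = l z * (q z * g z + f (?\<phi> z) * r z)" for z
  proof -
    have "f z * g z - f (?\<phi> z) * g (?\<phi> z) = (f z - f (?\<phi> z)) * g z + f (?\<phi> z) * (g z - g (?\<phi> z))"
      by (simp add: algebra_simps)
    then show ?thesis by (simp only: qr) (simp add: algebra_simps)
  qed
  moreover have "(\<lambda>z. f (?\<phi> z)) \<in> polyfuns"
    by (rule polyfun_precomp[OF cfunctional_polyfun_shift[OF assms(1)] mult.hyps(1)])
  ultimately show ?case using qr mult.hyps
    by (intro bexI[of _ "\<lambda>z. q z * g z + f (?\<phi> z) * r z"]) (auto intro: polyfuns.add polyfuns.mult)
qed

lemma Sym_ev: "f \<in> polyfuns \<Longrightarrow> ev (Sym f) = f"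
  by (rule Sym_inverse)

lemma cst_simps:
  "cst 0 = 0" "cst 1 = 1" "cst (a + b) = cst a + cst b" "cst (a * b) = cst a * cst b"
  "cst (- a) = - cst a"
  by (rule sym_eqI; simp)+

lemma rat_simps:
  "rat 0 = 0" "rat 1 = 1" "rat (p + q) = rat p + rat q" "rat (p * q) = rat p * rat q"
  "rat (p - q) = rat p - rat q" "rat (- p) = - rat p"
  by (simp_all add: rat_def Zero_fract_def One_fract_def)

lemma rat_eq_iff: "rat p = rat q \<longleftrightarrow> p = q"
  by (simp add: rat_def eq_fract)

lemma rat_eq_0_iff: "rat p = 0 \<longleftrightarrow> p = 0"
  using rat_eq_iff[of p 0] by (simp add: rat_simps)

lemma rat_prod: "rat (\<Prod>i\<in>A. f i) = (\<Prod>i\<in>A. rat (f i))"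
  by (induction A rule: infinite_finite_induct) (simp_all add: rat_simps)

lemma Fract_rat: "q \<noteq> 0 \<Longrightarrow> Fract p q = rat p / rat q"
  by (simp add: rat_def)

lemma fract_cases_rat:
  obtains p q where "q \<noteq> 0" "r = rat p / rat q"
proof (cases r)
  case (Fract a b)
  then show ?thesis using that[of b a] Fract_rat[of b a] by simp
qed

context root_system
begin

section \<open>The Weyl group action on polynomial and rational functions\<close>

lemma perfect_right: "linear f \<Longrightarrow> \<exists>!\<mu>. \<forall>v. f v = pairing D v \<mu>"
  and perfect_left: "linear g \<Longrightarrow> \<exists>!v. \<forall>\<mu>. g \<mu> = pairing D v \<mu>"
  using rd by (simp_all add: root_datum_def)

lemma pairing_unique: "(\<And>v. pairing D v \<mu> = pairing D v \<mu>') \<Longrightarrow> \<mu> = \<mu>'"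
proof -
  assume a: "\<And>v. pairing D v \<mu> = pairing D v \<mu>'"
  have "\<exists>!\<mu>''. \<forall>v. pairing D v \<mu> = pairing D v \<mu>''"
    by (rule perfect_right[OF linear_pairing_left])
  then show ?thesis using a by blast
qed

lemma pairing_unique_left: "(\<And>\<mu>. pairing D v \<mu> = pairing D v' \<mu>) \<Longrightarrow> v = v'"
proof -
  assume a: "\<And>\<mu>. pairing D v \<mu> = pairing D v' \<mu>"
  have "\<exists>!v''. \<forall>\<mu>. pairing D v \<mu> = pairing D v'' \<mu>"
    by (rule perfect_left[OF linear_pairing_right])
  then show ?thesis using a by blast
qed

lemma functional_represented: "linear f \<Longrightarrow> \<exists>v. \<forall>\<mu>. f \<mu> = pairing D v \<mu>"
  using perfect_left by blast

lemma pairing_transp: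
  assumes "linear w"
  shows "pairing D v (transp D w \<mu>) = pairing D (w v) \<mu>"
proof -
  have "linear (\<lambda>v. pairing D (w v) \<mu>)"
    using linear_compose[OF assms linear_pairing_left[of \<mu>]] by (simp add: comp_def)
  then have "\<exists>!\<mu>'. \<forall>v. pairing D (w v) \<mu> = pairing D v \<mu>'"
    by (rule perfect_right)
  then have "\<exists>!\<mu>'. \<forall>v. pairing D v \<mu>' = pairing D (w v) \<mu>" by metis
  from theI'[OF this] show ?thesis unfolding transp_def by blast
qed

lemma transp_add: "linear w \<Longrightarrow> transp D w (\<mu> + \<mu>') = transp D w \<mu> + transp D w \<mu>'"
  and transp_scale: "linear w \<Longrightarrow> transp D w (r *\<^sub>R \<mu>) = r *\<^sub>R transp D w \<mu>"
  and transp_diff: "linear w \<Longrightarrow> transp D w (\<mu> - \<mu>') = transp D w \<mu> - transp D w \<mu>'"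
  by (rule pairing_unique; simp add: pairing_transp pairing_simps)+

abbreviation tmap where "tmap w z \<equiv> map_prod (transp D w) (transp D w) z"

lemma cfunctional_tmap: "linear w \<Longrightarrow> cfunctional f \<Longrightarrow> cfunctional (\<lambda>z. f (tmap w z))"
proof -
  assume w: "linear w" and f: "cfunctional f"
  have "tmap w (x + y) = tmap w x + tmap w y" for x y
    by (cases x; cases y) (simp add: transp_add w)
  moreover have "tmap w (cscale a x) = cscale a (tmap w x)" for a x
    by (cases x) (simp add: cscale_def transp_add transp_diff transp_scale w)
  ultimately show ?thesis using f by (simp add: cfunctional_def)
qed

lemma ev_sact: "linear w \<Longrightarrow> ev (sact D w p) z = ev p (tmap w z)"
proof -
  assume w: "linear w"
  have "(\<lambda>z. ev p (tmap w z)) \<in> polyfuns"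
    by (rule polyfun_precomp[of "tmap w" "ev p"]) (auto intro: polyfuns.lin cfunctional_tmap w ev)
  then show ?thesis by (simp add: sact_def Sym_ev)
qed

lemma sact_simps:
  assumes "linear w"
  shows "sact D w 0 = 0" "sact D w 1 = 1" "sact D w (p + q) = sact D w p + sact D w q"
    "sact D w (p * q) = sact D w p * sact D w q" "sact D w (p - q) = sact D w p - sact D w q"
    "sact D w (- p) = - sact D w p" "sact D w (cst a) = cst a"
  by (rule sym_eqI; simp add: ev_sact assms)+

lemma sact_id: "sact D id p = p"
proof (rule sym_eqI)
  fix z
  have "transp D id \<mu> = \<mu>" for \<mu>
    by (rule pairing_unique) (simp add: pairing_transp linear_id)
  then have "tmap id z = z" by (cases z) simp
  then show "ev (sact D id p) z = ev p z" using ev_sact[OF linear_id, of p z] by simp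
qed

lemma sact_comp:
  assumes "linear u" "linear w"
  shows "sact D (u \<circ> w) p = sact D u (sact D w p)"
proof (rule sym_eqI)
  fix z
  have l: "linear (u \<circ> w)" using linear_compose assms by blast
  have "transp D (u \<circ> w) \<mu> = transp D w (transp D u \<mu>)" for \<mu>
    by (rule pairing_unique) (simp add: pairing_transp assms l)
  then have "tmap (u \<circ> w) z = tmap w (tmap u z)" by (cases z) simp
  then show "ev (sact D (u \<circ> w) p) z = ev (sact D u (sact D w p)) z"
    by (simp add: ev_sact[OF l] ev_sact[OF assms(1)] ev_sact[OF assms(2)])
qed

lemma cpair_tmap: "linear w \<Longrightarrow> cpair D \<omega> (tmap w z) = cpair D (map_prod w w \<omega>) z"
  by (cases \<omega>; cases z) (simp add: cpair_def pairing_transp)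

lemma sact_lin: "linear w \<Longrightarrow> sact D w (lin D \<omega>) = lin D (map_prod w w \<omega>)"
  by (rule sym_eqI) (simp add: ev_sact ev_lin rd cpair_tmap)

lemma sact_root_fn: "w \<in> W \<Longrightarrow> sact D w (root_fn D \<alpha>) = root_fn D (w \<alpha>)"
  using linear_W[of w] by (simp add: root_fn_def sact_lin linear_0)

lemma sact_inv: "w \<in> W \<Longrightarrow> sact D w (sact D (inv w) p) = p" "w \<in> W \<Longrightarrow> sact D (inv w) (sact D w p) = p"
  using sact_comp[of w "inv w"] sact_comp[of "inv w" w] linear_W inv_W sact_id by simp_all

lemma sact_eq_0_iff: "w \<in> W \<Longrightarrow> sact D w p = 0 \<longleftrightarrow> p = 0"
  using sact_inv(2)[of w p] sact_simps(1)[OF linear_W[OF inv_W]] sact_simps(1)[OF linear_W] by metis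

lemma ev_root_fn: "ev (root_fn D \<alpha>) z = cpair D (\<alpha>, 0) z"
  by (simp add: root_fn_def ev_lin rd)

lemma ev_root_fn_coroot: "\<alpha> \<in> roots D \<Longrightarrow> ev (root_fn D \<alpha>) (t *\<^sub>R coroot D \<alpha>, 0) = of_real (2 * t)"
  by (simp add: ev_root_fn cpair_def pairing_simps pairing_coroot complex_eq_iff)

lemma root_fn_nonzero:
  assumes "\<alpha> \<in> roots D"
  shows "root_fn D \<alpha> \<noteq> 0" "cst (of_real k) + root_fn D \<alpha> \<noteq> 0" "cst (of_real k) - root_fn D \<alpha> \<noteq> 0"
proof -
  have "ev (root_fn D \<alpha>) (1 *\<^sub>R coroot D \<alpha>, 0) \<noteq> 0"
    by (subst ev_root_fn_coroot[OF assms]) simp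
  then show "root_fn D \<alpha> \<noteq> 0" by auto
  have e: "ev (cst (of_real k) + root_fn D \<alpha>) (t *\<^sub>R coroot D \<alpha>, 0) = of_real (k + 2 * t)"
    "ev (cst (of_real k) - root_fn D \<alpha>) (t *\<^sub>R coroot D \<alpha>, 0) = of_real (k - 2 * t)" for t
    by (simp_all only: ev_simps ev_cst ev_root_fn_coroot[OF assms]) simp_all
  show "cst (of_real k) + root_fn D \<alpha> \<noteq> 0"
  proof
    assume "cst (of_real k) + root_fn D \<alpha> = 0"
    then have "(0::complex) = of_real (k + 2 * ((1 - k) / 2))"
      using e(1)[of "(1 - k) / 2"] by (metis ev_simps(1))
    also have "k + 2 * ((1 - k) / 2) = 1" by (simp add: field_simps)
    finally show False by simp
  qed
  show "cst (of_real k) - root_fn D \<alpha> \<noteq> 0"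
  proof
    assume "cst (of_real k) - root_fn D \<alpha> = 0"
    then have "(0::complex) = of_real (k - 2 * ((k - 1) / 2))"
      using e(2)[of "(k - 1) / 2"] by (metis ev_simps(1))
    also have "k - 2 * ((k - 1) / 2) = 1" by (simp add: field_simps)
    finally show False by simp
  qed
qed

lemma root_fn_neg: "root_fn D (- \<alpha>) = - root_fn D \<alpha>"
  by (rule sym_eqI) (simp add: ev_root_fn cpair_def pairing_simps complex_eq_iff)

lemma sact_faithful:
  assumes "w \<in> W" "\<And>p. sact D w p = p"
  shows "w = id"
proof
  fix v
  have "lin D (w v, 0) = lin D (v, 0)"
    using assms(2)[of "lin D (v, 0)"] linear_W[OF assms(1)] by (simp add: sact_lin linear_0)
  then have "ev (lin D (w v, 0)) (\<mu>, 0) = ev (lin D (v, 0)) (\<mu>, 0)" for \<mu> by simp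
  then have "pairing D (w v) \<mu> = pairing D v \<mu>" for \<mu>
    by (simp add: ev_lin rd cpair_def pairing_simps complex_eq_iff)
  then show "w v = id v" using pairing_unique_left by auto
qed

lemma tmap_refl: "\<alpha> \<in> roots D \<Longrightarrow>
  tmap (refl D \<alpha>) z = z - cscale (ev (root_fn D \<alpha>) z) (coroot D \<alpha>, 0)"
proof -
  assume "\<alpha> \<in> roots D"
  have t: "transp D (refl D \<alpha>) \<mu> = corefl D \<alpha> \<mu>" for \<mu>
    by (rule pairing_unique) (simp add: pairing_transp linear_refl pairing_refl)
  show ?thesis
    by (cases z) (simp add: t corefl_def ev_root_fn cpair_def cscale_def pairing_simps)
qed

lemma root_fn_dvd:
  assumes "\<alpha> \<in> roots D"
  shows "\<exists>q. root_fn D \<alpha> * q = p - sact D (refl D \<alpha>) p"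
proof -
  obtain q where q: "q \<in> polyfuns"
    "\<forall>z. ev p z - ev p (z - cscale (ev (root_fn D \<alpha>) z) (coroot D \<alpha>, 0)) = ev (root_fn D \<alpha>) z * q z"
    using polyfun_shift_dvd[OF ev ev, of p "root_fn D \<alpha>" "(coroot D \<alpha>, 0)"] by blast
  have "root_fn D \<alpha> * Sym q = p - sact D (refl D \<alpha>) p"
    using q by (intro sym_eqI) (simp add: Sym_ev ev_sact linear_refl tmap_refl assms del: split_paired_All)
  then show ?thesis by blast
qed

text \<open>For \<open>k \<noteq> 0\<close> the linear factor \<open>k + \<alpha>\<close> is prime and divides no root, so it has to cancel
  against the denominator of any fraction equal to \<open>\<prod>\<gamma> / ((k + \<alpha>) \<cdots>)\<close>.\<close>

lemma affine_factor_dvd: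
  assumes a: "\<alpha> \<in> roots D" and k: "k \<noteq> 0" and A: "finite A" "A \<subseteq> roots D"
    and e: "(\<Prod>\<gamma>\<in>A. root_fn D \<gamma>) * q = p * (cst (of_real k) + root_fn D \<alpha>)"
  shows "\<exists>q'. q = (cst (of_real k) + root_fn D \<alpha>) * q'"
proof -
  define l where "l = cst (of_real k) + root_fn D \<alpha>"
  define l2 where "l2 = cst (1/2) * l"
  \<comment> \<open>The projection along the coroot onto the zero set of \<open>l\<close>; the factor \<open>1/2\<close> in \<open>l2\<close> compensates
    that \<open>\<alpha>\<close> takes the value \<open>2\<close> on its coroot.\<close>
  define \<phi> where "\<phi> z = z - cscale (ev l2 z) (coroot D \<alpha>, 0)" for z
  have pc: "(\<lambda>z. ev r (\<phi> z)) \<in> polyfuns" for r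
    unfolding \<phi>_def by (rule polyfun_precomp[OF cfunctional_polyfun_shift[OF ev] ev])
  have lin: "ev (root_fn D \<gamma>) (\<phi> z) =
      ev (root_fn D \<gamma>) z - ev l2 z * of_real (pairing D \<gamma> (coroot D \<alpha>))" for \<gamma> z
    by (cases z) (simp add: ev_root_fn cpair_def \<phi>_def cscale_def pairing_simps complex_eq_iff)
  have l0: "ev l (\<phi> z) = 0" for z
    using lin[of \<alpha> z] pairing_coroot[OF a] by (simp add: l_def l2_def field_simps)
  have g: "\<exists>z. ev (root_fn D \<gamma>) (\<phi> z) \<noteq> 0" if "\<gamma> \<in> roots D" for \<gamma>
  proof (rule ccontr)
    assume n: "\<not> ?thesis"
    have "ev (root_fn D \<gamma>) 0 = 0" "ev (root_fn D \<alpha>) 0 = 0"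
      by (simp_all add: ev_root_fn cpair_def pairing_simps zero_complex.code)
    then have "ev l2 0 = of_real k / 2" by (simp add: l2_def l_def)
    moreover have "ev (root_fn D \<gamma>) (\<phi> 0) = 0" using n by blast
    ultimately have "of_real k / 2 * complex_of_real (pairing D \<gamma> (coroot D \<alpha>)) = 0"
      using lin[of \<gamma> 0] \<open>ev (root_fn D \<gamma>) 0 = 0\<close> by (metis diff_0 neg_equal_0_iff_equal)
    then have "pairing D \<gamma> (coroot D \<alpha>) = 0" using k by simp
    then have "ev (root_fn D \<gamma>) z = 0" for z using n lin[of \<gamma> z] by (metis diff_zero mult_zero_right of_real_0)
    then have "root_fn D \<gamma> = 0" by (intro sym_eqI) simp
    then show False using root_fn_nonzero that by blast
  qed
  have prod0: "ev (\<Prod>\<gamma>\<in>A. root_fn D \<gamma>) (\<phi> z) * ev q (\<phi> z) = 0" for z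
    using arg_cong[OF e, of "\<lambda>p. ev p (\<phi> z)"] l0[of z] by (simp add: l_def)
  have "(\<lambda>z. ev (\<Prod>\<gamma>\<in>A. root_fn D \<gamma>) (\<phi> z)) \<noteq> (\<lambda>_. 0)"
    using A
  proof (induction A rule: finite_induct)
    case empty
    then show ?case by (simp add: fun_eq_iff)
  next
    case (insert \<gamma> A)
    obtain z where "ev (root_fn D \<gamma>) (\<phi> z) \<noteq> 0" using g insert by blast
    then have "(\<lambda>z. ev (root_fn D \<gamma>) (\<phi> z)) \<noteq> (\<lambda>_. 0)" by metis
    then have "(\<lambda>z. ev (root_fn D \<gamma>) (\<phi> z) * ev (\<Prod>\<gamma>\<in>A. root_fn D \<gamma>) (\<phi> z)) \<noteq> (\<lambda>_. 0)"
      using insert by (intro polyfuns_no_zero_divisors pc) auto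
    then show ?case using insert by simp
  qed
  then have "(\<lambda>z. ev q (\<phi> z)) = (\<lambda>_. 0)"
    using polyfuns_no_zero_divisors[OF pc pc, of "\<Prod>\<gamma>\<in>A. root_fn D \<gamma>" q] prod0 by force
  then have q0: "ev q (\<phi> z) = 0" for z by metis
  obtain r where r: "r \<in> polyfuns" "\<forall>z. ev q z - ev q (\<phi> z) = ev l2 z * r z"
    using polyfun_shift_dvd[OF ev ev, of q l2 "(coroot D \<alpha>, 0)"] unfolding \<phi>_def by blast
  have "q = l * (cst (1/2) * Sym r)"
    using r q0 by (intro sym_eqI) (simp add: Sym_ev l2_def mult_ac del: split_paired_All)
  then show ?thesis unfolding l_def by blast
qed

text \<open>Any representation of \<open>r\<close> as a fraction gives the same result, since the action on polynomials is
multiplicative and injective.\<close>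

definition ract :: "('v \<Rightarrow> 'v) \<Rightarrow> 'd sym fract \<Rightarrow> 'd sym fract" where
  "ract w r = (SOME s. \<exists>p q. q \<noteq> 0 \<and> r = rat p / rat q \<and> s = rat (sact D w p) / rat (sact D w q))"

lemma ract_frac:
  assumes w: "w \<in> W" and q: "q \<noteq> 0"
  shows "ract w (rat p / rat q) = rat (sact D w p) / rat (sact D w q)"
proof -
  let ?S = "\<lambda>s. \<exists>p' q'. q' \<noteq> 0 \<and> rat p / rat q = rat p' / rat q' \<and>
    s = rat (sact D w p') / rat (sact D w q')"
  have "?S (ract w (rat p / rat q))"
    unfolding ract_def by (rule someI[of ?S "rat (sact D w p) / rat (sact D w q)"]) (use q in blast)
  then obtain p' q' where pq: "q' \<noteq> 0" "rat p / rat q = rat p' / rat q'"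
    "ract w (rat p / rat q) = rat (sact D w p') / rat (sact D w q')" by blast
  have "rat p * rat q' = rat p' * rat q"
    using pq q rat_eq_0_iff by (metis frac_eq_eq)
  then have "p * q' = p' * q" by (simp add: rat_eq_iff flip: rat_simps)
  then have "sact D w p * sact D w q' = sact D w p' * sact D w q"
    by (metis linear_W[OF w] sact_simps(4))
  then have "rat (sact D w p) * rat (sact D w q') = rat (sact D w p') * rat (sact D w q)"
    by (metis rat_simps(4))
  moreover have "rat (sact D w q) \<noteq> 0" "rat (sact D w q') \<noteq> 0"
    using q pq w by (simp_all add: rat_eq_0_iff sact_eq_0_iff)
  ultimately show ?thesis using pq(3) by (simp add: frac_eq_eq)
qed

lemma ract_rat: "w \<in> W \<Longrightarrow> ract w (rat p) = rat (sact D w p)"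
  using ract_frac[of w 1 p] linear_W[of w] by (simp add: rat_simps sact_simps)

lemma ract_simps:
  assumes w: "w \<in> W"
  shows "ract w 0 = 0" "ract w 1 = 1" "ract w (r + s) = ract w r + ract w s"
    "ract w (r * s) = ract w r * ract w s" "ract w (- r) = - ract w r"
    "ract w (inverse r) = inverse (ract w r)"
proof -
  note S = sact_simps[OF linear_W[OF w]]
  show z: "ract w 0 = 0" "ract w 1 = 1"
    using ract_rat[OF w, of 0] ract_rat[OF w, of 1] by (simp_all add: S rat_simps)
  obtain p q where r: "q \<noteq> 0" "r = rat p / rat q" by (rule fract_cases_rat)
  obtain p' q' where s: "q' \<noteq> 0" "s = rat p' / rat q'" by (rule fract_cases_rat)
  have nz: "rat q \<noteq> 0" "rat q' \<noteq> 0" "rat (sact D w q) \<noteq> 0" "rat (sact D w q') \<noteq> 0" "q * q' \<noteq> 0"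
    using r s w by (simp_all add: rat_eq_0_iff sact_eq_0_iff)
  have "r + s = rat (p * q' + p' * q) / rat (q * q')"
    using nz by (simp add: r s rat_simps field_simps)
  then have "ract w (r + s) = rat (sact D w (p * q' + p' * q)) / rat (sact D w (q * q'))"
    using ract_frac[OF w nz(5)] by metis
  then show "ract w (r + s) = ract w r + ract w s"
    using nz by (simp add: S r s ract_frac w rat_simps field_simps)
  have "r * s = rat (p * p') / rat (q * q')" by (simp add: r s rat_simps)
  then have "ract w (r * s) = rat (sact D w (p * p')) / rat (sact D w (q * q'))"
    using ract_frac[OF w nz(5)] by metis
  then show "ract w (r * s) = ract w r * ract w s"
    by (simp add: S r s ract_frac w rat_simps)
  have "- r = rat (- p) / rat q" by (simp add: r rat_simps)
  then have "ract w (- r) = rat (sact D w (- p)) / rat (sact D w q)"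
    using ract_frac[OF w r(1), of "- p"] by metis
  then show "ract w (- r) = - ract w r" using ract_frac[OF w r(1), of p] r(2) by (simp add: S rat_simps)
  show "ract w (inverse r) = inverse (ract w r)"
  proof (cases "p = 0")
    case True
    then show ?thesis using r z by (simp add: rat_simps)
  next
    case False
    have "inverse r = rat q / rat p" by (simp add: r)
    then show ?thesis using ract_frac[OF w False] ract_frac[OF w r(1)] r by simp
  qed
qed

lemma ract_diff: "w \<in> W \<Longrightarrow> ract w (r - s) = ract w r - ract w s"
  using ract_simps(3)[of w r "- s"] ract_simps(5)[of w s] by simp
lemma ract_divide: "w \<in> W \<Longrightarrow> ract w (r / s) = ract w r / ract w s"
  by (simp add: divide_inverse ract_simps)
lemma ract_prod: "w \<in> W \<Longrightarrow> ract w (\<Prod>i\<in>A. f i) = (\<Prod>i\<in>A. ract w (f i))"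
  by (induction A rule: infinite_finite_induct) (simp_all add: ract_simps)

lemma ract_id: "ract id r = r"
proof -
  obtain p q where r: "q \<noteq> 0" "r = rat p / rat q" by (rule fract_cases_rat)
  show ?thesis unfolding r(2) by (subst ract_frac) (use r in \<open>auto simp only: id_W sact_id\<close>)
qed

lemma ract_comp: "u \<in> W \<Longrightarrow> w \<in> W \<Longrightarrow> ract (u \<circ> w) r = ract u (ract w r)"
proof -
  assume u: "u \<in> W" and w: "w \<in> W"
  obtain p q where r: "q \<noteq> 0" "r = rat p / rat q" by (rule fract_cases_rat)
  have "sact D w q \<noteq> 0" using sact_eq_0_iff w r by blast
  then show ?thesis unfolding r(2)
    using ract_frac[OF comp_W[OF u w] r(1), of p] ract_frac[OF w r(1), of p]
      ract_frac[OF u, of "sact D w q" "sact D w p"]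
    by (simp add: sact_comp[OF linear_W[OF u] linear_W[OF w]])
qed

lemma ract_inv: "w \<in> W \<Longrightarrow> ract w (ract (inv w) r) = r" "w \<in> W \<Longrightarrow> ract (inv w) (ract w r) = r"
  using ract_comp[of w "inv w" r] ract_comp[of "inv w" w r] inv_W ract_id by simp_all

lemma ract_rroot: "w \<in> W \<Longrightarrow> ract w (rroot D \<alpha>) = rroot D (w \<alpha>)"
  by (simp add: rroot_def ract_rat sact_root_fn)

lemma ract_rk: "w \<in> W \<Longrightarrow> \<alpha> \<in> roots D \<Longrightarrow> ract w (rk D \<alpha>) = rk D (w \<alpha>)"
  using linear_W[of w] by (simp add: rk_def ract_rat sact_simps kpar_weyl)

lemma rroot_neg: "rroot D (- \<alpha>) = - rroot D \<alpha>"
  by (simp add: rroot_def root_fn_neg rat_simps)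

lemma kpar_neg: "\<alpha> \<in> roots D \<Longrightarrow> kpar D (- \<alpha>) = kpar D \<alpha>"
  using kpar_weyl[OF refl_W, of \<alpha> \<alpha>] by (simp add: refl_self)

lemma rk_neg: "\<alpha> \<in> roots D \<Longrightarrow> rk D (- \<alpha>) = rk D \<alpha>"
  by (simp add: rk_def kpar_neg)

lemma rroot_nonzero:
  assumes "\<alpha> \<in> roots D"
  shows "rroot D \<alpha> \<noteq> 0" "rk D \<alpha> + rroot D \<alpha> \<noteq> 0" "rk D \<alpha> - rroot D \<alpha> \<noteq> 0"
  using root_fn_nonzero[OF assms]
  by (simp_all add: rroot_def rk_def rat_eq_0_iff flip: rat_simps(3,5))

lemma ract_faithful:
  assumes "w \<in> W" "\<And>r. ract w r = r"
  shows "w = id"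
  using sact_faithful[OF assms(1)] assms(2) ract_rat[OF assms(1)] rat_eq_iff by metis

end

section \<open>The Hecke algebra with rational coefficients\<close>

lemma additive_simps:
  fixes f :: "'a::ab_group_add \<Rightarrow> 'b::ab_group_add"
  assumes "\<And>x y. f (x + y) = f x + f y"
  shows "f 0 = 0" "f (- x) = - f x" "f (x - y) = f x - f y"
    "f (\<Sum>i\<in>A. h i) = (\<Sum>i\<in>A. f (h i))"
proof -
  show z: "f 0 = 0" using assms[of 0 0] by simp
  show m: "f (- x) = - f x" for x
    using assms[of x "- x"] z by (simp add: eq_neg_iff_add_eq_0 add.commute)
  show "f (x - y) = f x - f y" using assms[of x "- y"] m by simp
  show "f (\<Sum>i\<in>A. h i) = (\<Sum>i\<in>A. f (h i))"
    by (induction A rule: infinite_finite_induct) (simp_all add: z assms)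
qed

locale hecke = root_system H
  for H :: "('v::real_vector, 'd::real_vector, 'h::ring_1, 'g::ring_1) rat_hecke_data" +
  assumes gh: "graded_hecke_algebra H" and st: "star_operation H" and rh: "rational_hecke H"
begin

abbreviation T where "T w \<equiv> loc H (tw H w)"
abbreviation E where "E \<equiv> remb H"
abbreviation cf where "cf \<equiv> rcoeff_of H"

lemma hom_loc: "loc H 1 = 1" "loc H (x + y) = loc H x + loc H y" "loc H (x * y) = loc H x * loc H y"
  and hom_E: "E 1 = 1" "E (r + s) = E r + E s" "E (r * s) = E r * E s"
  and hom_emb: "emb H 1 = 1" "emb H (p + q) = emb H p + emb H q" "emb H (p * q) = emb H p * emb H q"
  and loc_emb: "loc H (emb H p) = E (rat p)"
  using gh rh by (simp_all add: graded_hecke_algebra_def rational_hecke_def ring_hom_def)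

lemmas loc_add = additive_simps[of "loc H", OF hom_loc(2)]
lemmas E_add = additive_simps[of E, OF hom_E(2)]
lemmas emb_add = additive_simps[of "emb H", OF hom_emb(2)]

lemma tw_id: "tw H id = 1"
  and tw_comp: "u \<in> W \<Longrightarrow> w \<in> W \<Longrightarrow> tw H (u \<circ> w) = tw H u * tw H w"
  using gh by (simp_all add: graded_hecke_algebra_def)

lemma T_id: "T id = 1"
  by (simp only: tw_id hom_loc)
lemma T_comp: "u \<in> W \<Longrightarrow> w \<in> W \<Longrightarrow> T (u \<circ> w) = T u * T w"
  by (simp only: tw_comp hom_loc)

lemma E_commute: "E a * E b = E b * E a"
  by (metis hom_E(3) mult.commute)
lemma emb_commute: "emb H p * emb H q = emb H q * emb H p"
  by (metis hom_emb(3) mult.commute)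

lemma cf_spec: "(\<forall>w. w \<notin> W \<longrightarrow> cf g w = 0) \<and> g = (\<Sum>w\<in>W. T w * E (cf g w))"
proof -
  have "\<exists>!a. (\<forall>w. w \<notin> W \<longrightarrow> a w = 0) \<and> g = (\<Sum>w\<in>W. T w * E (a w))"
    using rh unfolding rational_hecke_def by blast
  from theI'[OF this] show ?thesis unfolding rcoeff_of_def .
qed

lemma cf_outside: "w \<notin> W \<Longrightarrow> cf g w = 0"
  and cf_expand: "g = (\<Sum>w\<in>W. T w * E (cf g w))"
  using cf_spec by blast+

lemma cf_unique:
  assumes "\<And>w. w \<notin> W \<Longrightarrow> a w = 0" "g = (\<Sum>w\<in>W. T w * E (a w))"
  shows "cf g = a"
proof -
  have "\<exists>!a. (\<forall>w. w \<notin> W \<longrightarrow> a w = 0) \<and> g = (\<Sum>w\<in>W. T w * E (a w))"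
    using rh unfolding rational_hecke_def by blast
  then show ?thesis using cf_spec[of g] assms by blast
qed

lemma cf_sum_T:
  assumes "w \<in> W"
  shows "cf (\<Sum>w\<in>W. T w * E (a w)) w = a w"
proof -
  have "cf (\<Sum>w\<in>W. T w * E (a w)) = (\<lambda>w. if w \<in> W then a w else 0)"
    by (rule cf_unique) (auto intro: sum.cong)
  then show ?thesis using assms by simp
qed

lemma cf_add: "cf (g + g') w = cf g w + cf g' w"
proof -
  have "g + g' = (\<Sum>w\<in>W. T w * E (cf g w + cf g' w))"
    by (subst cf_expand[of g], subst cf_expand[of g'])
      (simp add: hom_E distrib_left sum.distrib)
  then have "cf (g + g') = (\<lambda>w. cf g w + cf g' w)"
    by (rule cf_unique[rotated]) (simp add: cf_outside)
  then show ?thesis by simp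
qed

lemmas cf_add' = additive_simps[of "\<lambda>g. cf g w" for w, OF cf_add]

lemma cf_eqI: "(\<And>w. w \<in> W \<Longrightarrow> cf g w = cf g' w) \<Longrightarrow> g = g'"
  by (subst cf_expand[of g], subst cf_expand[of g']) (rule sum.cong, auto)

lemma cf_mult_E: "cf (g * E a) w = cf g w * a"
proof -
  have "g * E a = (\<Sum>w\<in>W. T w * E (cf g w * a))"
    by (subst cf_expand[of g]) (simp add: hom_E sum_distrib_right mult.assoc)
  then have "cf (g * E a) = (\<lambda>w. cf g w * a)"
    by (rule cf_unique[rotated]) (simp add: cf_outside)
  then show ?thesis by simp
qed

lemma sum_W_left: "u \<in> W \<Longrightarrow> (\<Sum>w\<in>W. f (u \<circ> w)) = (\<Sum>w\<in>W. f w)"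
  by (rule sum.reindex_bij_witness[of _ "\<lambda>w. inv u \<circ> w" "\<lambda>w. u \<circ> w"])
    (auto intro: comp_W inv_W)

lemma sum_W_right: "u \<in> W \<Longrightarrow> (\<Sum>w\<in>W. f (w \<circ> u)) = (\<Sum>w\<in>W. f w)"
  by (rule sum.reindex_bij_witness[of _ "\<lambda>w. w \<circ> inv u" "\<lambda>w. w \<circ> u"])
    (auto simp: comp_assoc intro: comp_W inv_W)

lemma cf_T_mult:
  assumes "u \<in> W" "w \<in> W"
  shows "cf (T u * g) w = cf g (inv u \<circ> w)"
proof -
  have "T u * g = (\<Sum>w\<in>W. T u * (T w * E (cf g w)))"
    by (subst cf_expand[of g]) (simp only: sum_distrib_left)
  also have "\<dots> = (\<Sum>w\<in>W. T (u \<circ> w) * E (cf g (inv u \<circ> (u \<circ> w))))"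
    using assms by (intro sum.cong) (simp_all add: T_comp mult.assoc)
  also have "\<dots> = (\<Sum>w\<in>W. T w * E (cf g (inv u \<circ> w)))"
    by (rule sum_W_left[OF assms(1), of "\<lambda>w. T w * E (cf g (inv u \<circ> w))"])
  finally show ?thesis using cf_sum_T[OF assms(2)] by simp
qed

lemma cf_one: "w \<in> W \<Longrightarrow> cf 1 w = (if w = id then 1 else 0)"
proof -
  assume w: "w \<in> W"
  have "(1::'g) = (\<Sum>w\<in>W. T w * E (if w = id then 1 else 0))"
  proof -
    have "(\<Sum>w\<in>W. T w * E (if w = id then 1 else 0)) = (\<Sum>w\<in>W. if w = id then T id else 0)"
      by (rule sum.cong) (auto simp: hom_E E_add)
    also have "\<dots> = T id" using finite_W id_W by (subst sum.delta) (simp_all del: id_W)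
    finally show ?thesis by (simp only: T_id)
  qed
  then show ?thesis using cf_sum_T[OF w, of "\<lambda>w. if w = id then 1 else 0"] by simp
qed

lemma cf_T_E: "u \<in> W \<Longrightarrow> w \<in> W \<Longrightarrow> cf (T u * E a) w = (if w = u then a else 0)"
proof -
  assume u: "u \<in> W" and w: "w \<in> W"
  have "cf (T u * 1) w = (if inv u \<circ> w = id then 1 else 0)"
    using cf_T_mult[OF u w, of 1] cf_one[OF comp_W[OF inv_W[OF u] w]] by simp
  moreover have "inv u \<circ> w = id \<longleftrightarrow> w = u"
  proof
    assume "inv u \<circ> w = id"
    then have "u \<circ> (inv u \<circ> w) = u" by simp
    then show "w = u" using u by simp
  qed (use u in simp)
  ultimately have "cf (T u) w = (if w = u then 1 else 0)" by simp
  then show ?thesis by (simp add: cf_mult_E)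
qed

lemma cf_E: "w \<in> W \<Longrightarrow> cf (E a) w = (if w = id then a else 0)"
  using cf_mult_E[of 1 a w] cf_one[of w] by simp

definition hc :: "'h \<Rightarrow> ('v \<Rightarrow> 'v) \<Rightarrow> 'd sym" where "hc h = coeff_of H h"

lemma hc_spec: "(\<forall>w. w \<notin> W \<longrightarrow> hc h w = 0) \<and> h = (\<Sum>w\<in>W. tw H w * emb H (hc h w))"
proof -
  have "\<exists>!a. (\<forall>w. w \<notin> W \<longrightarrow> a w = 0) \<and> h = (\<Sum>w\<in>W. tw H w * emb H (a w))"
    using gh unfolding graded_hecke_algebra_def by blast
  from theI'[OF this] show ?thesis unfolding hc_def coeff_of_def .
qed

lemma hc_outside: "w \<notin> W \<Longrightarrow> hc h w = 0"
  and hc_expand: "h = (\<Sum>w\<in>W. tw H w * emb H (hc h w))"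
  using hc_spec by blast+

lemma loc_expand: "loc H h = (\<Sum>w\<in>W. T w * E (rat (hc h w)))"
  by (subst hc_expand) (simp add: loc_add hom_loc loc_emb)

lemma cf_loc: "cf (loc H h) w = rat (hc h w)"
proof (cases "w \<in> W")
  case True
  then show ?thesis by (subst loc_expand) (rule cf_sum_T)
next
  case False
  then show ?thesis by (simp add: cf_outside hc_outside rat_simps)
qed

lemma loc_inj: "loc H h = loc H h' \<Longrightarrow> h = h'"
proof -
  assume "loc H h = loc H h'"
  then have "hc h w = hc h' w" for w using cf_loc rat_eq_iff by metis
  then show ?thesis using hc_expand[of h] hc_expand[of h'] by simp
qed

section \<open>Intertwining elements\<close>

text \<open>The numerator shared by both families of rational elements.  It lies in the Hecke algebra itself,
and moving a polynomial past it just applies the reflection: the correction terms of the cross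
relation cancel.\<close>

definition tau :: "'v \<Rightarrow> 'h" where
  "tau \<alpha> = tw H (refl H \<alpha>) * emb H (root_fn H \<alpha>) - emb H (cst (of_real (kpar H \<alpha>)))"

lemma loc_tau: "loc H (tau \<alpha>) = T (refl H \<alpha>) * E (rroot H \<alpha>) - E (rk H \<alpha>)"
  by (simp add: tau_def loc_add hom_loc loc_emb rroot_def rk_def)

lemma tau_intertwines_poly:
  assumes a: "\<alpha> \<in> simples H"
  shows "E (rat p) * loc H (tau \<alpha>) = loc H (tau \<alpha>) * E (rat (sact H (refl H \<alpha>) p))"
proof -
  have aR: "\<alpha> \<in> roots H" using a simples_roots by auto
  let ?s = "refl H \<alpha>"
  obtain q where q: "root_fn H \<alpha> * q = p - sact H ?s p" using root_fn_dvd[OF aR] by blast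
  have c: "emb H p * tw H ?s =
      tw H ?s * emb H (sact H ?s p) + emb H (cst (of_real (kpar H \<alpha>)) * q)"
    using gh a q unfolding graded_hecke_algebra_def by blast
  have "emb H p * tau \<alpha> = emb H p * tw H ?s * emb H (root_fn H \<alpha>)
      - emb H (cst (of_real (kpar H \<alpha>)) * p)"
    by (simp add: tau_def right_diff_distrib mult.assoc hom_emb emb_commute)
  also have "\<dots> = tw H ?s * emb H (sact H ?s p * root_fn H \<alpha>)
      + emb H (cst (of_real (kpar H \<alpha>)) * (q * root_fn H \<alpha> - p))"
    unfolding c by (simp add: distrib_right hom_emb mult.assoc right_diff_distrib emb_add)
  also have "q * root_fn H \<alpha> - p = - sact H ?s p" using q by (simp add: mult.commute)
  also have "tw H ?s * emb H (sact H ?s p * root_fn H \<alpha>) +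
      emb H (cst (of_real (kpar H \<alpha>)) * - sact H ?s p) = tau \<alpha> * emb H (sact H ?s p)"
    by (simp add: tau_def left_diff_distrib mult.assoc hom_emb emb_add emb_commute)
  finally show ?thesis using arg_cong[of _ _ "loc H"] by (metis hom_loc(3) loc_emb)
qed

lemma tau_intertwines:
  assumes a: "\<alpha> \<in> simples H"
  shows "E r * loc H (tau \<alpha>) = loc H (tau \<alpha>) * E (ract (refl H \<alpha>) r)"
proof -
  have aW: "refl H \<alpha> \<in> W" using a simples_roots refl_W by auto
  obtain p q where r: "q \<noteq> 0" "r = rat p / rat q" by (rule fract_cases_rat)
  let ?t = "loc H (tau \<alpha>)" and ?s = "refl H \<alpha>"
  have q0: "rat q \<noteq> 0" using r by (simp add: rat_eq_0_iff)
  have e1: "rat q * r = rat p" using r q0 by simp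
  have e2: "rat (sact H ?s q) * ract ?s r = rat (sact H ?s p)"
    by (metis aW e1 ract_rat ract_simps(4))
  have "E (rat q) * (E r * ?t) = E (rat p) * ?t"
    by (metis e1 hom_E(3) mult.assoc)
  also have "\<dots> = ?t * E (rat (sact H ?s p))" by (rule tau_intertwines_poly[OF a])
  also have "\<dots> = ?t * E (rat (sact H ?s q)) * E (ract ?s r)"
    by (metis e2 hom_E(3) mult.assoc)
  also have "\<dots> = E (rat q) * (?t * E (ract ?s r))"
    by (simp only: tau_intertwines_poly[OF a, symmetric] mult.assoc)
  finally have e: "E (rat q) * (E r * ?t) = E (rat q) * (?t * E (ract ?s r))" .
  have "E (inverse (rat q)) * E (rat q) = 1" using q0 by (simp flip: hom_E)
  then show ?thesis using e by (metis mult.assoc mult_1_left)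
qed

lemma cRs_tau: "cRs H \<alpha> = loc H (tau \<alpha>) * E (inverse (rk H \<alpha> + rroot H \<alpha>))"
  by (simp add: cRs_def loc_tau)

lemma Rs_tau: "Rs H \<alpha> = loc H (tau \<alpha>) * E (inverse (rk H \<alpha> - rroot H \<alpha>))"
  by (simp add: Rs_def loc_tau)

lemma E_cRs: "\<alpha> \<in> simples H \<Longrightarrow> E r * cRs H \<alpha> = cRs H \<alpha> * E (ract (refl H \<alpha>) r)"
  unfolding cRs_tau by (metis (no_types, lifting) E_commute mult.assoc tau_intertwines)

lemma cf_mult_tau:
  assumes a: "\<alpha> \<in> simples H" and y: "y \<in> W"
  shows "cf (g * loc H (tau \<alpha>)) y =
    rroot H \<alpha> * ract (refl H \<alpha>) (cf g (y \<circ> refl H \<alpha>)) - rk H \<alpha> * ract (refl H \<alpha>) (cf g y)"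
proof -
  have aR: "\<alpha> \<in> roots H" using a simples_roots by auto
  let ?s = "refl H \<alpha>"
  have sW: "?s \<in> W" using aR refl_W by blast
  have ss: "w \<circ> ?s \<circ> ?s = w" for w :: "'v \<Rightarrow> 'v" using aR by (simp add: comp_assoc)
  have "g * loc H (tau \<alpha>) = (\<Sum>w\<in>W. T w * (E (cf g w) * loc H (tau \<alpha>)))"
    by (subst cf_expand[of g]) (simp only: sum_distrib_right mult.assoc)
  also have "\<dots> = (\<Sum>w\<in>W. T (w \<circ> ?s) * E (rroot H \<alpha> * ract ?s (cf g (w \<circ> ?s \<circ> ?s)))
      - T w * E (rk H \<alpha> * ract ?s (cf g w)))"
  proof (rule sum.cong[OF HOL.refl])
    fix w assume w: "w \<in> W"
    have "T w * (E (cf g w) * loc H (tau \<alpha>)) = T w * loc H (tau \<alpha>) * E (ract ?s (cf g w))"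
      by (simp only: tau_intertwines[OF a] mult.assoc)
    also have "T w * loc H (tau \<alpha>) = T (w \<circ> ?s) * E (rroot H \<alpha>) - T w * E (rk H \<alpha>)"
      by (simp add: loc_tau right_diff_distrib T_comp[OF w sW] mult.assoc)
    also have "(T (w \<circ> ?s) * E (rroot H \<alpha>) - T w * E (rk H \<alpha>)) * E (ract ?s (cf g w)) =
        T (w \<circ> ?s) * E (rroot H \<alpha> * ract ?s (cf g w)) - T w * E (rk H \<alpha> * ract ?s (cf g w))"
      by (simp add: left_diff_distrib mult.assoc hom_E)
    finally show "T w * (E (cf g w) * loc H (tau \<alpha>)) =
        T (w \<circ> ?s) * E (rroot H \<alpha> * ract ?s (cf g (w \<circ> ?s \<circ> ?s))) - T w * E (rk H \<alpha> * ract ?s (cf g w))"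
      by (simp only: ss)
  qed
  also have "\<dots> = (\<Sum>w\<in>W. T w * E (rroot H \<alpha> * ract ?s (cf g (w \<circ> ?s)) - rk H \<alpha> * ract ?s (cf g w)))"
    using sum_W_right[OF sW, of "\<lambda>w. T w * E (rroot H \<alpha> * ract ?s (cf g (w \<circ> ?s)))"]
    by (simp add: sum_subtractf E_add right_diff_distrib)
  finally show ?thesis using cf_sum_T[OF y] by simp
qed

text \<open>In this form right multiplication by \<open>cRs\<close> adds at most the translates by \<open>s\<^sub>\<alpha>\<close> to the support,
and the new coefficients are explicit.\<close>

lemma cf_mult_cRs:
  assumes a: "\<alpha> \<in> simples H" and y: "y \<in> W"
  shows "cf (g * cRs H \<alpha>) y = (rroot H \<alpha> * ract (refl H \<alpha>) (cf g (y \<circ> refl H \<alpha>))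
    - rk H \<alpha> * ract (refl H \<alpha>) (cf g y)) / (rk H \<alpha> + rroot H \<alpha>)"
  unfolding cRs_tau mult.assoc[symmetric] cf_mult_E cf_mult_tau[OF assms]
  by (simp add: divide_inverse)

lemma rank_one_nonzero:
  assumes "\<alpha> \<in> simples H"
  shows "rroot H \<alpha> \<noteq> 0" "rk H \<alpha> + rroot H \<alpha> \<noteq> 0" "rk H \<alpha> - rroot H \<alpha> \<noteq> 0"
    "ract (refl H \<alpha>) (rroot H \<alpha>) = - rroot H \<alpha>" "ract (refl H \<alpha>) (rk H \<alpha>) = rk H \<alpha>"
proof -
  have aR: "\<alpha> \<in> roots H" "refl H \<alpha> \<in> W" using assms simples_roots refl_W by auto
  show "rroot H \<alpha> \<noteq> 0" "rk H \<alpha> + rroot H \<alpha> \<noteq> 0" "rk H \<alpha> - rroot H \<alpha> \<noteq> 0"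
    using rroot_nonzero[OF aR(1)] by auto
  show "ract (refl H \<alpha>) (rroot H \<alpha>) = - rroot H \<alpha>" "ract (refl H \<alpha>) (rk H \<alpha>) = rk H \<alpha>"
    by (simp_all add: ract_rroot ract_rk aR refl_self rroot_neg rk_neg)
qed

lemma cRs_square:
  assumes a: "\<alpha> \<in> simples H"
  shows "cRs H \<alpha> * cRs H \<alpha> = 1"
proof (rule cf_eqI)
  fix y assume y: "y \<in> W"
  let ?s = "refl H \<alpha>" and ?a = "rroot H \<alpha>" and ?k = "rk H \<alpha>"
  have aR: "\<alpha> \<in> roots H" using a simples_roots by auto
  have sW: "?s \<in> W" using aR refl_W by blast
  have ys: "y \<circ> ?s \<in> W" using y sW comp_W by blast
  have ss: "y \<circ> ?s \<circ> ?s = y" using aR by (simp add: comp_assoc)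
  have sid: "?s \<noteq> id"
  proof
    assume "?s = id"
    then have "?s \<alpha> = \<alpha>" by simp
    then have "\<alpha> = - \<alpha>" using refl_self[OF aR] by simp
    then have "(2::real) *\<^sub>R \<alpha> = 0" by (metis add.right_inverse scaleR_2)
    then show False using aR zero_notin_roots by auto
  qed
  note nz = rank_one_nonzero[OF a]
  note R = ract_simps[OF sW] ract_diff[OF sW] ract_divide[OF sW]
  have c1: "cf (cRs H \<alpha>) w = (?a * (if w \<circ> ?s = id then 1 else 0) - ?k * (if w = id then 1 else 0))
      / (?k + ?a)" if "w \<in> W" for w
  proof -
    have "w \<circ> ?s \<in> W" using that sW comp_W by blast
    then show ?thesis using cf_mult_cRs[OF a that, of 1] that sid by (simp add: cf_one R)
  qed
  have e: "cf (cRs H \<alpha> * cRs H \<alpha>) y = (?a * ract ?s (cf (cRs H \<alpha>) (y \<circ> ?s))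
      - ?k * ract ?s (cf (cRs H \<alpha>) y)) / (?k + ?a)"
    by (rule cf_mult_cRs[OF a y])
  have iff: "y \<circ> ?s = id \<longleftrightarrow> y = ?s"
    using aR ss by (metis refl_comp_refl id_comp)
  show "cf (cRs H \<alpha> * cRs H \<alpha>) y = cf 1 y"
  proof (cases "y = id")
    case True
    then have "cf (cRs H \<alpha>) y = - ?k / (?k + ?a)" "cf (cRs H \<alpha>) (y \<circ> ?s) = ?a / (?k + ?a)"
      using c1[OF y] c1[OF ys] ss sid iff by auto
    then have "cf (cRs H \<alpha> * cRs H \<alpha>) y =
        (?a * (- ?a / (?k - ?a)) - ?k * (- ?k / (?k - ?a))) / (?k + ?a)"
      unfolding e by (simp add: R nz)
    also have "?a * (- ?a / (?k - ?a)) - ?k * (- ?k / (?k - ?a)) = (?k * ?k - ?a * ?a) / (?k - ?a)"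
      by (simp add: diff_divide_distrib)
    also have "\<dots> = ?k + ?a" using nz by (simp add: square_diff_square_factored)
    also have "(?k + ?a) / (?k + ?a) = 1" using nz by simp
    finally show ?thesis using cf_one[OF y] True by metis
  next
    case False
    show ?thesis
    proof (cases "y = ?s")
      case True
      then have "cf (cRs H \<alpha>) y = ?a / (?k + ?a)" "cf (cRs H \<alpha>) (y \<circ> ?s) = - ?k / (?k + ?a)"
        using c1[OF y] c1[OF ys] ss sid iff by auto
      then have "cf (cRs H \<alpha> * cRs H \<alpha>) y =
          (?a * (- ?k / (?k - ?a)) - ?k * (- ?a / (?k - ?a))) / (?k + ?a)"
        unfolding e by (simp add: R nz)
      also have "\<dots> = 0" using nz by (simp add: field_simps)
      finally show ?thesis using cf_one[OF y] False by simp
    next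
      case F: False
      then have "cf (cRs H \<alpha>) y = 0" "cf (cRs H \<alpha>) (y \<circ> ?s) = 0"
        using c1[OF y] c1[OF ys] ss False iff by auto
      then show ?thesis unfolding e using cf_one[OF y] False by (simp add: R)
    qed
  qed
qed

lemma T_refl_cRs:
  assumes a: "\<alpha> \<in> simples H"
  shows "T (refl H \<alpha>) = cRs H \<alpha> * E ((rk H \<alpha> + rroot H \<alpha>) / rroot H \<alpha>) + E (rk H \<alpha> / rroot H \<alpha>)"
proof -
  note nz = rank_one_nonzero[OF a]
  have "cRs H \<alpha> * E ((rk H \<alpha> + rroot H \<alpha>) / rroot H \<alpha>) = loc H (tau \<alpha>) * E (inverse (rroot H \<alpha>))"
    unfolding cRs_tau mult.assoc hom_E(3)[symmetric] using nz by (simp add: field_simps)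
  also have "\<dots> = T (refl H \<alpha>) * E (rroot H \<alpha> * inverse (rroot H \<alpha>)) - E (rk H \<alpha> * inverse (rroot H \<alpha>))"
    by (simp add: loc_tau left_diff_distrib mult.assoc hom_E)
  also have "\<dots> = T (refl H \<alpha>) - E (rk H \<alpha> / rroot H \<alpha>)"
    using nz by (simp add: hom_E divide_inverse)
  finally show ?thesis by simp
qed

lemma cf_mult_T_refl:
  assumes a: "\<alpha> \<in> simples H" and y: "y \<in> W"
  shows "cf (g * T (refl H \<alpha>)) y = ract (refl H \<alpha>) (cf g (y \<circ> refl H \<alpha>))
    + rk H \<alpha> / rroot H \<alpha> * (cf g y - ract (refl H \<alpha>) (cf g y))"
proof -
  note nz = rank_one_nonzero[OF a]
  have "cf (g * T (refl H \<alpha>)) y =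
      cf (g * cRs H \<alpha> * E ((rk H \<alpha> + rroot H \<alpha>) / rroot H \<alpha>) + g * E (rk H \<alpha> / rroot H \<alpha>)) y"
    unfolding T_refl_cRs[OF a] by (simp add: distrib_left mult.assoc)
  also have "\<dots> = cf (g * cRs H \<alpha>) y * ((rk H \<alpha> + rroot H \<alpha>) / rroot H \<alpha>)
      + cf g y * (rk H \<alpha> / rroot H \<alpha>)"
    by (simp only: cf_add cf_mult_E)
  finally have e: "cf (g * T (refl H \<alpha>)) y = cf (g * cRs H \<alpha>) y * ((rk H \<alpha> + rroot H \<alpha>) / rroot H \<alpha>)
      + cf g y * (rk H \<alpha> / rroot H \<alpha>)" .
  have "(a * u - k * v) / (k + a) * ((k + a) / a) + c * (k / a) = u + k / a * (c - v)"
    if "a \<noteq> 0" "k + a \<noteq> 0" for a k u v c :: "'d sym fract"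
  proof -
    have "(a * u - k * v) / (k + a) * ((k + a) / a) = (a * u - k * v) / a" using that by simp
    also have "\<dots> = u - k / a * v" using that by (simp add: diff_divide_distrib)
    finally show ?thesis by (simp add: right_diff_distrib)
  qed
  then show ?thesis unfolding e cf_mult_cRs[OF assms] using nz by blast
qed

text \<open>Moving a rational function past \<open>t\<^sub>w\<close> twists it by the inverse of \<open>w\<close>, up to terms of smaller
  length.\<close>

lemma cf_E_T:
  assumes "w \<in> W"
  shows "cf (E a * T w) w = ract (inv w) a"
    "cf (E a * T w) y \<noteq> 0 \<Longrightarrow> y = w \<or> N y < N w"
proof -
  obtain as where as: "reduced_word H w as" using reduced_word_exists assms by blast
  have "cf (E a * T w) w = ract (inv w) a \<and> (\<forall>y. cf (E a * T w) y \<noteq> 0 \<longrightarrow> y = w \<or> N y < N w)"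
    using as assms
  proof (induction w as rule: reduced_word_induct)
    case Nil
    have "inv id = (id :: 'v \<Rightarrow> 'v)" by simp
    then show ?case using cf_E cf_outside id_W unfolding T_id
      by (metis mult.right_neutral ract_id)
  next
    case (snoc u as \<alpha>)
    let ?s = "refl H \<alpha>"
    have sR: "\<alpha> \<in> roots H" using snoc simples_roots by auto
    have sW: "?s \<in> W" using sR refl_W by blast
    have N: "N (u \<circ> ?s) = Suc (N u)" using N_refl_right snoc by blast
    have ss: "y \<circ> ?s \<circ> ?s = y" for y :: "'v \<Rightarrow> 'v" using sR by (simp add: comp_assoc)
    have e: "E a * T (u \<circ> ?s) = E a * T u * T ?s"
      using snoc sW by (simp add: T_comp mult.assoc)
    note R = ract_simps[OF sW] ract_diff[OF sW]
    have z: "cf (E a * T u) (u \<circ> ?s) = 0" using snoc N by (metis less_SucI n_not_Suc_n not_less_eq)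
    have l: "cf (E a * T (u \<circ> ?s)) (u \<circ> ?s) = ract (inv (u \<circ> ?s)) a"
      unfolding e cf_mult_T_refl[OF snoc(2) comp_W[OF snoc(1) sW]] ss z
      using snoc sW sR
      by (simp add: R inv_comp_distrib inv_refl ract_comp inv_W del: comp_apply)
    have "y = u \<circ> ?s \<or> N y < N (u \<circ> ?s)" if y: "cf (E a * T (u \<circ> ?s)) y \<noteq> 0" for y
    proof -
      have yW: "y \<in> W" using y cf_outside by blast
      have "cf (E a * T u) (y \<circ> ?s) \<noteq> 0 \<or> cf (E a * T u) y \<noteq> 0"
        using y unfolding e cf_mult_T_refl[OF snoc(2) yW] by (auto simp: R)
      then show ?thesis
      proof
        assume "cf (E a * T u) (y \<circ> ?s) \<noteq> 0"
        then have "y \<circ> ?s = u \<or> N (y \<circ> ?s) < N u" using snoc by blast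
        then show ?thesis
        proof
          assume "y \<circ> ?s = u"
          then show ?thesis using ss by metis
        next
          assume l: "N (y \<circ> ?s) < N u"
          have "N y \<le> Suc (N (y \<circ> ?s))"
            using N_refl_right[OF yW snoc(2)] N_refl_right_neg[OF yW snoc(2)]
            by (cases "y \<alpha> \<in> P") auto
          then show ?thesis using l N by simp
        qed
      next
        assume "cf (E a * T u) y \<noteq> 0"
        then have "y = u \<or> N y < N u" using snoc by blast
        then show ?thesis using N by auto
      qed
    qed
    then show ?case using l by blast
  qed
  then show "cf (E a * T w) w = ract (inv w) a"
    "cf (E a * T w) y \<noteq> 0 \<Longrightarrow> y = w \<or> N y < N w" by blast+
qed

lemma cf_E_mult_max:
  assumes y: "y \<in> W" and mx: "\<And>w. cf g w \<noteq> 0 \<Longrightarrow> N w \<le> N y"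
  shows "cf (E a * g) y = ract (inv y) a * cf g y"
proof -
  have "E a * g = (\<Sum>w\<in>W. E a * T w * E (cf g w))"
    by (subst cf_expand[of g]) (simp add: sum_distrib_left mult.assoc)
  then have "cf (E a * g) y = (\<Sum>w\<in>W. cf (E a * T w * E (cf g w)) y)"
    by (simp only: cf_add')
  also have "\<dots> = (\<Sum>w\<in>W. cf (E a * T w) y * cf g w)" by (simp only: cf_mult_E)
  also have "\<dots> = (\<Sum>w\<in>W. if w = y then ract (inv y) a * cf g y else 0)"
  proof (rule sum.cong[OF HOL.refl])
    fix w assume w: "w \<in> W"
    show "cf (E a * T w) y * cf g w = (if w = y then ract (inv y) a * cf g y else 0)"
    proof (cases "w = y")
      case True
      then show ?thesis using cf_E_T(1)[OF w] by simp
    next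
      case False
      have "cf (E a * T w) y = 0 \<or> cf g w = 0"
        using cf_E_T(2)[OF w, of a y] mx[of w] False by force
      then show ?thesis using False by auto
    qed
  qed
  also have "\<dots> = ract (inv y) a * cf g y" using finite_W y by (simp add: sum.delta)
  finally show ?thesis .
qed

text \<open>An element that twists all rational functions by \<open>w\<close> is a multiple of the intertwiner of
  \<open>w\<close>, hence vanishes as soon as its coefficient at \<open>t\<^sub>w\<close> does: its longest term would twist by a
  different group element.\<close>

lemma twisting_zero:
  assumes w: "w \<in> W" and t: "\<And>a. E a * g = g * E (ract (inv w) a)" and z: "cf g w = 0"
  shows "g = 0"
proof (rule ccontr)
  assume "g \<noteq> 0"
  then obtain y0 where "y0 \<in> W" "cf g y0 \<noteq> 0" using cf_eqI[of g 0] cf_add'(1) by metis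
  then have ne: "{y. cf g y \<noteq> 0} \<noteq> {}" by blast
  have fin: "finite {y. cf g y \<noteq> 0}"
    by (rule finite_subset[OF _ finite_W]) (use cf_outside in blast)
  have "Max (N ` {y. cf g y \<noteq> 0}) \<in> N ` {y. cf g y \<noteq> 0}"
    using fin ne by (intro Max_in) auto
  then obtain y where y0: "cf g y \<noteq> 0" "N y = Max (N ` {y. cf g y \<noteq> 0})" by auto
  have y: "cf g y \<noteq> 0" "\<And>w. cf g w \<noteq> 0 \<Longrightarrow> N w \<le> N y"
    using y0 fin by (auto intro!: Max_ge)
  have yW: "y \<in> W" using y cf_outside by blast
  have "ract (inv y) a = ract (inv w) a" for a
  proof -
    have "ract (inv y) a * cf g y = cf g y * ract (inv w) a"
      using cf_E_mult_max[OF yW y(2), where a = a] t[of a] cf_mult_E by metis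
    then show ?thesis using y(1) by (simp add: mult.commute)
  qed
  then have "ract (y \<circ> inv w) a = a" for a
    unfolding ract_comp[OF yW inv_W[OF w]] using ract_inv(1)[OF yW, of a] by metis
  then have "y \<circ> inv w = id" using ract_faithful comp_W[OF yW inv_W[OF w]] by blast
  then have "y \<circ> inv w \<circ> w = id \<circ> w" by (rule arg_cong)
  then have "y = w" using w by (simp only: comp_assoc inv_comp_W comp_id id_comp)
  then show False using y z by simp
qed

section \<open>Products along words\<close>

definition cRw :: "'v list \<Rightarrow> 'g" where "cRw as = prod_list (map (cRs H) as)"

lemma cRw_simps: "cRw [] = 1" "cRw (as @ bs) = cRw as * cRw bs" "cRw [a] = cRs H a"
  by (simp_all add: cRw_def)

lemma E_cRw:
  assumes "set as \<subseteq> simples H"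
  shows "E r * cRw as = cRw as * E (ract (inv (word_prod H as)) r)"
  using assms
proof (induction as arbitrary: r rule: rev_induct)
  case Nil
  have "ract (inv (word_prod H [])) r = r" by (simp only: word_prod_Nil inv_id ract_id)
  then show ?case by (simp only: cRw_simps mult_1_left mult_1_right)
next
  case (snoc a as)
  have a: "a \<in> simples H" "a \<in> roots H" "refl H a \<in> W" using snoc simples_roots refl_W by auto
  have u: "word_prod H as \<in> W" using snoc word_prod_W by simp
  have i: "ract (inv (word_prod H (as @ [a]))) r = ract (refl H a) (ract (inv (word_prod H as)) r)"
    using inv_comp_distrib[OF u a(3)] ract_comp[OF a(3) inv_W[OF u]] inv_refl[OF a(2)]
    by (simp only: word_prod_append word_prod_Cons word_prod_Nil comp_id)
  have "E r * cRw (as @ [a]) = cRw as * (E (ract (inv (word_prod H as)) r) * cRs H a)"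
    using snoc by (simp only: cRw_simps mult.assoc[symmetric]) simp
  then show ?case unfolding i by (simp add: E_cRs[OF a(1)] cRw_simps mult.assoc)
qed

text \<open>The coefficient of \<open>cR w\<close> at \<open>t\<^sub>w\<close>.  As a product over inversions it does not refer to a word.\<close>

definition lead :: "('v \<Rightarrow> 'v) \<Rightarrow> 'd sym fract" where
  "lead w = (\<Prod>\<gamma>\<in>Inv w. rroot H \<gamma> / (rk H \<gamma> + rroot H \<gamma>))"

lemma prod_Inv_snoc:
  assumes "u \<in> W" "\<alpha> \<in> simples H" "u \<alpha> \<in> P"
    and "\<And>\<gamma>. \<gamma> \<in> roots H \<Longrightarrow> ract (refl H \<alpha>) (f \<gamma>) = f (refl H \<alpha> \<gamma>)"
  shows "(\<Prod>\<gamma>\<in>Inv (u \<circ> refl H \<alpha>). f \<gamma>) = f \<alpha> * ract (refl H \<alpha>) (\<Prod>\<gamma>\<in>Inv u. f \<gamma>)"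
proof -
  have sR: "\<alpha> \<in> roots H" "refl H \<alpha> \<in> W" using assms simples_roots refl_W by auto
  have inj: "inj_on (refl H \<alpha>) (Inv u)" using sR by (metis inj_onI refl_refl)
  have "(\<Prod>\<gamma>\<in>Inv (u \<circ> refl H \<alpha>). f \<gamma>) = f \<alpha> * (\<Prod>\<gamma>\<in>Inv u. f (refl H \<alpha> \<gamma>))"
  proof -
    note I = Inv_refl_right[OF assms(1-3)]
    have "(\<Prod>\<gamma>\<in>Inv (u \<circ> refl H \<alpha>). f \<gamma>) = f \<alpha> * (\<Prod>\<gamma>\<in>refl H \<alpha> ` Inv u. f \<gamma>)"
      unfolding I(1) using finite_Inv I(2) by (intro prod.insert) auto
    then show ?thesis using prod.reindex[OF inj, of f] by (simp only: comp_def)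
  qed
  also have "(\<Prod>\<gamma>\<in>Inv u. f (refl H \<alpha> \<gamma>)) = (\<Prod>\<gamma>\<in>Inv u. ract (refl H \<alpha>) (f \<gamma>))"
    using assms(4) P_roots by (intro prod.cong) (auto simp: Inv_def)
  finally show ?thesis using ract_prod[OF sR(2)] by metis
qed

lemma factor_equivariant:
  assumes "w \<in> W" "\<gamma> \<in> roots H"
  shows "ract w (rroot H \<gamma> / (rk H \<gamma> + rroot H \<gamma>)) = rroot H (w \<gamma>) / (rk H (w \<gamma>) + rroot H (w \<gamma>))"
  using assms by (simp add: ract_divide ract_simps ract_rroot ract_rk)

lemma cRw_reduced:
  assumes "reduced_word H w as" "w \<in> W"
  shows "cf (cRw as) w = lead w"
    "cf (cRw as) y \<noteq> 0 \<Longrightarrow> y = w \<or> N y < N w"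
    "cf (cRw as) y \<noteq> 0 \<Longrightarrow> bruhat y w"
proof -
  have "cf (cRw as) w = lead w \<and> (\<forall>y. cf (cRw as) y \<noteq> 0 \<longrightarrow> (y = w \<or> N y < N w) \<and> bruhat y w)"
    using assms
  proof (induction w as rule: reduced_word_induct)
    case Nil
    have "cf (cRw []) id = 1" using cf_one[OF id_W] by (simp add: cRw_simps)
    moreover have "lead id = 1" by (simp only: lead_def Inv_id prod.empty)
    moreover have "y = id" if "cf (cRw []) y \<noteq> 0" for y
      using that cf_one[of y] cf_outside[of y 1] by (metis cRw_simps(1))
    ultimately show ?case using bruhat.refl by metis
  next
    case (snoc u as \<alpha>)
    let ?s = "refl H \<alpha>"
    have sR: "\<alpha> \<in> roots H" using snoc simples_roots by auto
    have sW: "?s \<in> W" using sR refl_W by blast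
    have usW: "u \<circ> ?s \<in> W" using snoc sW comp_W by blast
    have N: "N (u \<circ> ?s) = Suc (N u)" using N_refl_right snoc by blast
    have ss: "y \<circ> ?s \<circ> ?s = y" for y :: "'v \<Rightarrow> 'v" using sR by (simp add: comp_assoc)
    note R = ract_simps[OF sW] ract_diff[OF sW]
    have e: "cRw (as @ [\<alpha>]) = cRw as * cRs H \<alpha>" by (simp add: cRw_simps)
    have z: "cf (cRw as) (u \<circ> ?s) = 0" using snoc N by (metis less_SucI n_not_Suc_n not_less_eq)
    have "cf (cRw (as @ [\<alpha>])) (u \<circ> ?s) = rroot H \<alpha> / (rk H \<alpha> + rroot H \<alpha>) * ract ?s (lead u)"
      unfolding e cf_mult_cRs[OF snoc(2) usW] ss z using snoc by (simp add: R)
    also have "\<dots> = lead (u \<circ> ?s)"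
      unfolding lead_def
      by (rule prod_Inv_snoc[OF snoc(1-3), symmetric]) (rule factor_equivariant[OF sW])
    finally have l: "cf (cRw (as @ [\<alpha>])) (u \<circ> ?s) = lead (u \<circ> ?s)" .
    have "(y = u \<circ> ?s \<or> N y < N (u \<circ> ?s)) \<and> bruhat y (u \<circ> ?s)" if y: "cf (cRw (as @ [\<alpha>])) y \<noteq> 0" for y
    proof -
      have yW: "y \<in> W" using y cf_outside by blast
      have "cf (cRw as) (y \<circ> ?s) \<noteq> 0 \<or> cf (cRw as) y \<noteq> 0"
        using y unfolding e cf_mult_cRs[OF snoc(2) yW] by (auto simp: R)
      then show ?thesis
      proof
        assume c: "cf (cRw as) (y \<circ> ?s) \<noteq> 0"
        have ysW: "y \<circ> ?s \<in> W" using yW sW comp_W by blast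
        have "bruhat (y \<circ> ?s) u" using snoc c by blast
        then have "bruhat (y \<circ> ?s \<circ> ?s) (u \<circ> ?s)"
          by (rule bruhat_lift[OF _ ysW snoc(1-3)])
        then have b: "bruhat y (u \<circ> ?s)" using ss by simp
        have "y \<circ> ?s = u \<or> N (y \<circ> ?s) < N u" using snoc c by blast
        then show ?thesis
        proof
          assume "y \<circ> ?s = u"
          then show ?thesis using ss b by metis
        next
          assume l: "N (y \<circ> ?s) < N u"
          have "N y \<le> Suc (N (y \<circ> ?s))"
            using N_refl_right[OF yW snoc(2)] N_refl_right_neg[OF yW snoc(2)]
            by (cases "y \<alpha> \<in> P") auto
          then show ?thesis using l N b by simp
        qed
      next
        assume c: "cf (cRw as) y \<noteq> 0"
        then have "bruhat y (u \<circ> ?s)" using bruhat_snoc snoc by blast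
        moreover have "y = u \<or> N y < N u" using snoc c by blast
        ultimately show ?thesis using N by auto
      qed
    qed
    then show ?case using l by blast
  qed
  then show "cf (cRw as) w = lead w"
    "cf (cRw as) y \<noteq> 0 \<Longrightarrow> y = w \<or> N y < N w"
    "cf (cRw as) y \<noteq> 0 \<Longrightarrow> bruhat y w" by blast+
qed

text \<open>Independence of the reduced word: the difference of two such products twists rational
  functions by \<open>w\<close> and has no term at \<open>t\<^sub>w\<close>.\<close>

lemma cRw_unique:
  assumes "reduced_word H w as" "reduced_word H w bs" "w \<in> W"
  shows "cRw as = cRw bs"
proof -
  have as: "set as \<subseteq> simples H" "word_prod H as = w" "set bs \<subseteq> simples H" "word_prod H bs = w"
    using assms by (auto simp: reduced_word_def)
  have "cRw as - cRw bs = 0"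
  proof (rule twisting_zero[OF assms(3)])
    show "E a * (cRw as - cRw bs) = (cRw as - cRw bs) * E (ract (inv w) a)" for a
      using E_cRw[OF as(1), of a] E_cRw[OF as(3), of a]
      by (simp add: as(2,4) right_diff_distrib left_diff_distrib)
    show "cf (cRw as - cRw bs) w = 0"
      using cRw_reduced(1)[OF assms(1,3)] cRw_reduced(1)[OF assms(2,3)] by (simp add: cf_add')
  qed
  then show ?thesis by simp
qed

abbreviation cR where "cR \<equiv> cRel H"

lemma some_reduced: "w \<in> W \<Longrightarrow> reduced_word H w (SOME as. reduced_word H w as)"
  using someI_ex[OF reduced_word_exists] .

lemma cR_eq: "reduced_word H w as \<Longrightarrow> w \<in> W \<Longrightarrow> cR w = cRw as"
  unfolding cRel_def using cRw_unique some_reduced by (metis cRw_def)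

lemma cf_cR:
  assumes "w \<in> W"
  shows "cf (cR w) w = lead w" "cf (cR w) y \<noteq> 0 \<Longrightarrow> y = w \<or> N y < N w"
    "cf (cR w) y \<noteq> 0 \<Longrightarrow> bruhat y w"
  using cRw_reduced[OF some_reduced[OF assms] assms] cR_eq[OF some_reduced[OF assms] assms]
  by auto

lemma cR_id: "cR id = 1"
proof -
  have "reduced_word H id []"
    using reduced_word_iff[OF id_W, of "[]"] Inv_id by (metis card.empty empty_subsetI list.set(1) list.size(3) word_prod_Nil)
  then show ?thesis using cR_eq[OF _ id_W] cRw_simps(1) by metis
qed

lemma E_cR: "w \<in> W \<Longrightarrow> E r * cR w = cR w * E (ract (inv w) r)"
  using E_cRw[of "SOME as. reduced_word H w as" r] cR_eq[OF some_reduced] some_reduced[of w]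
  by (simp add: reduced_word_def)

lemma cR_E: "w \<in> W \<Longrightarrow> cR w * E r = E (ract w r) * cR w"
  using E_cR[of w "ract w r"] ract_inv(2)[of w r] by simp

text \<open>For a descent, cancel the last factor by \<open>cRs_square\<close>; this removes any condition on lengths from
the multiplication rule.\<close>

lemma cR_cRs:
  assumes w: "w \<in> W" and a: "\<alpha> \<in> simples H"
  shows "cR w * cRs H \<alpha> = cR (w \<circ> refl H \<alpha>)"
proof -
  have sR: "\<alpha> \<in> roots H" using a simples_roots by auto
  have sW: "refl H \<alpha> \<in> W" using sR refl_W by blast
  have pos: "cR u * cRs H \<alpha> = cR (u \<circ> refl H \<alpha>)" if u: "u \<in> W" "u \<alpha> \<in> P" for u
  proof -
    obtain as where as: "reduced_word H u as" using reduced_word_exists u by blast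
    have usW: "u \<circ> refl H \<alpha> \<in> W" using u sW comp_W by blast
    have "reduced_word H (u \<circ> refl H \<alpha>) (as @ [\<alpha>])"
      using as N_refl_right[OF u(1) a u(2)] a usW u
      by (simp add: reduced_word_iff word_prod_append del: comp_apply)
    then show ?thesis using cR_eq as u usW by (metis cRw_simps(2,3))
  qed
  show ?thesis
  proof (cases "w \<alpha> \<in> P")
    case False
    let ?u = "w \<circ> refl H \<alpha>"
    have u: "?u \<in> W" using w sW comp_W by blast
    have ss: "?u \<circ> refl H \<alpha> = w" using sR by (simp add: comp_assoc)
    have "?u \<alpha> \<in> P" using False sR w not_pos_iff[OF weyl_root] by (simp add: refl_self neg_W)
    then have "cR ?u * cRs H \<alpha> = cR w" using pos[OF u] ss by simp
    then have "cR w * cRs H \<alpha> = cR ?u * (cRs H \<alpha> * cRs H \<alpha>)" by (metis mult.assoc)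
    then show ?thesis using cRs_square[OF a] by (metis mult_1_right)
  qed (use pos w in blast)
qed

lemma cR_refl: "\<alpha> \<in> simples H \<Longrightarrow> cR (refl H \<alpha>) = cRs H \<alpha>"
  using cR_cRs[OF id_W, of \<alpha>] cR_id by simp

lemma cR_comp:
  assumes u: "u \<in> W" and w: "w \<in> W"
  shows "cR (u \<circ> w) = cR u * cR w"
proof -
  obtain as where as: "reduced_word H w as" using reduced_word_exists w by blast
  show ?thesis using as w
  proof (induction w as rule: reduced_word_induct)
    case Nil
    show ?case by (simp only: cR_id comp_id mult_1_right)
  next
    case (snoc w as \<alpha>)
    have "u \<circ> w \<in> W" using u snoc comp_W by blast
    then have "cR (u \<circ> w) * cRs H \<alpha> = cR (u \<circ> w \<circ> refl H \<alpha>)" using cR_cRs snoc(2) by blast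
    then show ?case
      unfolding cR_cRs[OF snoc(1,2), symmetric] snoc(5) by (simp only: comp_assoc mult.assoc)
  qed
qed

lemma cR_inv: "w \<in> W \<Longrightarrow> cR w * cR (inv w) = 1" "w \<in> W \<Longrightarrow> cR (inv w) * cR w = 1"
  using cR_comp[of w "inv w"] cR_comp[of "inv w" w] inv_W cR_id by simp_all

text \<open>The elements \<open>R\<^sub>s\<close>, \<open>\<tau>\<close> and their variants differ from \<open>cRs\<close> by a function of the root.  Moved to the
right end of a reduced word, these functions are taken at the successive inversions.\<close>

lemma prod_word_factor:
  assumes as: "reduced_word H w as" "w \<in> W"
    and Y: "\<And>\<alpha>. \<alpha> \<in> simples H \<Longrightarrow> Y \<alpha> = cRs H \<alpha> * E (f \<alpha>)"
    and f: "\<And>\<alpha> \<gamma>. \<alpha> \<in> simples H \<Longrightarrow> \<gamma> \<in> roots H \<Longrightarrow> ract (refl H \<alpha>) (f \<gamma>) = f (refl H \<alpha> \<gamma>)"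
  shows "prod_list (map Y as) = cR w * E (\<Prod>\<gamma>\<in>Inv w. f \<gamma>)"
  using as
proof (induction w as rule: reduced_word_induct)
  case Nil
  have "(\<Prod>\<gamma>\<in>Inv id. f \<gamma>) = 1" by (simp only: Inv_id prod.empty)
  then show ?case by (simp only: cR_id hom_E list.map prod_list.Nil mult_1)
next
  case (snoc u as \<alpha>)
  have "prod_list (map Y (as @ [\<alpha>])) = cR u * (E (\<Prod>\<gamma>\<in>Inv u. f \<gamma>) * cRs H \<alpha>) * E (f \<alpha>)"
    using snoc Y by (simp add: mult.assoc)
  also have "\<dots> = cR u * cRs H \<alpha> * E (f \<alpha> * ract (refl H \<alpha>) (\<Prod>\<gamma>\<in>Inv u. f \<gamma>))"
    using E_cRs[OF snoc(2)] by (simp add: hom_E mult.assoc E_commute)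
  also have "\<dots> = cR (u \<circ> refl H \<alpha>) * E (\<Prod>\<gamma>\<in>Inv (u \<circ> refl H \<alpha>). f \<gamma>)"
    using cR_cRs[OF snoc(1,2)] prod_Inv_snoc[of u \<alpha> f, OF snoc(1-3) f[OF snoc(2)]] by metis
  finally show ?case .
qed

text \<open>The span is stable under right multiplication by each \<open>t\<^sub>s\<close>, because \<open>t\<^sub>s\<close> is a combination of
\<open>cRs\<close> and \<open>1\<close> with rational coefficients, so it contains all \<open>t\<^sub>w\<close>.\<close>

lemma cR_sum_exists: "\<exists>b. g = (\<Sum>w\<in>W. cR w * E (b w))"
proof -
  define S where "S = {g. \<exists>b. g = (\<Sum>w\<in>W. cR w * E (b w))}"
  have SI: "g \<in> S" if "g = (\<Sum>w\<in>W. cR w * E (b w))" for g b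
    using that unfolding S_def mem_Collect_eq by (rule exI[of _ b])
  have S0: "0 \<in> S" by (rule SI[of _ "\<lambda>_. 0"]) (simp add: E_add)
  have Sadd: "x + y \<in> S" if xy: "x \<in> S" "y \<in> S" for x y
  proof -
    obtain b b' where "x = (\<Sum>w\<in>W. cR w * E (b w))" "y = (\<Sum>w\<in>W. cR w * E (b' w))"
      using xy unfolding S_def by blast
    then show ?thesis
      by (intro SI[of _ "\<lambda>w. b w + b' w"]) (simp add: sum.distrib hom_E distrib_left)
  qed
  have SE: "x * E a \<in> S" if x: "x \<in> S" for x a
  proof -
    obtain b where "x = (\<Sum>w\<in>W. cR w * E (b w))" using x unfolding S_def by blast
    then show ?thesis
      by (intro SI[of _ "\<lambda>w. b w * a"]) (simp add: sum_distrib_right hom_E mult.assoc)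
  qed
  have Scr: "cR w \<in> S" if w: "w \<in> W" for w
  proof -
    have "(\<Sum>u\<in>W. cR u * E (if u = w then 1 else 0)) = (\<Sum>u\<in>W. if u = w then cR w else 0)"
      by (rule sum.cong) (auto simp: hom_E E_add)
    also have "\<dots> = cR w" using finite_W w by (simp add: sum.delta)
    finally show ?thesis by (rule SI[OF sym])
  qed
  have Ssum: "(\<Sum>i\<in>A. x i) \<in> S" if "\<And>i. i \<in> A \<Longrightarrow> x i \<in> S" for A :: "('v \<Rightarrow> 'v) set" and x
    using that by (induction A rule: infinite_finite_induct) (auto intro: S0 Sadd)
  have Scrs: "x * cRs H \<alpha> \<in> S" if x: "x \<in> S" and a: "\<alpha> \<in> simples H" for x \<alpha>
  proof -
    obtain b where b: "x = (\<Sum>w\<in>W. cR w * E (b w))" using x unfolding S_def by blast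
    have sW: "refl H \<alpha> \<in> W" using a simples_roots refl_W by blast
    have "x * cRs H \<alpha> = (\<Sum>w\<in>W. cR (w \<circ> refl H \<alpha>) * E (ract (refl H \<alpha>) (b w)))"
      unfolding b sum_distrib_right
      by (rule sum.cong) (simp_all add: mult.assoc E_cRs[OF a] flip: cR_cRs[OF _ a])
    also have "\<dots> \<in> S" by (rule Ssum) (use SE Scr comp_W sW in blast)
    finally show ?thesis .
  qed
  have ST: "T w \<in> S" if w: "w \<in> W" for w
  proof -
    obtain as where as: "reduced_word H w as" using reduced_word_exists w by blast
    show ?thesis using as w
    proof (induction w as rule: reduced_word_induct)
      case Nil
      show ?case using Scr[OF id_W] cR_id T_id by metis
    next
      case (snoc u as \<alpha>)
      have sW: "refl H \<alpha> \<in> W" using snoc simples_roots refl_W by blast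
      have "T (u \<circ> refl H \<alpha>) = T u * cRs H \<alpha> * E ((rk H \<alpha> + rroot H \<alpha>) / rroot H \<alpha>)
          + T u * E (rk H \<alpha> / rroot H \<alpha>)"
        using T_comp[OF snoc(1) sW] T_refl_cRs[OF snoc(2)] by (simp only: distrib_left mult.assoc)
      then show ?case using snoc Sadd SE Scrs by metis
    qed
  qed
  have "(\<Sum>w\<in>W. T w * E (cf g w)) \<in> S" by (rule Ssum) (use SE ST in blast)
  then show ?thesis using cf_expand[of g] by (simp add: S_def)
qed

text \<open>This reduces additive statements about all rational elements to multiples of intertwiners.\<close>

lemma cR_induct:
  assumes "\<And>w a. w \<in> W \<Longrightarrow> Q (cR w * E a)" "\<And>x y. Q x \<Longrightarrow> Q y \<Longrightarrow> Q (x + y)"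
  shows "Q g"
proof -
  obtain b where b: "g = (\<Sum>w\<in>W. cR w * E (b w))" using cR_sum_exists by blast
  have "cR id * E 0 = 0" by (simp add: E_add)
  then have z: "Q 0" using assms(1)[OF id_W, of 0] by simp
  have "Q (\<Sum>w\<in>A. cR w * E (b w))" if "finite A" "A \<subseteq> W" for A
    using that by (induction A rule: finite_induct) (auto intro: z assms)
  then show ?thesis using b finite_W by blast
qed

end

context hecke
begin

section \<open>Parabolic subalgebras\<close>

lemma subring_zero: "0 \<in> subring_gen X"
  using subring_gen.diff[OF subring_gen.one subring_gen.one, of X] by simp
lemma subring_add: "x \<in> subring_gen X \<Longrightarrow> y \<in> subring_gen X \<Longrightarrow> x + y \<in> subring_gen X"
  using subring_gen.diff[of x X "0 - y"] subring_gen.diff[OF subring_zero, of y X] by simp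
lemma subring_sum: "(\<And>i. i \<in> A \<Longrightarrow> f i \<in> subring_gen X) \<Longrightarrow> (\<Sum>i\<in>A. f i) \<in> subring_gen X"
  by (induction A rule: infinite_finite_induct) (auto intro: subring_zero subring_add)

lemma T_rhecke: "w \<in> WP M \<Longrightarrow> T w \<in> rhecke_par H M"
  and E_rhecke: "E r \<in> rhecke_par H M"
  by (auto simp: rhecke_par_def intro: subring_gen.incl)

lemmas rhecke_closed =
  subring_gen.diff[of _ "loc H ` tw H ` WP M \<union> range E" for M, folded rhecke_par_def]
  subring_gen.mult[of _ "loc H ` tw H ` WP M \<union> range E" for M, folded rhecke_par_def]
  subring_add[of _ "loc H ` tw H ` WP M \<union> range E" for M, folded rhecke_par_def]

lemma rhecke_sum: "(\<And>i. i \<in> A \<Longrightarrow> f i \<in> rhecke_par H M) \<Longrightarrow> (\<Sum>i\<in>A. f i) \<in> rhecke_par H M"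
  unfolding rhecke_par_def by (rule subring_sum)

text \<open>The rational parabolic subalgebra is also generated by the rational functions and the rank
  one intertwiners, whose commutation rules are simpler than those of the \<open>t\<^sub>w\<close>.\<close>

lemma rhecke_induct [consumes 2, case_names E cRs diff mult]:
  assumes M: "M \<subseteq> simples H" and m: "m \<in> rhecke_par H M"
    and E: "\<And>r. Q (E r)" and cRs: "\<And>\<alpha>. \<alpha> \<in> M \<Longrightarrow> Q (cRs H \<alpha>)"
    and diff: "\<And>x y. Q x \<Longrightarrow> Q y \<Longrightarrow> Q (x - y)" and mult: "\<And>x y. Q x \<Longrightarrow> Q y \<Longrightarrow> Q (x * y)"
  shows "Q m"
proof -
  have add: "Q (x + y)" if "Q x" "Q y" for x y
    using diff[OF that(1) diff[OF E[of 0] that(2)]] by (simp add: E_add)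
  have one: "Q 1" using E[of 1] by (simp add: hom_E)
  have T: "Q (T u)" if u: "u \<in> WP M" for u
  proof -
    obtain as where as: "set as \<subseteq> M" "word_prod H as = u" using WP_word u by blast
    have "Q (T (word_prod H as))"
      using as(1)
    proof (induction as)
      case Nil
      show ?case using one by (simp only: word_prod_Nil T_id)
    next
      case (Cons \<alpha> as)
      have a: "\<alpha> \<in> M" "\<alpha> \<in> simples H" "refl H \<alpha> \<in> W" "word_prod H as \<in> W" "Q (T (word_prod H as))"
        using Cons M simples_roots refl_W word_prod_W by auto
      have "Q (T (refl H \<alpha>))"
        unfolding T_refl_cRs[OF a(2)] by (intro add mult cRs[OF a(1)] E)
      then show ?case
        unfolding word_prod_Cons T_comp[OF a(3,4)] using mult a(5) by blast
    qed
    then show ?thesis using as by simp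
  qed
  from m show ?thesis
    unfolding rhecke_par_def
    by (induction m rule: subring_gen.induct) (use T E one diff mult in auto)
qed

text \<open>Right multiplication by the generators of the parabolic subalgebra moves supports only within
  left cosets \<open>w W\<^sub>M\<close>.\<close>

lemma support_mult:
  assumes M: "M \<subseteq> simples H" and m: "m \<in> rhecke_par H M"
    and Q: "\<And>w u. w \<in> W \<Longrightarrow> u \<in> WP M \<Longrightarrow> w \<circ> u \<in> Q \<Longrightarrow> w \<in> Q"
    and g: "\<And>w. cf g w \<noteq> 0 \<Longrightarrow> w \<in> Q" and n: "cf (g * m) w \<noteq> 0"
  shows "w \<in> Q"
  using M m g n
proof (induction m arbitrary: g w rule: rhecke_induct)
  case (E r)
  then show ?case by (simp add: cf_mult_E)
next
  case (cRs \<alpha>)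
  have a: "\<alpha> \<in> simples H" "refl H \<alpha> \<in> W" "refl H \<alpha> \<in> WP M"
    using cRs M simples_roots refl_W refl_WP by auto
  have w: "w \<in> W" using cRs.prems cf_outside by blast
  have "cf g (w \<circ> refl H \<alpha>) \<noteq> 0 \<or> cf g w \<noteq> 0"
  proof (rule ccontr)
    assume "\<not> ?thesis"
    then have "cf (g * cRs H \<alpha>) w = 0"
      unfolding cf_mult_cRs[OF a(1) w] using ract_simps(1)[OF a(2)] by simp
    then show False using cRs.prems by blast
  qed
  then show ?case using cRs.prems Q[OF w a(3)] by blast
next
  case (diff x y)
  have "cf (g * x) w \<noteq> 0 \<or> cf (g * y) w \<noteq> 0"
    using diff.prems(2) by (auto simp: right_diff_distrib cf_add')
  then show ?case using diff.IH diff.prems(1) by blast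
next
  case (mult x y)
  have "v \<in> Q" if "cf (g * x) v \<noteq> 0" for v using mult.IH(1) mult.prems(1) that by blast
  then show ?case using mult.IH(2)[of "g * x" w] mult.prems(2) by (simp add: mult.assoc)
qed

lemma rhecke_par_iff:
  assumes M: "M \<subseteq> simples H"
  shows "g \<in> rhecke_par H M \<longleftrightarrow> (\<forall>w. cf g w \<noteq> 0 \<longrightarrow> w \<in> WP M)"
proof
  assume r: "\<forall>w. cf g w \<noteq> 0 \<longrightarrow> w \<in> WP M"
  have "(\<Sum>w\<in>W. T w * E (cf g w)) \<in> rhecke_par H M"
  proof (rule rhecke_sum)
    fix w
    show "T w * E (cf g w) \<in> rhecke_par H M"
    proof (cases "cf g w = 0")
      case True
      then show ?thesis using E_rhecke[of 0 M] by (simp add: E_add)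
    next
      case False
      then show ?thesis using r T_rhecke E_rhecke rhecke_closed(2) by blast
    qed
  qed
  then show "g \<in> rhecke_par H M" by (simp only: cf_expand[of g, symmetric])
next
  assume g: "g \<in> rhecke_par H M"
  have one: "cf 1 w \<noteq> 0 \<Longrightarrow> w \<in> WP M" for w using cf_one cf_outside id_WP by metis
  show "\<forall>w. cf g w \<noteq> 0 \<longrightarrow> w \<in> WP M"
  proof (intro allI impI)
    fix w assume "cf g w \<noteq> 0"
    then have n: "cf (1 * g) w \<noteq> 0" by simp
    show "w \<in> WP M"
      by (rule support_mult[where Q = "WP M", OF M g _ one n]) (use comp_WP_iff[OF M] in auto)
  qed
qed

definition proj :: "'v set \<Rightarrow> 'g \<Rightarrow> 'g" where
  "proj M g = (\<Sum>w\<in>W. T w * E (if w \<in> WP M then cf g w else 0))"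

lemma cf_proj: "M \<subseteq> simples H \<Longrightarrow> cf (proj M g) w = (if w \<in> WP M then cf g w else 0)"
  using cf_sum_T[of w "\<lambda>w. if w \<in> WP M then cf g w else 0"] cf_outside[of w] WP_W[of M w]
  unfolding proj_def by (cases "w \<in> W") auto

text \<open>Every \<open>w\<close> is uniquely \<open>x z\<close> with \<open>x\<close> a minimal representative and \<open>z\<close> in \<open>W\<^sub>M\<close>, so the component at
\<open>1\<close> collects exactly the terms at \<open>W\<^sub>M\<close>.\<close>

lemma eps_eq_proj:
  assumes M: "M \<subseteq> simples H"
  shows "eps H M g = proj M g"
  unfolding eps_def
proof (rule the_equality)
  define ms where "ms x = (\<Sum>z\<in>W. T z * E (if z \<in> WP M then cf g (x \<circ> z) else 0))" for x
  have cms: "cf (ms x) z = (if z \<in> WP M then cf g (x \<circ> z) else 0)" if "z \<in> W" for x z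
    unfolding ms_def by (rule cf_sum_T[OF that])
  have "ms x \<in> rhecke_par H M" for x
    unfolding rhecke_par_iff[OF M] using cms cf_outside by metis
  moreover have "g = (\<Sum>x\<in>min_reps H M. T x * ms x)"
  proof (rule cf_eqI)
    fix w assume w: "w \<in> W"
    have JW: "x \<in> W" if "x \<in> min_reps H M" for x using that by (simp add: min_reps_def)
    obtain x0 where x0: "x0 \<in> min_reps H M" "inv x0 \<circ> w \<in> WP M"
      using J_decomp[OF M w] by blast
    have "cf (\<Sum>x\<in>min_reps H M. T x * ms x) w = (\<Sum>x\<in>min_reps H M. cf (ms x) (inv x \<circ> w))"
      unfolding cf_add' by (rule sum.cong[OF HOL.refl]) (rule cf_T_mult[OF JW w])
    also have "\<dots> = (\<Sum>x\<in>min_reps H M. if x = x0 then cf g w else 0)"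
    proof (rule sum.cong[OF HOL.refl])
      fix x assume x: "x \<in> min_reps H M"
      have iw: "inv x \<circ> w \<in> W" using comp_W inv_W JW x w by blast
      show "cf (ms x) (inv x \<circ> w) = (if x = x0 then cf g w else 0)"
      proof (cases "x = x0")
        case True
        then show ?thesis using cms[OF iw, of x] x0 JW by simp
      next
        case False
        have "inv x \<circ> w \<notin> WP M"
        proof
          assume i: "inv x \<circ> w \<in> WP M"
          have "(inv x0 \<circ> w) \<circ> inv (inv x \<circ> w) \<in> WP M" using i x0 comp_WP inv_WP[OF M] by blast
          moreover have "(inv x0 \<circ> w) \<circ> inv (inv x \<circ> w) = inv x0 \<circ> x"
            using w JW[OF x] JW[OF x0(1)] inv_comp_distrib[OF inv_W[OF JW[OF x]] w]
            by (simp add: inv_inv_W comp_assoc)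
          ultimately have "x = x0" using J_unique[OF M] x x0 by simp
          then show False using False by blast
        qed
        then show ?thesis using cms[OF iw, of x] False by simp
      qed
    qed
    also have "\<dots> = cf g w"
      using x0 finite_subset[OF _ finite_W, of "min_reps H M"] JW by (simp add: sum.delta subset_iff)
    finally show "cf g w = cf (\<Sum>x\<in>min_reps H M. T x * ms x) w" by simp
  qed
  moreover have "proj M g = ms id"
    by (rule cf_eqI) (simp only: cf_proj[OF M] cms id_comp)
  ultimately show "\<exists>ms. (\<forall>w\<in>min_reps H M. ms w \<in> rhecke_par H M) \<and>
      g = (\<Sum>w\<in>min_reps H M. T w * ms w) \<and> proj M g = ms id"
    by (intro exI[of _ ms] conjI ballI)
next
  fix m assume "\<exists>ms. (\<forall>w\<in>min_reps H M. ms w \<in> rhecke_par H M) \<and>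
      g = (\<Sum>w\<in>min_reps H M. T w * ms w) \<and> m = ms id"
  then obtain ms where ms: "\<And>w. w \<in> min_reps H M \<Longrightarrow> ms w \<in> rhecke_par H M"
    "g = (\<Sum>w\<in>min_reps H M. T w * ms w)" "m = ms id" by blast
  have JW: "x \<in> W" if "x \<in> min_reps H M" for x using that by (simp add: min_reps_def)
  have idJ: "id \<in> min_reps H M" using id_J[OF M] .
  show "m = proj M g"
  proof (rule cf_eqI)
    fix z assume z: "z \<in> W"
    show "cf m z = cf (proj M g) z"
    proof (cases "z \<in> WP M")
      case False
      have "m \<in> rhecke_par H M" using ms idJ by metis
      then have "cf m z = 0" using rhecke_par_iff[OF M] False by blast
      then show ?thesis using False cf_proj[OF M] by simp
    next
      case True
      have "cf g z = (\<Sum>x\<in>min_reps H M. cf (ms x) (inv x \<circ> z))"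
        unfolding ms(2) cf_add' by (rule sum.cong[OF HOL.refl]) (rule cf_T_mult[OF JW z])
      also have "\<dots> = (\<Sum>x\<in>min_reps H M. if x = id then cf m z else 0)"
      proof (rule sum.cong[OF HOL.refl])
        fix x assume x: "x \<in> min_reps H M"
        show "cf (ms x) (inv x \<circ> z) = (if x = id then cf m z else 0)"
        proof (cases "x = id")
          case True
          then show ?thesis using ms(3) by (simp only: inv_id id_comp if_True simp_thms)
        next
          case False
          have "inv x \<circ> z \<notin> WP M"
          proof
            assume "inv x \<circ> z \<in> WP M"
            then have "inv x \<in> WP M" using comp_WP_iff[OF M True inv_W[OF JW[OF x]]] by blast
            then have "inv x \<circ> id \<in> WP M" by simp
            then have "id = x" using J_unique[OF M] x idJ by blast
            then show False using False by blast
          qed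
          then have "cf (ms x) (inv x \<circ> z) = 0" using ms(1)[OF x] rhecke_par_iff[OF M] by blast
          then show ?thesis using False by simp
        qed
      qed
      also have "\<dots> = cf m z"
        using idJ finite_subset[OF _ finite_W, of "min_reps H M"] JW by (simp add: sum.delta subset_iff)
      finally show ?thesis using True cf_proj[OF M] by simp
    qed
  qed
qed

lemma proj_add: "M \<subseteq> simples H \<Longrightarrow> proj M (g + g') = proj M g + proj M g'"
  by (rule cf_eqI) (simp add: cf_proj cf_add)

text \<open>Right multiplication by the parabolic subalgebra preserves both the elements supported on \<open>W\<^sub>M\<close>
and those supported on its complement.\<close>

lemma proj_mult_right:
  assumes M: "M \<subseteq> simples H" and m: "m \<in> rhecke_par H M"
  shows "proj M (g * m) = proj M g * m"
proof (rule cf_eqI)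
  fix w assume w: "w \<in> W"
  let ?y = "g - proj M g"
  have e: "cf (g * m) w = cf (proj M g * m) w + cf (?y * m) w"
    by (simp only: cf_add[symmetric] distrib_right[symmetric]) simp
  have p: "cf (proj M g) v \<noteq> 0 \<Longrightarrow> v \<in> WP M" for v using cf_proj[OF M, of g v] by (auto split: if_splits)
  have y: "cf ?y v \<noteq> 0 \<Longrightarrow> v \<in> - WP M" for v using cf_proj[OF M, of g v] by (auto simp: cf_add')
  have a: "cf (proj M g * m) w \<noteq> 0 \<Longrightarrow> w \<in> WP M"
    using support_mult[where Q = "WP M" and g = "proj M g", OF M m _ p] comp_WP_iff[OF M] by blast
  have b: "cf (?y * m) w \<noteq> 0 \<Longrightarrow> w \<in> - WP M"
    using support_mult[where Q = "- WP M" and g = ?y, OF M m _ y] comp_WP_iff[OF M] by blast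
  show "cf (proj M (g * m)) w = cf (proj M g * m) w"
    using a b e cf_proj[OF M, of "g * m" w] by auto
qed

lemma cRs_rhecke: "\<alpha> \<in> M \<Longrightarrow> cRs H \<alpha> \<in> rhecke_par H M"
  unfolding cRs_def using T_rhecke[OF refl_WP] E_rhecke rhecke_closed by metis

lemma cR_rhecke:
  assumes M: "M \<subseteq> simples H" and w: "w \<in> WP M"
  shows "cR w \<in> rhecke_par H M"
proof -
  obtain as where as: "set as \<subseteq> M" "word_prod H as = w" using WP_word w by blast
  have "cR (word_prod H as) \<in> rhecke_par H M"
    using as(1)
  proof (induction as rule: rev_induct)
    case Nil
    have "(1::'g) \<in> rhecke_par H M" unfolding rhecke_par_def by (rule subring_gen.one)
    then show ?case by (simp only: word_prod_Nil cR_id)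
  next
    case (snoc \<alpha> as)
    have u: "word_prod H as \<in> W" "\<alpha> \<in> simples H" using snoc M word_prod_W by auto
    have "cR (word_prod H (as @ [\<alpha>])) = cR (word_prod H as) * cRs H \<alpha>"
      using cR_cRs[OF u] by (simp only: word_prod_append word_prod_Cons word_prod_Nil comp_id)
    then show ?case using snoc cRs_rhecke rhecke_closed(2) by auto
  qed
  then show ?thesis using as by simp
qed

lemma emb_hecke: "emb H p \<in> hecke_par H M"
  and tw_hecke: "w \<in> WP M \<Longrightarrow> tw H w \<in> hecke_par H M"
  by (auto simp: hecke_par_def intro: subring_gen.incl)

lemma hecke_closed:
  "x \<in> hecke_par H M \<Longrightarrow> y \<in> hecke_par H M \<Longrightarrow> x - y \<in> hecke_par H M"
  "x \<in> hecke_par H M \<Longrightarrow> y \<in> hecke_par H M \<Longrightarrow> x * y \<in> hecke_par H M"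
  "x \<in> hecke_par H M \<Longrightarrow> y \<in> hecke_par H M \<Longrightarrow> x + y \<in> hecke_par H M"
  "(\<And>i. i \<in> A \<Longrightarrow> f i \<in> hecke_par H M) \<Longrightarrow> (\<Sum>i\<in>A. f i) \<in> hecke_par H M"
  unfolding hecke_par_def
  by (blast intro: subring_gen.diff, blast intro: subring_gen.mult, blast intro: subring_add,
      rule subring_sum)

lemma loc_hecke: "h \<in> hecke_par H M \<Longrightarrow> loc H h \<in> rhecke_par H M"
  unfolding hecke_par_def
proof (induction h rule: subring_gen.induct)
  case (incl x)
  then show ?case using T_rhecke E_rhecke loc_emb by auto
next
  case one
  show ?case by (simp add: hom_loc rhecke_par_def subring_gen.one)
next
  case (diff x y)
  then show ?case using rhecke_closed(1) by (simp add: loc_add)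
next
  case (mult x y)
  then show ?case using rhecke_closed(2) by (simp add: hom_loc)
qed

lemma hecke_par_hc: "M \<subseteq> simples H \<Longrightarrow> h \<in> hecke_par H M \<Longrightarrow> w \<notin> WP M \<Longrightarrow> hc h w = 0"
  using loc_hecke[of h M] rhecke_par_iff[of M "loc H h"] cf_loc[of h w] rat_eq_0_iff by metis

lemma hecke_par_expand:
  assumes M: "M \<subseteq> simples H" and h: "h \<in> hecke_par H M"
  shows "h = (\<Sum>w\<in>WP M. tw H w * emb H (hc h w))"
proof -
  have "h = (\<Sum>w\<in>W. tw H w * emb H (hc h w))" by (rule hc_expand)
  also have "\<dots> = (\<Sum>w\<in>WP M. tw H w * emb H (hc h w))"
    using WP_W[OF M] hecke_par_hc[OF M h] finite_W
    by (intro sum.mono_neutral_right) (auto simp: emb_add)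
  finally show ?thesis .
qed

end

section \<open>The projection defining the induced form\<close>

lemma assoc_tail:
  fixes a b c d y :: "'a::semigroup_mult"
  assumes "a * b = c * d"
  shows "a * (b * y) = c * (d * y)"
  using assms by (simp add: mult.assoc[symmetric])

lemma commutes_mult:
  fixes x a b :: "'a::semigroup_mult"
  assumes "x * a = a * x" "x * b = b * x"
  shows "x * (a * b) = a * b * x"
proof -
  have "x * (a * b) = a * (x * b)" using assms(1) by (simp add: mult.assoc[symmetric])
  then show ?thesis using assms(2) by (simp add: mult.assoc)
qed

locale parabolic = hecke H
  for H :: "('v::real_vector, 'd::real_vector, 'h::ring_1, 'g::ring_1) rat_hecke_data" +
  fixes M :: "'v set"
  assumes M: "M \<subseteq> simples H"
begin

abbreviation c where "c \<equiv> w_up H M"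
abbreviation Md where "Md \<equiv> delta H M"

lemma cW: "c \<in> W" and icW: "inv c \<in> W"
  using c_W[OF M] inv_W by auto

lemma Md: "Md \<subseteq> simples H"
  by (rule delta_simples[OF M])

lemma prod_complement_invariant:
  assumes L: "L \<subseteq> simples H" and z: "z \<in> WP L"
    and f: "\<And>\<gamma>. \<gamma> \<in> roots H \<Longrightarrow> ract z (f \<gamma>) = f (z \<gamma>)"
  shows "ract z (\<Prod>\<gamma>\<in>P - RP L. f \<gamma>) = (\<Prod>\<gamma>\<in>P - RP L. f \<gamma>)"
proof -
  have zW: "z \<in> W" "inv z \<in> WP L" using z WP_W[OF L] inv_WP[OF L] by auto
  have "ract z (\<Prod>\<gamma>\<in>P - RP L. f \<gamma>) = (\<Prod>\<gamma>\<in>P - RP L. f (z \<gamma>))"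
    unfolding ract_prod[OF zW(1)] using f P_roots by (intro prod.cong) auto
  also have "\<dots> = (\<Prod>\<gamma>\<in>P - RP L. f \<gamma>)"
    by (rule prod.reindex_bij_witness[of _ "inv z" z])
      (use zW WP_pos[OF L z] WP_pos[OF L zW(2)] in auto)
  finally show ?thesis .
qed

text \<open>The map \<open>\<gamma> \<mapsto> - c \<gamma>\<close> is a bijection between the positive roots outside the two parabolics.\<close>

lemma prod_complement_c:
  assumes f: "\<And>\<gamma>. \<gamma> \<in> roots H \<Longrightarrow> ract c (f \<gamma>) = f' (- c \<gamma>)"
  shows "ract c (\<Prod>\<gamma>\<in>P - RP Md. f \<gamma>) = (\<Prod>\<beta>\<in>P - RP M. f' \<beta>)"
proof -
  have "ract c (\<Prod>\<gamma>\<in>P - RP Md. f \<gamma>) = (\<Prod>\<gamma>\<in>P - RP Md. f' (- c \<gamma>))"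
    unfolding ract_prod[OF cW] using f P_roots by (intro prod.cong) auto
  also have "\<dots> = (\<Prod>\<beta>\<in>P - RP M. f' \<beta>)"
    by (rule prod.reindex_bij_witness[of _ "\<lambda>\<beta>. - inv c \<beta>" "\<lambda>\<gamma>. - c \<gamma>"])
      (use c_neg[OF M] inv_c_neg[OF M] cW icW in \<open>auto simp: neg_W\<close>)
  finally show ?thesis .
qed

lemma commute_invariant:
  assumes L: "L \<subseteq> simples H" and r: "\<And>z. z \<in> WP L \<Longrightarrow> ract z r = r" and m: "m \<in> rhecke_par H L"
  shows "E r * m = m * E r"
  using L m
proof (induction m rule: rhecke_induct)
  case (E a)
  show ?case by (rule E_commute)
next
  case (cRs \<alpha>)
  then show ?case using E_cRs[of \<alpha> r] L r refl_WP by auto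
next
  case (mult x y)
  then show ?case by (intro commutes_mult)
qed (simp add: left_diff_distrib right_diff_distrib)

section \<open>The element \<open>R\<^sup>0\<close>\<close>

text \<open>The scalar factor by which \<open>R\<^sup>0\<close> differs from the intertwiner of \<open>c\<close>.\<close>

definition F where "F = (\<Prod>\<gamma>\<in>P - RP Md. (rk H \<gamma> + rroot H \<gamma>) / (rk H \<gamma> - rroot H \<gamma>))"

abbreviation R0 where "R0 \<equiv> Rel H c"

lemma R0_eq: "R0 = cR c * E F"
proof -
  let ?f = "\<lambda>\<gamma>. (rk H \<gamma> + rroot H \<gamma>) / (rk H \<gamma> - rroot H \<gamma>)"
  have "R0 = cR c * E (\<Prod>\<gamma>\<in>Inv c. ?f \<gamma>)"
    unfolding Rel_def
  proof (rule prod_word_factor[OF some_reduced[OF cW] cW])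
    fix \<alpha> assume a: "\<alpha> \<in> simples H"
    show "Rs H \<alpha> = cRs H \<alpha> * E (?f \<alpha>)"
      unfolding Rs_tau cRs_tau mult.assoc hom_E(3)[symmetric]
      using rank_one_nonzero[OF a] by (simp add: field_simps)
  next
    fix \<alpha> \<gamma> assume "\<alpha> \<in> simples H" and g: "\<gamma> \<in> roots H"
    then have s: "refl H \<alpha> \<in> W" using simples_roots refl_W by auto
    show "ract (refl H \<alpha>) (?f \<gamma>) = ?f (refl H \<alpha> \<gamma>)"
      using s g by (simp add: ract_divide ract_simps ract_diff ract_rroot ract_rk)
  qed
  then show ?thesis by (simp only: F_def Inv_c[OF M])
qed

lemma F_nonzero: "F \<noteq> 0"
  unfolding F_def using rroot_nonzero P_roots finite_P
  by (subst prod_zero_iff) (auto simp: subset_iff)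

lemma F_invariant: "z \<in> WP Md \<Longrightarrow> ract z F = F"
  unfolding F_def
  by (rule prod_complement_invariant[OF Md])
    (simp_all add: ract_divide ract_simps ract_diff ract_rroot ract_rk WP_W[OF Md])

definition R0inv where "R0inv = E (inverse F) * cR (inv c)"

lemma R0_inverse: "R0 * R0inv = 1" "R0inv * R0 = 1"
proof -
  have "E F * E (inverse F) = 1" "E (inverse F) * E F = 1"
    using F_nonzero by (simp_all flip: hom_E)
  moreover have "cR c * cR (inv c) = 1" "cR (inv c) * cR c = 1" using cR_inv[OF cW] by auto
  ultimately show "R0 * R0inv = 1" "R0inv * R0 = 1"
    unfolding R0_eq R0inv_def
    by (simp_all only: mult.assoc mult_1_left assoc_tail[of "E F" _ 1 1] assoc_tail[of "cR (inv c)" _ 1 1])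
qed

lemma E_R0: "E a * R0 = R0 * E (ract (inv c) a)"
proof -
  have "E a * (cR c * E F) = cR c * (E (ract (inv c) a) * E F)"
    by (simp only: E_cR[OF cW, THEN assoc_tail])
  then show ?thesis by (simp only: R0_eq E_commute[of _ F] mult.assoc)
qed

lemma R0_E: "R0 * E a = E (ract c a) * R0"
  using E_R0[of "ract c a"] ract_inv(2)[OF cW] by simp

lemma conj_W: "z \<in> W \<Longrightarrow> z \<circ> c = c \<circ> (inv c \<circ> z \<circ> c)"
  using cW by (simp add: comp_assoc)

lemma cR_R0:
  assumes z: "z \<in> WP M"
  shows "cR z * R0 = R0 * cR (inv c \<circ> z \<circ> c)"
proof -
  let ?z = "inv c \<circ> z \<circ> c"
  have zW: "z \<in> W" using z WP_W[OF M] by blast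
  have z': "?z \<in> WP Md" "?z \<in> W" using conj_inv_c[OF M z] WP_W[OF Md] by auto
  have "cR z * cR c = cR c * cR ?z"
    using cR_comp[OF zW cW] cR_comp[OF cW z'(2)] conj_W[OF zW] by simp
  moreover have "E F * cR ?z = cR ?z * E F"
    using cR_E[OF z'(2), of F] F_invariant[OF z'(1)] by simp
  ultimately show ?thesis
    unfolding R0_eq by (simp only: mult.assoc assoc_tail[of "cR z"])
qed

text \<open>The factor \<open>F\<close> is invariant under the dual parabolic group, so \<open>R\<^sup>0\<close> has the same commutation
rules as the intertwiner of \<open>c\<close>.  Hence conjugation by \<open>R\<^sup>0\<close> realises the isomorphism between the
two parabolic subalgebras.\<close>

lemma T_R0:
  assumes z: "z \<in> WP M"
  shows "T z * R0 = R0 * T (inv c \<circ> z \<circ> c)"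
proof -
  have s: "T (refl H \<alpha>) * R0 = R0 * T (inv c \<circ> refl H \<alpha> \<circ> c)" if a: "\<alpha> \<in> M" for \<alpha>
  proof -
    let ?b = "inv c \<alpha>"
    have aR: "\<alpha> \<in> simples H" "\<alpha> \<in> roots H" using a M simples_roots by auto
    have b: "?b \<in> Md" "?b \<in> simples H" using inv_c_M[OF M a] Md by auto
    have rb: "refl H ?b = inv c \<circ> refl H \<alpha> \<circ> c"
      using refl_weyl_conj[OF icW aR(2)] cW by (simp add: inv_inv_W)
    have i: "ract (inv c) ((rk H \<alpha> + rroot H \<alpha>) / rroot H \<alpha>) = (rk H ?b + rroot H ?b) / rroot H ?b"
      "ract (inv c) (rk H \<alpha> / rroot H \<alpha>) = rk H ?b / rroot H ?b"
      using icW aR by (simp_all add: ract_divide ract_simps ract_rroot ract_rk)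
    have "cRs H \<alpha> * R0 = R0 * cRs H ?b"
      using cR_R0[OF refl_WP[OF a]] by (simp only: cR_refl[OF aR(1)] cR_refl[OF b(2)] rb[symmetric])
    then have "T (refl H \<alpha>) * R0 = R0 * T (refl H ?b)"
      unfolding T_refl_cRs[OF aR(1)] T_refl_cRs[OF b(2)]
      by (simp only: distrib_right distrib_left mult.assoc E_R0 i assoc_tail[of "cRs H \<alpha>"])
    then show ?thesis by (simp only: rb)
  qed
  obtain as where as: "set as \<subseteq> M" "word_prod H as = z" using WP_word z by blast
  have "T (word_prod H as) * R0 = R0 * T (inv c \<circ> word_prod H as \<circ> c)"
    using as(1)
  proof (induction as)
    case Nil
    have "inv c \<circ> id \<circ> c = id" using cW by simp
    then show ?case by (simp only: word_prod_Nil T_id mult_1_left mult_1_right)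
  next
    case (Cons \<alpha> as)
    let ?u = "word_prod H as"
    have W: "refl H \<alpha> \<in> W" "?u \<in> W" using Cons M simples_roots refl_W word_prod_W by auto
    have W': "inv c \<circ> refl H \<alpha> \<circ> c \<in> W" "inv c \<circ> ?u \<circ> c \<in> W" using W comp_W cW icW by blast+
    have e: "inv c \<circ> (refl H \<alpha> \<circ> ?u) \<circ> c = (inv c \<circ> refl H \<alpha> \<circ> c) \<circ> (inv c \<circ> ?u \<circ> c)"
      using cW by (simp add: comp_assoc)
    have "T (refl H \<alpha> \<circ> ?u) * R0 = T (refl H \<alpha>) * (T ?u * R0)"
      using T_comp[OF W] by (simp only: mult.assoc)
    also have "\<dots> = R0 * (T (inv c \<circ> refl H \<alpha> \<circ> c) * T (inv c \<circ> ?u \<circ> c))"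
    proof -
      have e12: "T ?u * R0 = R0 * T (inv c \<circ> ?u \<circ> c)"
        "T (refl H \<alpha>) * R0 = R0 * T (inv c \<circ> refl H \<alpha> \<circ> c)"
        by (rule Cons.IH, use Cons.prems in simp) (rule s, use Cons.prems in simp)
      show ?thesis unfolding e12(1) by (rule assoc_tail[OF e12(2)])
    qed
    finally show ?case unfolding word_prod_Cons e T_comp[OF W'] .
  qed
  then show ?thesis using as by simp
qed

section \<open>The projection \<open>Psi\<close>\<close>

text \<open>Conjugation by \<open>R\<^sup>0\<close> carries the value of \<open>\<epsilon>\<close> in the definition of the form from the dual parabolic
subalgebra back to the one that acts on \<open>U\<close>.\<close>

definition Psi :: "'g \<Rightarrow> 'g" where
  "Psi g = R0 * eps H Md (T (inv c) * g * R0) * R0inv"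

text \<open>The rational function whose value at the central character is the scalar \<open>f\<close>.\<close>

definition F0 where "F0 = (\<Prod>\<beta>\<in>P - RP M. - rroot H \<beta> / (rk H \<beta> + rroot H \<beta>))"

lemma Psi_add: "Psi (g + g') = Psi g + Psi g'"
  by (simp add: Psi_def eps_eq_proj[OF Md] proj_add[OF Md] distrib_left distrib_right)

lemma N_c_le: "z \<in> WP Md \<Longrightarrow> N c \<le> N (c \<circ> z)"
proof (rule card_mono[OF finite_Inv])
  assume z: "z \<in> WP Md"
  show "Inv c \<subseteq> Inv (c \<circ> z)"
  proof
    fix \<gamma> assume g: "\<gamma> \<in> Inv c"
    then have "z \<gamma> \<in> P - RP Md" using WP_pos[OF Md z] Inv_c[OF M] by blast
    then have "- c (z \<gamma>) \<in> P" using c_neg[OF M] by blast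
    then show "\<gamma> \<in> Inv (c \<circ> z)" using g by (simp add: Inv_def)
  qed
qed

text \<open>All terms of \<open>R\<^sup>0\<close> other than the leading one are shorter than \<open>c\<close>, which is the shortest element of
its coset.\<close>

lemma eps_R0: "eps H Md (T (inv c) * R0) = E (lead c * F)"
proof (rule cf_eqI)
  fix z assume z: "z \<in> W"
  have cz: "cf (T (inv c) * R0) z = cf (cR c) (c \<circ> z) * F"
    using cf_T_mult[OF icW z, of R0] cW by (simp only: inv_inv_W R0_eq cf_mult_E)
  show "cf (eps H Md (T (inv c) * R0)) z = cf (E (lead c * F)) z"
  proof (cases "z = id")
    case True
    then show ?thesis
      using cz cf_cR(1)[OF cW] cf_E[OF id_W]
      by (simp only: eps_eq_proj[OF Md] cf_proj[OF Md] id_WP comp_id if_True simp_thms)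
  next
    case False
    have "cf (eps H Md (T (inv c) * R0)) z = 0"
    proof (cases "z \<in> WP Md")
      case True
      have "c \<circ> z \<noteq> c"
      proof
        assume "c \<circ> z = c"
        then have "inv c \<circ> (c \<circ> z) = inv c \<circ> c" by simp
        then show False using False cW by simp
      qed
      then have "cf (cR c) (c \<circ> z) = 0" using cf_cR(2)[OF cW] N_c_le[OF True] by (metis not_le)
      then show ?thesis using cz by (simp add: eps_eq_proj[OF Md] cf_proj[OF Md])
    qed (simp add: eps_eq_proj[OF Md] cf_proj[OF Md])
    then show ?thesis using cf_E[OF z] False by simp
  qed
qed

lemma F0_eq: "ract c (lead c * F) = F0"
proof -
  have e: "lead c * F = (\<Prod>\<gamma>\<in>P - RP Md. rroot H \<gamma> / (rk H \<gamma> - rroot H \<gamma>))"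
    unfolding lead_def F_def Inv_c[OF M] prod.distrib[symmetric]
    by (rule prod.cong) (use rroot_nonzero P_roots in \<open>auto simp: subset_iff\<close>)
  show ?thesis unfolding e F0_def
  proof (rule prod_complement_c)
    fix \<gamma> assume g: "\<gamma> \<in> roots H"
    have cg: "c \<gamma> \<in> roots H" using weyl_root[OF cW g] .
    show "ract c (rroot H \<gamma> / (rk H \<gamma> - rroot H \<gamma>)) =
        - rroot H (- c \<gamma>) / (rk H (- c \<gamma>) + rroot H (- c \<gamma>))"
      using cW g cg by (simp add: ract_divide ract_diff ract_rroot ract_rk rroot_neg rk_neg)
  qed
qed

text \<open>On the basis of intertwiners the projection keeps exactly those of the parabolic subgroup:
  \<open>cR w\<close> times \<open>R\<^sup>0\<close> is a multiple of \<open>cR (w c)\<close>, which reaches the coset \<open>c W\<^sub>\<delta>\<close> in the Bruhat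
  order only if \<open>w c\<close> lies in it.\<close>

lemma Psi_cR:
  assumes w: "w \<in> W"
  shows "Psi (cR w * E a) = (if w \<in> WP M then E F0 * (cR w * E a) else 0)"
proof (cases "w \<in> WP M")
  case False
  have wc: "w \<circ> c \<in> W" using w cW comp_W by blast
  have "cR w * E a * R0 = cR (w \<circ> c) * E (F * ract (inv c) a)"
    using E_R0[of a] cR_comp[OF w cW] by (simp only: R0_eq hom_E mult.assoc) 
  then have e: "T (inv c) * (cR w * E a) * R0 = T (inv c) * (cR (w \<circ> c) * E (F * ract (inv c) a))"
    by (simp only: mult.assoc)
  have "eps H Md (T (inv c) * (cR w * E a) * R0) = 0"
  proof (rule cf_eqI)
    fix z assume z: "z \<in> W"
    have "cf (T (inv c) * (cR w * E a) * R0) z = 0" if zM: "z \<in> WP Md"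
    proof -
      have cz: "c \<circ> z \<in> W" using cW z comp_W by blast
      have "cf (cR (w \<circ> c)) (c \<circ> z) = 0"
      proof (rule ccontr)
        assume "cf (cR (w \<circ> c)) (c \<circ> z) \<noteq> 0"
        then have "bruhat (c \<circ> z) (w \<circ> c)" by (rule cf_cR(3)[OF wc])
        then have "(w \<circ> c) \<circ> inv c \<in> WP M"
          using bruhat_c_upper[OF M _ wc _ cz] conj_c[OF M zM] by blast
        then show False using False cW by (simp add: comp_assoc)
      qed
      then show ?thesis unfolding e using cf_T_mult[OF icW z] cW
        by (simp add: inv_inv_W cf_mult_E)
    qed
    then show "cf (eps H Md (T (inv c) * (cR w * E a) * R0)) z = cf 0 z"
      by (simp add: eps_eq_proj[OF Md] cf_proj[OF Md] cf_add')
  qed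
  then show ?thesis using False by (simp add: Psi_def)
next
  case True
  let ?w = "inv c \<circ> w \<circ> c"
  have w': "?w \<in> WP Md" using conj_inv_c[OF M True] .
  let ?m = "cR ?w * E (ract (inv c) a)"
  have m: "?m \<in> rhecke_par H Md"
    using rhecke_closed(2) cR_rhecke[OF Md w'] E_rhecke by blast
  have x: "cR w * E a * R0 = R0 * ?m"
    by (simp only: mult.assoc E_R0 cR_R0[OF True, THEN assoc_tail])
  then have "T (inv c) * (cR w * E a) * R0 = T (inv c) * R0 * ?m" by (simp only: mult.assoc)
  then have "eps H Md (T (inv c) * (cR w * E a) * R0) = E (lead c * F) * ?m"
    using proj_mult_right[OF Md m] eps_R0 by (simp only: eps_eq_proj[OF Md])
  then have "Psi (cR w * E a) = R0 * E (lead c * F) * ?m * R0inv"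
    by (simp only: Psi_def mult.assoc)
  also have "\<dots> = E F0 * (R0 * ?m) * R0inv"
    by (simp only: R0_E F0_eq mult.assoc)
  also have "\<dots> = E F0 * (cR w * E a) * (R0 * R0inv)" by (simp only: x[symmetric] mult.assoc)
  finally show ?thesis using True by (simp add: R0_inverse)
qed

lemma F0_invariant: "z \<in> WP M \<Longrightarrow> ract z F0 = F0"
  unfolding F0_def
  by (rule prod_complement_invariant[OF M])
    (simp_all add: ract_divide ract_simps ract_rroot ract_rk WP_W[OF M])

lemma Psi_E_left: "Psi (E r * g) = E r * Psi g"
proof (induction g rule: cR_induct)
  case (1 w a)
  have "E r * (cR w * E a) = cR w * E (ract (inv w) r * a)"
    using E_cR[OF 1, of r] by (simp only: hom_E mult.assoc[symmetric])
  moreover have "E F0 * (E r * (cR w * E a)) = E r * (E F0 * (cR w * E a))"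
    by (rule assoc_tail[OF E_commute])
  ultimately show ?case using Psi_cR[OF 1] by simp
next
  case (2 x y)
  then show ?case by (simp add: Psi_add distrib_left)
qed

lemma Psi_cRs_left:
  assumes a: "\<alpha> \<in> M"
  shows "Psi (cRs H \<alpha> * g) = cRs H \<alpha> * Psi g"
proof (induction g rule: cR_induct)
  case (1 w r)
  have aS: "\<alpha> \<in> simples H" "refl H \<alpha> \<in> W" using a M simples_roots refl_W by auto
  have e: "cRs H \<alpha> * (cR w * E r) = cR (refl H \<alpha> \<circ> w) * E r"
    using cR_comp[OF aS(2) 1] cR_refl[OF aS(1)] by (simp only: mult.assoc[symmetric])
  have sw: "refl H \<alpha> \<circ> w \<in> W" using aS 1 comp_W by blast
  have iff: "refl H \<alpha> \<circ> w \<in> WP M \<longleftrightarrow> w \<in> WP M" using comp_WP_iff[OF M refl_WP[OF a] 1] by blast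
  have "E F0 * cRs H \<alpha> = cRs H \<alpha> * E F0"
    using E_cRs[OF aS(1), of F0] F0_invariant[OF refl_WP[OF a]] by simp
  then have "E F0 * (cRs H \<alpha> * (cR w * E r)) = cRs H \<alpha> * (E F0 * (cR w * E r))"
    by (rule assoc_tail)
  then show ?case using Psi_cR[OF 1, of r] Psi_cR[OF sw, of r] e iff by (simp del: comp_apply)
next
  case (2 x y)
  then show ?case by (simp add: Psi_add distrib_left)
qed

lemma Psi_cRs_right:
  assumes a: "\<alpha> \<in> M"
  shows "Psi (g * cRs H \<alpha>) = Psi g * cRs H \<alpha>"
proof (induction g rule: cR_induct)
  case (1 w r)
  have aS: "\<alpha> \<in> simples H" "refl H \<alpha> \<in> W" using a M simples_roots refl_W by auto
  have e: "cR w * E r * cRs H \<alpha> = cR (w \<circ> refl H \<alpha>) * E (ract (refl H \<alpha>) r)"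
    using cR_cRs[OF 1 aS(1)] by (simp only: mult.assoc E_cRs[OF aS(1)]) (simp only: mult.assoc[symmetric])
  have sw: "w \<circ> refl H \<alpha> \<in> W" using aS 1 comp_W by blast
  have iff: "w \<circ> refl H \<alpha> \<in> WP M \<longleftrightarrow> w \<in> WP M" using comp_WP_iff[OF M refl_WP[OF a] 1] by blast
  have "Psi (cR w * E r * cRs H \<alpha>) = (if w \<in> WP M then E F0 * (cR w * E r * cRs H \<alpha>) else 0)"
    unfolding e Psi_cR[OF sw] iff ..
  then show ?case unfolding Psi_cR[OF 1] by (simp add: mult.assoc)
next
  case (2 x y)
  then show ?case by (simp add: Psi_add distrib_right)
qed

lemma Psi_E_right: "Psi (g * E r) = Psi g * E r"
proof (induction g rule: cR_induct)
  case (1 w a)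
  have "cR w * E a * E r = cR w * E (a * r)" by (simp only: hom_E mult.assoc)
  then show ?case using Psi_cR[OF 1] by (simp add: mult.assoc)
next
  case (2 x y)
  then show ?case by (simp add: Psi_add distrib_right)
qed

lemma Psi_diff: "Psi (x - y) = Psi x - Psi y"
  using additive_simps(3)[of Psi, OF Psi_add] .

lemma Psi_left:
  assumes "m \<in> rhecke_par H M"
  shows "Psi (m * g) = m * Psi g"
  using M assms
  by (induction m arbitrary: g rule: rhecke_induct)
    (simp_all add: Psi_E_left Psi_cRs_left left_diff_distrib Psi_diff mult.assoc)

lemma Psi_right:
  assumes "m \<in> rhecke_par H M"
  shows "Psi (g * m) = Psi g * m"
  using M assms
  by (induction m arbitrary: g rule: rhecke_induct)
    (simp_all add: Psi_E_right Psi_cRs_right right_diff_distrib Psi_diff mult.assoc[symmetric])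

section \<open>Clearing denominators\<close>

text \<open>Roots with \<open>k = 0\<close> contribute no denominator to \<open>R\<^sup>0\<close>, since then the factor
  \<open>(t\<^sub>s \<alpha> - k) / (k - \<alpha>)\<close> is \<open>- t\<^sub>s\<close>.  So the denominators are taken only over the other roots.\<close>

definition dfac :: "'v \<Rightarrow> 'd sym" where
  "dfac \<beta> = (if kpar H \<beta> = 0 then 1 else cst (of_real (kpar H \<beta>)) + root_fn H \<beta>)"
definition dpol :: "'d sym" where "dpol = (\<Prod>\<beta>\<in>P - RP M. dfac \<beta>)"

lemma dfac_nonzero: "\<beta> \<in> roots H \<Longrightarrow> dfac \<beta> \<noteq> 0"
  using root_fn_nonzero[of \<beta>] by (simp add: dfac_def)

lemma dpol_nonzero: "dpol \<noteq> 0"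
  unfolding dpol_def using dfac_nonzero P_roots finite_P by (subst prod_zero_iff) auto

lemma sact_dfac: "w \<in> W \<Longrightarrow> \<beta> \<in> roots H \<Longrightarrow> sact H w (dfac \<beta>) = dfac (w \<beta>)"
  using linear_W[of w] by (simp add: dfac_def kpar_weyl sact_simps sact_root_fn)

lemma dpol_ract: "z \<in> WP M \<Longrightarrow> ract z (rat dpol) = rat dpol"
  unfolding dpol_def rat_prod
  by (rule prod_complement_invariant[OF M])
    (simp_all add: ract_rat sact_dfac WP_W[OF M])

lemma dpol_invariant: "z \<in> WP M \<Longrightarrow> sact H z dpol = dpol"
  using dpol_ract[of z] WP_W[OF M, of z] by (simp add: ract_rat rat_eq_iff)

definition tau' :: "'v \<Rightarrow> 'h" where
  "tau' \<alpha> = (if kpar H \<alpha> = 0 then - tw H (refl H \<alpha>) else tau \<alpha>)"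

lemma R0_integral: "\<exists>t. R0 = loc H t * E (\<Prod>\<gamma>\<in>P - RP Md. if kpar H \<gamma> = 0 then 1 else inverse (rk H \<gamma> - rroot H \<gamma>))"
proof -
  let ?f = "\<lambda>\<gamma>. if kpar H \<gamma> = 0 then - 1 else rk H \<gamma> + rroot H \<gamma>"
  let ?e = "\<lambda>\<gamma>. if kpar H \<gamma> = 0 then 1 else inverse (rk H \<gamma> - rroot H \<gamma>)"
  obtain as where as: "reduced_word H c as" using reduced_word_exists[OF cW] by blast
  have k0: "rk H \<gamma> = 0" if "kpar H \<gamma> = 0" for \<gamma> using that by (simp add: rk_def cst_simps rat_simps)
  have "prod_list (map (\<lambda>\<alpha>. loc H (tau' \<alpha>)) as) = cR c * E (\<Prod>\<gamma>\<in>Inv c. ?f \<gamma>)"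
  proof (rule prod_word_factor[OF as cW])
    fix \<alpha> assume a: "\<alpha> \<in> simples H"
    note nz = rank_one_nonzero[OF a]
    show "loc H (tau' \<alpha>) = cRs H \<alpha> * E (?f \<alpha>)"
    proof (cases "kpar H \<alpha> = 0")
      case True
      have "cRs H \<alpha> = T (refl H \<alpha>) * E (rroot H \<alpha> * inverse (rroot H \<alpha>))"
        using k0[OF True] by (simp add: cRs_def E_add mult.assoc hom_E)
      then have "cRs H \<alpha> = T (refl H \<alpha>)" using nz by (simp add: hom_E)
      then show ?thesis using True by (simp add: tau'_def loc_add E_add hom_E)
    next
      case False
      have "cRs H \<alpha> * E (rk H \<alpha> + rroot H \<alpha>) =
          loc H (tau \<alpha>) * E (inverse (rk H \<alpha> + rroot H \<alpha>) * (rk H \<alpha> + rroot H \<alpha>))"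
        unfolding cRs_tau mult.assoc hom_E(3) ..
      then show ?thesis using False nz by (simp add: tau'_def hom_E)
    qed
  next
    fix \<alpha> \<gamma> assume "\<alpha> \<in> simples H" and g: "\<gamma> \<in> roots H"
    then have s: "refl H \<alpha> \<in> W" using simples_roots refl_W by auto
    show "ract (refl H \<alpha>) (?f \<gamma>) = ?f (refl H \<alpha> \<gamma>)"
      using s g by (simp add: ract_simps ract_rroot ract_rk kpar_weyl)
  qed
  moreover have "loc H (prod_list (map tau' as)) = prod_list (map (\<lambda>\<alpha>. loc H (tau' \<alpha>)) as)"
    by (induction as) (simp_all add: hom_loc)
  ultimately have t: "loc H (prod_list (map tau' as)) = cR c * E (\<Prod>\<gamma>\<in>P - RP Md. ?f \<gamma>)"
    by (simp only: Inv_c[OF M])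
  have "(\<Prod>\<gamma>\<in>P - RP Md. ?f \<gamma>) * (\<Prod>\<gamma>\<in>P - RP Md. ?e \<gamma>) = F"
    unfolding F_def prod.distrib[symmetric]
  proof (rule prod.cong[OF HOL.refl])
    fix \<gamma> assume "\<gamma> \<in> P - RP Md"
    then have "\<gamma> \<in> roots H" using P_roots by blast
    then show "?f \<gamma> * ?e \<gamma> = (rk H \<gamma> + rroot H \<gamma>) / (rk H \<gamma> - rroot H \<gamma>)"
      using rroot_nonzero[of \<gamma>] k0[of \<gamma>] by (simp add: divide_inverse)
  qed
  then have "R0 = loc H (prod_list (map tau' as)) * E (\<Prod>\<gamma>\<in>P - RP Md. ?e \<gamma>)"
    unfolding R0_eq t by (simp only: mult.assoc hom_E(3)[symmetric])
  then show ?thesis by blast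
qed

lemma Psi_integral: "\<exists>m\<in>hecke_par H M. loc H m = Psi (loc H h) * E (rat dpol)"
proof -
  let ?e = "\<lambda>\<gamma>. if kpar H \<gamma> = 0 then 1 else inverse (rk H \<gamma> - rroot H \<gamma>)"
  obtain t where t: "R0 = loc H t * E (\<Prod>\<gamma>\<in>P - RP Md. ?e \<gamma>)" using R0_integral by blast
  let ?h = "tw H (inv c) * h * t"
  define m where "m = (\<Sum>z\<in>WP Md. tw H (c \<circ> z \<circ> inv c) * emb H (sact H c (hc ?h z)))"
  have "T (inv c) * loc H h * R0 = loc H ?h * E (\<Prod>\<gamma>\<in>P - RP Md. ?e \<gamma>)"
    unfolding t by (simp only: hom_loc mult.assoc)
  then have e1: "eps H Md (T (inv c) * loc H h * R0) = proj Md (loc H ?h) * E (\<Prod>\<gamma>\<in>P - RP Md. ?e \<gamma>)"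
    using proj_mult_right[OF Md E_rhecke] by (simp only: eps_eq_proj[OF Md])
  have "proj Md (loc H ?h) = (\<Sum>z\<in>W. if z \<in> WP Md then T z * E (rat (hc ?h z)) else 0)"
    unfolding proj_def by (rule sum.cong) (auto simp: cf_loc E_add)
  also have "\<dots> = (\<Sum>z\<in>WP Md. T z * E (rat (hc ?h z)))"
    using finite_W WP_W[OF Md] by (subst sum.inter_filter[symmetric]) (auto intro!: sum.cong)
  finally have e2: "proj Md (loc H ?h) = (\<Sum>z\<in>WP Md. T z * E (rat (hc ?h z)))" .
  have conj: "R0 * (T z * E (rat p)) = T (c \<circ> z \<circ> inv c) * E (rat (sact H c p)) * R0"
    if z: "z \<in> WP Md" for z p
  proof -
    have zW: "z \<in> W" using z WP_W[OF Md] by blast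
    have "inv c \<circ> (c \<circ> z \<circ> inv c) \<circ> c = z" using cW by (simp add: comp_assoc)
    then have e1: "R0 * T z = T (c \<circ> z \<circ> inv c) * R0" using T_R0[OF conj_c[OF M z]] by simp
    have e2: "R0 * E (rat p) = E (rat (sact H c p)) * R0" using R0_E[of "rat p"] ract_rat[OF cW] by simp
    show ?thesis unfolding assoc_tail[OF e1] e2 mult.assoc ..
  qed
  have "R0 * proj Md (loc H ?h) = (\<Sum>z\<in>WP Md. R0 * (T z * E (rat (hc ?h z))))"
    unfolding e2 by (rule sum_distrib_left)
  also have "\<dots> = (\<Sum>z\<in>WP Md. T (c \<circ> z \<circ> inv c) * E (rat (sact H c (hc ?h z))) * R0)"
    by (rule sum.cong[OF HOL.refl]) (rule conj)
  also have "\<dots> = loc H m * R0"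
    unfolding m_def by (simp add: loc_add hom_loc loc_emb sum_distrib_right)
  finally have e3: "R0 * proj Md (loc H ?h) = loc H m * R0" .
  have d: "ract c (\<Prod>\<gamma>\<in>P - RP Md. ?e \<gamma>) = inverse (rat dpol)"
  proof -
    have "ract c (\<Prod>\<gamma>\<in>P - RP Md. ?e \<gamma>) = (\<Prod>\<beta>\<in>P - RP M. inverse (rat (dfac \<beta>)))"
    proof (rule prod_complement_c)
      fix \<gamma> assume g: "\<gamma> \<in> roots H"
      have cg: "c \<gamma> \<in> roots H" using weyl_root[OF cW g] .
      have "rat (dfac (- c \<gamma>)) = (if kpar H \<gamma> = 0 then 1 else rk H (c \<gamma>) - rroot H (c \<gamma>))"
        using g cg cW by (simp add: dfac_def kpar_neg kpar_weyl root_fn_neg rat_simps rk_def rroot_def)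
      then show "ract c (?e \<gamma>) = inverse (rat (dfac (- c \<gamma>)))"
        using cW g by (simp add: ract_simps ract_diff ract_rroot ract_rk)
    qed
    then show ?thesis by (simp add: dpol_def rat_prod prod_inversef[symmetric] comp_def)
  qed
  have "Psi (loc H h) = loc H m * R0 * E (\<Prod>\<gamma>\<in>P - RP Md. ?e \<gamma>) * R0inv"
    unfolding Psi_def e1 e3[symmetric] by (simp only: mult.assoc)
  also have "\<dots> = loc H m * E (inverse (rat dpol)) * (R0 * R0inv)"
    by (simp only: mult.assoc) (simp only: R0_E d mult.assoc[symmetric])
  finally have "Psi (loc H h) * E (rat dpol) = loc H m * (E (inverse (rat dpol)) * E (rat dpol))"
    by (simp add: R0_inverse mult.assoc)
  also have "E (inverse (rat dpol)) * E (rat dpol) = 1"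
    using dpol_nonzero by (simp add: rat_eq_0_iff flip: hom_E)
  finally have "loc H m = Psi (loc H h) * E (rat dpol)" by simp
  moreover have "m \<in> hecke_par H M"
    unfolding m_def by (intro hecke_closed tw_hecke emb_hecke conj_c[OF M])
  ultimately show ?thesis by blast
qed

text \<open>The map \<open>Psi\<close> with its denominator cleared.  It goes from the Hecke algebra to the parabolic
subalgebra and is a bimodule map, so it can be composed with the representation \<open>\<sigma>\<close>, which is
defined on polynomial coefficients only.\<close>

definition mu :: "'h \<Rightarrow> 'h" where
  "mu h = (SOME m. m \<in> hecke_par H M \<and> loc H m = Psi (loc H h) * E (rat dpol))"

lemma mu: "mu h \<in> hecke_par H M" "loc H (mu h) = Psi (loc H h) * E (rat dpol)"
proof -
  have "mu h \<in> hecke_par H M \<and> loc H (mu h) = Psi (loc H h) * E (rat dpol)"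
    unfolding mu_def by (rule someI_ex) (use Psi_integral in blast)
  then show "mu h \<in> hecke_par H M" "loc H (mu h) = Psi (loc H h) * E (rat dpol)" by blast+
qed

lemma mu_add: "mu (h + h') = mu h + mu h'"
  by (rule loc_inj) (simp add: mu hom_loc Psi_add distrib_right)

lemma mu_left: "m \<in> hecke_par H M \<Longrightarrow> mu (m * h) = m * mu h"
  by (rule loc_inj) (simp add: mu hom_loc Psi_left loc_hecke mult.assoc)

lemma mu_right: "m \<in> hecke_par H M \<Longrightarrow> mu (h * m) = mu h * m"
  by (rule loc_inj)
    (simp add: mu hom_loc Psi_right loc_hecke mult.assoc commute_invariant[OF M dpol_ract])

lemma eps_mu:
  "eps H Md (loc H (tw H (inv c) * h) * R0) = R0inv * (loc H (mu h) * E (inverse (rat dpol))) * R0"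
proof -
  have "E (rat dpol) * E (inverse (rat dpol)) = 1"
    using dpol_nonzero by (simp add: rat_eq_0_iff flip: hom_E)
  then have "loc H (mu h) * E (inverse (rat dpol)) = Psi (loc H h)"
    by (simp add: mu mult.assoc)
  moreover have "R0inv * Psi (loc H h) * R0 =
      (R0inv * R0) * eps H Md (T (inv c) * loc H h * R0) * (R0inv * R0)"
    unfolding Psi_def by (simp only: mult.assoc)
  ultimately show ?thesis by (simp add: R0_inverse hom_loc)
qed

lemma cf_eps_mu:
  assumes z: "z \<in> WP M"
  shows "cf (eps H Md (loc H (tw H (inv c) * h) * R0)) (inv c \<circ> z \<circ> c) =
    ract (inv c) (rat (hc (mu h) z) / rat dpol)"
proof -
  let ?a = "\<lambda>z. rat (hc (mu h) z) / rat dpol"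
  have "loc H (mu h) * E (inverse (rat dpol)) = (\<Sum>z\<in>WP M. T z * E (?a z))"
    by (subst hecke_par_expand[OF M mu(1)])
      (simp add: loc_add hom_loc loc_emb sum_distrib_right mult.assoc divide_inverse hom_E)
  then have "loc H (mu h) * E (inverse (rat dpol)) * R0 = (\<Sum>z\<in>WP M. T z * E (?a z) * R0)"
    by (simp only: sum_distrib_right)
  also have "\<dots> = (\<Sum>z\<in>WP M. R0 * (T (inv c \<circ> z \<circ> c) * E (ract (inv c) (?a z))))"
  proof (rule sum.cong[OF HOL.refl])
    fix z assume "z \<in> WP M"
    then show "T z * E (?a z) * R0 = R0 * (T (inv c \<circ> z \<circ> c) * E (ract (inv c) (?a z)))"
      by (simp only: mult.assoc E_R0 T_R0[THEN assoc_tail])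
  qed
  finally have "eps H Md (loc H (tw H (inv c) * h) * R0) =
      (R0inv * R0) * (\<Sum>z\<in>WP M. T (inv c \<circ> z \<circ> c) * E (ract (inv c) (?a z)))"
    unfolding eps_mu by (simp only: sum_distrib_left mult.assoc)
  then have e: "eps H Md (loc H (tw H (inv c) * h) * R0) =
      (\<Sum>z\<in>WP M. T (inv c \<circ> z \<circ> c) * E (ract (inv c) (?a z)))"
    by (simp add: R0_inverse)
  have zW: "u \<in> WP M \<Longrightarrow> u \<in> W" "u \<in> W \<Longrightarrow> inv c \<circ> u \<circ> c \<in> W" for u
    using WP_W[OF M] cW icW comp_W by blast+
  have inj: "inv c \<circ> z \<circ> c = inv c \<circ> u \<circ> c \<longleftrightarrow> u = z" for u
  proof
    assume "inv c \<circ> z \<circ> c = inv c \<circ> u \<circ> c"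
    then have "c \<circ> (inv c \<circ> z \<circ> c) \<circ> inv c = c \<circ> (inv c \<circ> u \<circ> c) \<circ> inv c" by simp
    then show "u = z" using cW by (simp add: comp_assoc)
  qed simp
  have "cf (eps H Md (loc H (tw H (inv c) * h) * R0)) (inv c \<circ> z \<circ> c) =
      (\<Sum>u\<in>WP M. if u = z then ract (inv c) (?a z) else 0)"
    unfolding e cf_add'
  proof (rule sum.cong[OF HOL.refl])
    fix u assume u: "u \<in> WP M"
    show "cf (T (inv c \<circ> u \<circ> c) * E (ract (inv c) (?a u))) (inv c \<circ> z \<circ> c) =
        (if u = z then ract (inv c) (?a z) else 0)"
      using cf_T_E[OF zW(2)[OF zW(1)[OF u]] zW(2)[OF zW(1)[OF z]]] inj[of u] by (auto simp del: comp_apply)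
  qed
  then show ?thesis using z finite_WP[OF M] by (simp add: sum.delta)
qed

end

lemma rat_frac_eq:
  assumes "q \<noteq> 0" "q' \<noteq> 0" "rat p / rat q = rat p' / rat q'"
  shows "p * q' = p' * q"
proof -
  have "rat q \<noteq> 0" "rat q' \<noteq> 0" using assms by (simp_all add: rat_eq_0_iff)
  then have "rat p * rat q' = rat p' * rat q" using assms(3) by (simp add: frac_eq_eq)
  then show ?thesis by (simp add: rat_eq_iff flip: rat_simps)
qed

section \<open>Tensor products and formal sums\<close>

lemma formal_eval_superset:
  assumes "vector_space s" "finite A" "Poly_Mapping.keys c \<subseteq> A"
  shows "formal_eval s t c = (\<Sum>(h, u)\<in>A. s (of_int (Poly_Mapping.lookup c (h, u))) (t h u))"
proof -
  interpret vector_space s by (rule assms(1))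
  show ?thesis
    unfolding formal_eval_def
    by (rule sum.mono_neutral_left) (use assms(2,3) in \<open>auto simp: in_keys_iff\<close>)
qed

lemma formal_eval_add:
  assumes "vector_space s"
  shows "formal_eval s t (c + d) = formal_eval s t c + formal_eval s t d"
proof -
  interpret vector_space s by (rule assms)
  let ?A = "Poly_Mapping.keys c \<union> Poly_Mapping.keys d"
  have "Poly_Mapping.keys (c + d) \<subseteq> ?A" by (rule Poly_Mapping.keys_add)
  then show ?thesis
    using formal_eval_superset[OF assms, of ?A] 
    by (simp add: lookup_add scale_left_distrib sum.distrib case_prod_beta)
qed

lemma formal_eval_diff:
  assumes "vector_space s"
  shows "formal_eval s t (c - d) = formal_eval s t c - formal_eval s t d"
  using formal_eval_add[OF assms, of t "c - d" d] by simp

lemma formal_eval_single: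
  assumes "vector_space s"
  shows "formal_eval s t (Poly_Mapping.single (h, u) 1) = t h u"
proof -
  interpret vector_space s by (rule assms)
  show ?thesis by (simp add: formal_eval_def)
qed

lemma vector_space_complex: "vector_space ((*) :: complex \<Rightarrow> complex \<Rightarrow> complex)"
  by unfold_locales (simp_all add: algebra_simps)

lemma formal_eval_relations:
  assumes k: "\<And>h h' u. \<kappa> (h + h') u = \<kappa> h u + \<kappa> h' u" "\<And>h u u'. \<kappa> h (u + u') = \<kappa> h u + \<kappa> h u'"
    "\<And>h m u. m \<in> A \<Longrightarrow> \<kappa> (h * m) u = \<kappa> h (\<sigma> m u)"
    and c: "c \<in> tensor_relations A \<sigma>"
  shows "formal_eval (*) \<kappa> c = (0::complex)"
  using c unfolding tensor_relations_def
proof (induction c rule: subgroup_gen.induct)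
  case zero
  show ?case by (simp add: formal_eval_def)
next
  case (incl x)
  note F = formal_eval_diff[OF vector_space_complex] formal_eval_single[OF vector_space_complex]
  from incl show ?case by (auto simp: F k)
next
  case (diff x y)
  then show ?case by (simp add: formal_eval_diff[OF vector_space_complex])
qed

text \<open>A value is computed on any formal sum representing the given tensor.  Two such sums differ by a
relation, and relations are sent to \<open>0\<close>.\<close>

lemma tensor_lift:
  assumes tp: "is_tensor_product H A \<sigma> sX tens"
    and k: "\<And>h h' u. \<kappa> (h + h') u = \<kappa> h u + \<kappa> h' u" "\<And>h u u'. \<kappa> h (u + u') = \<kappa> h u + \<kappa> h u'"
    "\<And>h m u. m \<in> A \<Longrightarrow> \<kappa> (h * m) u = \<kappa> h (\<sigma> m u)"
  shows "\<exists>f. (\<forall>x y. f (x + y) = f x + f y) \<and> (\<forall>h u. f (tens h u) = (\<kappa> h u :: complex))"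
proof -
  have vs: "vector_space sX" and sj: "surj (formal_eval sX tens)"
    and ker: "\<And>c. formal_eval sX tens c = 0 \<longleftrightarrow> c \<in> tensor_relations A \<sigma>"
    using tp by (auto simp: is_tensor_product_def)
  define f where "f x = formal_eval (*) \<kappa> (SOME c. formal_eval sX tens c = x)" for x
  have f: "f (formal_eval sX tens c) = formal_eval (*) \<kappa> c" for c
  proof -
    let ?c = "SOME c'. formal_eval sX tens c' = formal_eval sX tens c"
    have "formal_eval sX tens ?c = formal_eval sX tens c" by (rule someI) (rule HOL.refl)
    then have "formal_eval sX tens (?c - c) = 0" by (simp add: formal_eval_diff[OF vs])
    then have "formal_eval (*) \<kappa> (?c - c) = 0"
      using formal_eval_relations[of \<kappa> A \<sigma>, OF k] ker by blast
    then show ?thesis by (simp add: f_def formal_eval_diff[OF vector_space_complex])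
  qed
  have "f (x + y) = f x + f y" for x y
  proof -
    obtain c d where "x = formal_eval sX tens c" "y = formal_eval sX tens d"
      using sj by (metis surjD)
    then show ?thesis
      using f[of "c + d"] f[of c] f[of d]
      by (simp add: formal_eval_add[OF vs] formal_eval_add[OF vector_space_complex])
  qed
  moreover have "f (tens h u) = \<kappa> h u" for h u
    using f[of "Poly_Mapping.single (h, u) 1"]
    by (simp add: formal_eval_single[OF vs] formal_eval_single[OF vector_space_complex])
  ultimately show ?thesis by blast
qed

section \<open>The star operation\<close>

context hecke
begin

lemma star_simps: "star H 1 = 1" "star H (x + y) = star H x + star H y"
  "star H (emb H (cst a) * x) = emb H (cst (cnj a)) * star H x"
  "star H (x * y) = star H y * star H x" "w \<in> W \<Longrightarrow> star H (tw H w) = tw H (inv w)"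
  "star H (emb H (lin H \<omega>)) = emb H (lin H (cconj \<omega>))"
  using st unfolding star_operation_def by blast+

lemmas star_add = additive_simps[of "star H", OF star_simps(2)]

lemma star_cst: "star H (emb H (cst a)) = emb H (cst (cnj a))"
  using star_simps(3)[of a 1] star_simps(1) by simp

lemma cfunctional_lin:
  assumes "cfunctional f"
  shows "\<exists>\<omega>. f = cpair H \<omega>"
proof -
  have fa: "f (x + y) = f x + f y" and fs: "f (cscale a x) = a * f x" for x y a
    using assms unfolding cfunctional_def by blast+
  have r: "f (r *\<^sub>R \<mu>, 0) = of_real r * f (\<mu>, 0)" for r \<mu>
    using fs[of "of_real r" "(\<mu>, 0)"] by (simp add: cscale_def)
  have a: "f (\<mu> + \<mu>', 0) = f (\<mu>, 0) + f (\<mu>', 0)" for \<mu> \<mu>'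
    using fa[of "(\<mu>, 0)" "(\<mu>', 0)"] by simp
  have "linear (\<lambda>\<mu>. Re (f (\<mu>, 0)))" "linear (\<lambda>\<mu>. Im (f (\<mu>, 0)))"
    by (rule linearI; simp add: a r)+
  then obtain v v' where v: "\<And>\<mu>. Re (f (\<mu>, 0)) = pairing H v \<mu>" "\<And>\<mu>. Im (f (\<mu>, 0)) = pairing H v' \<mu>"
    using functional_represented by meson
  have "f z = cpair H (v, v') z" for z
  proof -
    obtain \<mu> \<mu>' where z: "z = (\<mu>, \<mu>')" by (cases z)
    have "f z = f (\<mu>, 0) + \<i> * f (\<mu>', 0)"
      using fa[of "(\<mu>, 0)" "(0, \<mu>')"] fs[of \<i> "(\<mu>', 0)"] by (simp add: z cscale_def)
    then show ?thesis by (simp add: z cpair_def v complex_eq_iff)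
  qed
  then show ?thesis by (metis ext)
qed

text \<open>The star operation is prescribed on constants and linear functions, and the complex-linear
functionals are exactly the linear functions because the pairing is perfect.\<close>

lemma star_emb: "\<exists>p'. star H (emb H p) = emb H p'"
proof -
  have "\<exists>p'. star H (emb H (Sym f)) = emb H p'" if "f \<in> polyfuns" for f
    using that
  proof (induction f rule: polyfuns.induct)
    case (const a)
    then show ?case using star_cst[of a] unfolding cst_def by blast
  next
    case (lin f)
    then obtain \<omega> where "f = cpair H \<omega>" using cfunctional_lin by blast
    then show ?case using star_simps(6)[of \<omega>] unfolding lin_def by blast
  next
    case (add f g)
    then have "Sym (\<lambda>z. f z + g z) = Sym f + Sym g" by (simp add: plus_sym_def Sym_ev)
    moreover obtain p q where "star H (emb H (Sym f)) = emb H p" "star H (emb H (Sym g)) = emb H q"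
      using add.IH by blast
    ultimately have "star H (emb H (Sym (\<lambda>z. f z + g z))) = emb H (p + q)"
      by (simp only: hom_emb star_simps)
    then show ?case by blast
  next
    case (mult f g)
    then have "Sym (\<lambda>z. f z * g z) = Sym f * Sym g" by (simp add: times_sym_def Sym_ev)
    moreover obtain p q where "star H (emb H (Sym f)) = emb H p" "star H (emb H (Sym g)) = emb H q"
      using mult.IH by blast
    ultimately have "star H (emb H (Sym (\<lambda>z. f z * g z))) = emb H (q * p)"
      by (simp only: hom_emb star_simps)
    then show ?case by blast
  qed
  from this[OF ev] show ?thesis by (simp add: ev_inverse)
qed

lemma star_hecke:
  assumes M: "M \<subseteq> simples H" and m: "m \<in> hecke_par H M"
  shows "star H m \<in> hecke_par H M"
  using m unfolding hecke_par_def
proof (induction m rule: subring_gen.induct)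
  case (incl x)
  then consider w where "w \<in> WP M" "x = tw H w" | p where "x = emb H p" by blast
  then show ?case
  proof cases
    case 1
    then have "star H x = tw H (inv w)" using star_simps(5) WP_W[OF M] by blast
    then show ?thesis using inv_WP[OF M 1(1)] by (auto intro: subring_gen.incl)
  next
    case 2
    then show ?thesis using star_emb[of p] by (auto intro: subring_gen.incl)
  qed
qed (auto simp: star_simps star_add intro: subring_gen.intros)

lemma root_fn_T:
  assumes a: "\<alpha> \<in> simples H"
  shows "emb H (root_fn H \<alpha>) * tw H (refl H \<alpha>) =
    emb H (cst (of_real (kpar H \<alpha>))) - tau \<alpha>"
proof (rule loc_inj)
  have aR: "\<alpha> \<in> roots H" "refl H \<alpha> \<in> W" using a simples_roots refl_W by auto
  note nz = rank_one_nonzero[OF a]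
  let ?a = "rroot H \<alpha>" and ?k = "rk H \<alpha>" and ?t = "loc H (tau \<alpha>)"
  have "E ?a * ?t = - (?t * E ?a)"
    using tau_intertwines[OF a, of ?a] nz by (simp add: E_add)
  moreover have "E ?a * ?t = E ?a * T (refl H \<alpha>) * E ?a - E ?k * E ?a"
    by (simp add: loc_tau right_diff_distrib mult.assoc E_commute)
  ultimately have "E ?a * T (refl H \<alpha>) * E ?a = (E ?k - ?t) * E ?a"
    by (simp add: left_diff_distrib diff_eq_eq)
  then have "E ?a * T (refl H \<alpha>) * (E ?a * E (inverse ?a)) = (E ?k - ?t) * (E ?a * E (inverse ?a))"
    by (simp add: mult.assoc[symmetric])
  moreover have "E ?a * E (inverse ?a) = 1" using nz by (simp flip: hom_E)
  ultimately have "E ?a * T (refl H \<alpha>) = E ?k - ?t" by simp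
  then show "loc H (emb H (root_fn H \<alpha>) * tw H (refl H \<alpha>)) =
      loc H (emb H (cst (of_real (kpar H \<alpha>))) - tau \<alpha>)"
    by (simp add: hom_loc loc_add loc_emb rroot_def rk_def)
qed

lemma star_root_fn: "star H (emb H (root_fn H \<alpha>)) = emb H (root_fn H \<alpha>)"
  by (simp add: root_fn_def star_simps cconj_def)

lemma star_tau:
  assumes a: "\<alpha> \<in> simples H"
  shows "star H (tau \<alpha>) = - tau \<alpha>"
proof -
  have aR: "\<alpha> \<in> roots H" "refl H \<alpha> \<in> W" using a simples_roots refl_W by auto
  have "star H (tau \<alpha>) = emb H (root_fn H \<alpha>) * tw H (refl H \<alpha>) - emb H (cst (of_real (kpar H \<alpha>)))"
    using aR by (simp add: tau_def star_add star_simps star_root_fn star_cst inv_refl)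
  then show ?thesis using root_fn_T[OF a] by simp
qed

lemma star_emb_real_prod:
  assumes "finite A" "\<And>i. i \<in> A \<Longrightarrow> star H (emb H (f i)) = emb H (f i)"
  shows "star H (emb H (\<Prod>i\<in>A. f i)) = emb H (\<Prod>i\<in>A. f i)"
  using assms by (induction A rule: finite_induct) (simp_all add: hom_emb star_simps emb_commute)

lemma loc_prod_list: "loc H (prod_list (map f as)) = prod_list (map (\<lambda>x. loc H (f x)) as)"
  by (induction as) (simp_all add: hom_loc)

lemma reduced_word_rev:
  assumes "reduced_word H y as" "y \<in> W"
  shows "reduced_word H (inv y) (rev as)"
proof -
  have le: "N (inv w) \<le> N w" if w: "w \<in> W" for w
  proof -
    obtain bs where bs: "set bs \<subseteq> simples H" "word_prod H bs = w" "length bs = N w"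
      using word_of_length_N[OF w] by blast
    then have "N (word_prod H (rev bs)) \<le> length (rev bs)" by (intro N_word_le) simp
    then show ?thesis using bs word_prod_rev by simp
  qed
  have "N (inv y) = N y" using le[OF assms(2)] le[OF inv_W[OF assms(2)]] assms(2) by (simp add: inv_inv_W)
  then show ?thesis
    using assms inv_W[OF assms(2)] word_prod_rev by (simp add: reduced_word_iff)
qed

definition G :: "('v \<Rightarrow> 'v) \<Rightarrow> 'd sym fract" where
  "G y = (\<Prod>\<gamma>\<in>Inv y. (rroot H \<gamma> - rk H \<gamma>) / (rroot H \<gamma> + rk H \<gamma>))"

lemma ract_prod_Inv_inv:
  assumes y: "y \<in> W"
  shows "ract (inv y) (\<Prod>\<gamma>\<in>Inv (inv y). - (rk H \<gamma> + rroot H \<gamma>)) =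
    (\<Prod>\<gamma>\<in>Inv y. rroot H \<gamma> - rk H \<gamma>)"
proof -
  have iy: "inv y \<in> W" using y inv_W by blast
  have "ract (inv y) (\<Prod>\<gamma>\<in>Inv (inv y). - (rk H \<gamma> + rroot H \<gamma>)) =
      (\<Prod>\<gamma>\<in>Inv (inv y). rroot H (- inv y \<gamma>) - rk H (- inv y \<gamma>))"
    unfolding ract_prod[OF iy]
  proof (rule prod.cong[OF HOL.refl])
    fix \<gamma> assume "\<gamma> \<in> Inv (inv y)"
    then have g: "\<gamma> \<in> roots H" using P_roots by (auto simp: Inv_def)
    show "ract (inv y) (- (rk H \<gamma> + rroot H \<gamma>)) = rroot H (- inv y \<gamma>) - rk H (- inv y \<gamma>)"
      using g iy weyl_root[OF iy g]
      by (simp add: ract_simps ract_diff ract_rroot ract_rk rroot_neg rk_neg)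
  qed
  also have "\<dots> = (\<Prod>\<gamma>\<in>Inv y. rroot H \<gamma> - rk H \<gamma>)"
    by (rule prod.reindex_bij_witness[of _ "\<lambda>\<gamma>. - y \<gamma>" "\<lambda>\<gamma>. - inv y \<gamma>"])
      (use y iy in \<open>auto simp: Inv_def neg_W\<close>)
  finally show ?thesis .
qed

text \<open>The intertwiners \<open>\<tau>\<close> are anti-selfadjoint.  Clearing the denominators of \<open>cR y\<close> on the
  right therefore determines the adjoint: up to the scalar functions \<open>q\<^sup>\<bullet>\<close> and \<open>G y\<close> it is \<open>cR\<close> of
  the inverse.\<close>

lemma loc_star:
  assumes y: "y \<in> W" and h: "loc H h = cR y * E (rat q)" and q': "star H (emb H q) = emb H q'"
  shows "loc H (star H h) = E (rat q' * G y) * cR (inv y)"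
proof -
  obtain as where as: "reduced_word H y as" using reduced_word_exists y by blast
  have iy: "inv y \<in> W" using y inv_W by blast
  define dY where "dY = (\<Prod>\<gamma>\<in>Inv y. cst (of_real (kpar H \<gamma>)) + root_fn H \<gamma>)"
  have rdY: "rat dY = (\<Prod>\<gamma>\<in>Inv y. rk H \<gamma> + rroot H \<gamma>)"
    by (simp add: dY_def rat_prod rat_simps rk_def rroot_def)
  define tY where "tY = prod_list (map tau as)"
  have asS: "set as \<subseteq> simples H" using as by (simp add: reduced_word_def)
  have "loc H tY = prod_list (map (\<lambda>\<alpha>. loc H (tau \<alpha>)) as)"
    unfolding tY_def by (rule loc_prod_list)
  also have "\<dots> = cR y * E (\<Prod>\<gamma>\<in>Inv y. rk H \<gamma> + rroot H \<gamma>)"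
  proof (rule prod_word_factor[OF as y])
    fix \<alpha> assume a: "\<alpha> \<in> simples H"
    show "loc H (tau \<alpha>) = cRs H \<alpha> * E (rk H \<alpha> + rroot H \<alpha>)"
      unfolding cRs_tau mult.assoc hom_E(3)[symmetric] using rank_one_nonzero[OF a]
      by (simp add: hom_E)
  next
    fix \<alpha> \<gamma> assume "\<alpha> \<in> simples H" and g: "\<gamma> \<in> roots H"
    then have s: "refl H \<alpha> \<in> W" using simples_roots refl_W by auto
    show "ract (refl H \<alpha>) (rk H \<gamma> + rroot H \<gamma>) = rk H (refl H \<alpha> \<gamma>) + rroot H (refl H \<alpha> \<gamma>)"
      using s g by (simp add: ract_simps ract_rroot ract_rk)
  qed
  finally have tY: "loc H tY = cR y * E (rat dY)" by (simp only: rdY)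
  have "loc H (h * emb H dY) = loc H (tY * emb H q)"
    by (simp only: hom_loc h tY loc_emb mult.assoc E_commute)
  then have "h * emb H dY = tY * emb H q" by (rule loc_inj)
  then have "star H (h * emb H dY) = star H (tY * emb H q)" by simp
  moreover have "star H (emb H dY) = emb H dY"
    unfolding dY_def
    by (rule star_emb_real_prod[OF finite_Inv]) (simp add: hom_emb star_simps star_cst star_root_fn)
  ultimately have s: "emb H dY * star H h = emb H q' * star H tY" by (simp add: star_simps q')
  have "star H tY = prod_list (map (\<lambda>\<alpha>. - tau \<alpha>) (rev as))"
    unfolding tY_def using asS by (induction as) (simp_all add: star_simps star_tau)
  then have "loc H (star H tY) = prod_list (map (\<lambda>\<alpha>. loc H (- tau \<alpha>)) (rev as))"
    by (simp only: loc_prod_list)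
  also have "\<dots> = cR (inv y) * E (\<Prod>\<gamma>\<in>Inv (inv y). - (rk H \<gamma> + rroot H \<gamma>))"
  proof (rule prod_word_factor[OF reduced_word_rev[OF as y] iy])
    fix \<alpha> assume a: "\<alpha> \<in> simples H"
    have "loc H (tau \<alpha>) = cRs H \<alpha> * E (rk H \<alpha> + rroot H \<alpha>)"
      unfolding cRs_tau mult.assoc hom_E(3)[symmetric] using rank_one_nonzero[OF a]
      by (simp add: hom_E)
    then show "loc H (- tau \<alpha>) = cRs H \<alpha> * E (- (rk H \<alpha> + rroot H \<alpha>))"
      by (simp only: loc_add E_add mult_minus_right)
  next
    fix \<alpha> \<gamma> assume "\<alpha> \<in> simples H" and g: "\<gamma> \<in> roots H"
    then have s: "refl H \<alpha> \<in> W" using simples_roots refl_W by auto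
    show "ract (refl H \<alpha>) (- (rk H \<gamma> + rroot H \<gamma>)) = - (rk H (refl H \<alpha> \<gamma>) + rroot H (refl H \<alpha> \<gamma>))"
      using s g by (simp add: ract_simps ract_diff ract_rroot ract_rk)
  qed
  also have "\<dots> = E (\<Prod>\<gamma>\<in>Inv y. rroot H \<gamma> - rk H \<gamma>) * cR (inv y)"
    using cR_E[OF iy] ract_prod_Inv_inv[OF y] by simp
  finally have t: "loc H (star H tY) = E (\<Prod>\<gamma>\<in>Inv y. rroot H \<gamma> - rk H \<gamma>) * cR (inv y)" .
  have nz: "rat dY \<noteq> 0"
    unfolding rdY using rroot_nonzero P_roots finite_Inv
    by (subst prod_zero_iff) (auto simp: Inv_def)
  have "E (inverse (rat dY)) * (E (rat dY) * loc H (star H h)) =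
      E (inverse (rat dY)) * (E (rat q') * (E (\<Prod>\<gamma>\<in>Inv y. rroot H \<gamma> - rk H \<gamma>) * cR (inv y)))"
    using arg_cong[OF s, of "loc H"] t by (simp only: hom_loc loc_emb)
  then have "E (inverse (rat dY) * rat dY) * loc H (star H h) =
      E (inverse (rat dY) * (rat q' * (\<Prod>\<gamma>\<in>Inv y. rroot H \<gamma> - rk H \<gamma>))) * cR (inv y)"
    by (simp only: hom_E mult.assoc)
  moreover have "inverse (rat dY) * rat dY = 1" using nz by simp
  moreover have "inverse (rat dY) * (rat q' * (\<Prod>\<gamma>\<in>Inv y. rroot H \<gamma> - rk H \<gamma>)) = rat q' * G y"
    unfolding G_def prod_dividef rdY by (simp add: divide_inverse mult_ac add.commute)
  ultimately show ?thesis by (simp add: hom_E)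
qed

end

section \<open>The induced form\<close>

locale induced = parabolic H M
  for H :: "('v::real_vector, 'd::real_vector, 'h::ring_1, 'g::ring_1) rat_hecke_data"
    and M :: "'v set" +
  fixes sU :: "complex \<Rightarrow> 'u::ab_group_add \<Rightarrow> 'u"
    and \<sigma> :: "'h \<Rightarrow> 'u \<Rightarrow> 'u" and \<nu> cc :: "'d cpx"
    and b :: "'u \<Rightarrow> 'u \<Rightarrow> complex"
    and sX :: "complex \<Rightarrow> 'x::ab_group_add \<Rightarrow> 'x"
    and tens :: "'h \<Rightarrow> 'u \<Rightarrow> 'x"
  assumes rep: "hecke_rep H (hecke_par H M) sU \<sigma>"
    and central: "central_character H M sU \<sigma> cc"
    and herm: "hermitian_form sU b" and inv_b: "star_invariant H (hecke_par H M) \<sigma> b"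
    and tp: "is_tensor_product H (hecke_par H M) \<sigma> sX tens"
    and reg: "regular_parameter H M sU \<sigma> sX tens \<nu>"
begin

abbreviation HM where "HM \<equiv> hecke_par H M"
abbreviation S where "S p \<equiv> \<sigma> (emb H p)"

lemma vsU: "vector_space sU"
  using rep by (simp add: hecke_rep_def)

lemma sU_simps: "sU a (u + v) = sU a u + sU a v" "sU (x + y) u = sU x u + sU y u"
  "sU x (sU y u) = sU (x * y) u" "sU 1 u = u" "sU 0 u = 0" "sU x 0 = 0"
proof -
  interpret vector_space sU by (rule vsU)
  show "sU a (u + v) = sU a u + sU a v" "sU (x + y) u = sU x u + sU y u"
    "sU x (sU y u) = sU (x * y) u" "sU 1 u = u" "sU 0 u = 0" "sU x 0 = 0"
    by (simp_all add: scale_right_distrib scale_left_distrib)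
qed

lemma \<sigma>_simps:
  "m \<in> HM \<Longrightarrow> m' \<in> HM \<Longrightarrow> \<sigma> (m + m') u = \<sigma> m u + \<sigma> m' u"
  "m \<in> HM \<Longrightarrow> m' \<in> HM \<Longrightarrow> \<sigma> (m * m') u = \<sigma> m (\<sigma> m' u)"
  "S (cst a) u = sU a u"
  "m \<in> HM \<Longrightarrow> \<sigma> m (u + v) = \<sigma> m u + \<sigma> m v"
  "m \<in> HM \<Longrightarrow> \<sigma> m (sU a u) = sU a (\<sigma> m u)"
proof -
  show "m \<in> HM \<Longrightarrow> m' \<in> HM \<Longrightarrow> \<sigma> (m + m') u = \<sigma> m u + \<sigma> m' u"
    "m \<in> HM \<Longrightarrow> m' \<in> HM \<Longrightarrow> \<sigma> (m * m') u = \<sigma> m (\<sigma> m' u)" "S (cst a) u = sU a u"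
    using rep by (simp_all add: hecke_rep_def)
  show "\<sigma> m (u + v) = \<sigma> m u + \<sigma> m v" "\<sigma> m (sU a u) = sU a (\<sigma> m u)" if "m \<in> HM"
  proof -
    interpret l: Vector_Spaces.linear sU sU "\<sigma> m"
      using rep that by (simp add: hecke_rep_def)
    show "\<sigma> m (u + v) = \<sigma> m u + \<sigma> m v" "\<sigma> m (sU a u) = sU a (\<sigma> m u)"
      by (rule l.add, rule l.scale)
  qed
qed

lemma S_mult: "S (p * q) u = S p (S q u)"
  using \<sigma>_simps(2)[OF emb_hecke emb_hecke] by (simp add: hom_emb)

lemma S_commute: "S p (S q u) = S q (S p u)"
  using S_mult[of p q] S_mult[of q p] by (simp add: mult.commute)

lemma S_one: "S 1 u = u"
  using \<sigma>_simps(3)[of 1] by (simp add: cst_simps sU_simps)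

lemma \<sigma>_zero: "\<sigma> 0 u = 0"
proof -
  have "S (cst 0) u = 0" using \<sigma>_simps(3)[of 0] sU_simps by simp
  then show ?thesis by (simp add: cst_simps emb_add)
qed

lemma \<sigma>_sum: "(\<And>i. i \<in> A \<Longrightarrow> f i \<in> HM) \<Longrightarrow> \<sigma> (\<Sum>i\<in>A. f i) u = (\<Sum>i\<in>A. \<sigma> (f i) u)"
proof (induction A rule: infinite_finite_induct)
  case (insert x A)
  then have "(\<Sum>i\<in>A. f i) \<in> HM" by (intro hecke_closed(4)) auto
  then show ?case using insert \<sigma>_simps(1) by simp
qed (simp_all add: \<sigma>_zero)

lemma bij_S_mult: "bij (S p) \<Longrightarrow> bij (S q) \<Longrightarrow> bij (S (p * q))"
proof -
  assume "bij (S p)" "bij (S q)"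
  moreover have "S (p * q) = S p \<circ> S q" using S_mult by (simp add: fun_eq_iff)
  ultimately show ?thesis by (simp add: bij_comp)
qed

lemma bij_S_factor: "bij (S (p * q)) \<Longrightarrow> bij (S p)"
proof -
  assume bj: "bij (S (p * q))"
  have "inj (S p)"
  proof (rule injI)
    fix u v assume "S p u = S p v"
    then have "S (p * q) u = S (p * q) v" using S_mult S_commute by metis
    then show "u = v" using bj by (meson bij_is_inj injD)
  qed
  moreover have "surj (S p)"
    unfolding surj_def using S_mult bij_is_surj[OF bj] by (metis surjD)
  ultimately show ?thesis by (simp add: bij_def)
qed

lemma bij_S_one: "bij (S 1)"
proof -
  have "S 1 = id" using S_one by (simp add: fun_eq_iff)
  then show ?thesis by (simp only: bij_id)
qed

lemma bij_S_prod: "finite A \<Longrightarrow> (\<And>i. i \<in> A \<Longrightarrow> bij (S (f i))) \<Longrightarrow> bij (S (\<Prod>i\<in>A. f i))"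
  by (induction A rule: finite_induct) (simp_all add: bij_S_one bij_S_mult)

text \<open>The defining equation of the action may be verified on any admissible fraction.\<close>

lemma rat_act_eq:
  assumes q: "q \<noteq> 0" "bij (S q)" and e: "S q u' = S p u"
  shows "rat_act H \<sigma> (rat p / rat q) u = u'"
  unfolding rat_act_def
proof (rule the_equality)
  show "\<exists>p' q'. q' \<noteq> 0 \<and> rat p / rat q = Fract p' q' \<and> bij (S q') \<and> S q' u' = S p' u"
    using assms Fract_rat by metis
next
  fix v assume "\<exists>p' q'. q' \<noteq> 0 \<and> rat p / rat q = Fract p' q' \<and> bij (S q') \<and> S q' v = S p' u"
  then obtain p' q' where pq: "q' \<noteq> 0" "rat p / rat q = rat p' / rat q'" "bij (S q')" "S q' v = S p' u"
    using Fract_rat by metis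
  have "p * q' = p' * q" using rat_frac_eq[OF q(1) pq(1,2)] .
  then have "S q' (S p u) = S q (S p' u)" by (metis S_mult mult.commute)
  then have "S q' (S q u') = S q' (S q v)" using e pq(4) S_commute by metis
  then have "S q u' = S q v" using pq(3) by (meson bij_is_inj injD)
  then show "v = u'" using q(2) by (metis bij_is_inj injD)
qed

section \<open>Denominators act invertibly\<close>

text \<open>The leading coefficient of the intertwiner of the longest representative \<open>c\<inverse>\<close> is the product of
all \<open>\<gamma> / (k + \<gamma>)\<close>.  By regularity it has a denominator that acts invertibly, and the prime factor
\<open>k + \<beta>\<close> has to divide this denominator.\<close>

lemma bij_dfac:
  assumes b: "\<beta> \<in> P - RP M"
  shows "bij (S (dfac \<beta>))"
proof (cases "kpar H \<beta> = 0")
  case True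
  then show ?thesis using bij_S_one by (simp add: dfac_def)
next
  case False
  have bR: "\<beta> \<in> roots H" using b P_roots by auto
  let ?A = "P - RP M" and ?l = "\<lambda>\<gamma>. cst (of_real (kpar H \<gamma>)) + root_fn H \<gamma>"
  have fin: "finite ?A" using finite_P by simp
  have "inv c \<in> min_reps H M" using inv_c_J[OF M] by simp
  then have "rat_defined H \<sigma> (cf (cR (inv c)) (inv c))"
    using reg icW unfolding regular_parameter_def by blast
  then have "rat_defined H \<sigma> (lead (inv c))" using cf_cR(1)[OF icW] by simp
  then obtain p q where pq: "q \<noteq> 0" "lead (inv c) = rat p / rat q" "bij (S q)"
    unfolding rat_defined_def using Fract_rat by metis
  have l: "lead (inv c) = rat (\<Prod>\<gamma>\<in>?A. root_fn H \<gamma>) / rat (\<Prod>\<gamma>\<in>?A. ?l \<gamma>)"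
    unfolding lead_def Inv_inv_c[OF M] prod_dividef
    by (simp add: rat_prod rroot_def rk_def rat_simps)
  have nz: "(\<Prod>\<gamma>\<in>?A. ?l \<gamma>) \<noteq> 0"
    using root_fn_nonzero P_roots fin by (subst prod_zero_iff) auto
  have "(\<Prod>\<gamma>\<in>?A. root_fn H \<gamma>) * q = p * (\<Prod>\<gamma>\<in>?A. ?l \<gamma>)"
    by (rule rat_frac_eq[OF nz pq(1)]) (use pq(2) l in simp)
  also have "(\<Prod>\<gamma>\<in>?A. ?l \<gamma>) = ?l \<beta> * (\<Prod>\<gamma>\<in>?A - {\<beta>}. ?l \<gamma>)"
    by (rule prod.remove[OF fin b])
  finally have "(\<Prod>\<gamma>\<in>?A. root_fn H \<gamma>) * q = (p * (\<Prod>\<gamma>\<in>?A - {\<beta>}. ?l \<gamma>)) * ?l \<beta>"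
    by (simp add: mult_ac)
  moreover have "?A \<subseteq> roots H" using P_roots by auto
  ultimately obtain q' where "q = ?l \<beta> * q'"
    using affine_factor_dvd[OF bR False fin] by blast
  then have "bij (S (?l \<beta>))" using pq(3) bij_S_factor by metis
  then show ?thesis using False by (simp add: dfac_def)
qed

lemma bij_dpol: "bij (S dpol)"
  unfolding dpol_def using finite_P bij_dfac by (intro bij_S_prod) auto

lemma S_central: "(\<And>w. w \<in> WP M \<Longrightarrow> sact H w p = p) \<Longrightarrow> S p u = sU (ev p cc) u"
  using central by (simp add: central_character_def)

lemma dpol_cc: "(u::'u) = 0 \<or> ev dpol cc \<noteq> 0"
proof (rule ccontr)
  assume n: "\<not> ?thesis"
  have d: "S dpol v = sU (ev dpol cc) v" for v using S_central dpol_invariant by blast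
  have "S dpol u = S dpol 0" using n d by (simp add: sU_simps)
  then show False using n bij_dpol by (metis bij_is_inj injD)
qed

text \<open>If \<open>U\<close> is zero the scalar may vanish, but then the equation is trivial.\<close>

lemma S_dpol: "S dpol (sU (1 / ev dpol cc) u) = u"
proof -
  have "S dpol (sU (1 / ev dpol cc) u) = sU (ev dpol cc) (sU (1 / ev dpol cc) u)"
    using S_central dpol_invariant by blast
  then show ?thesis using dpol_cc[of u] by (auto simp: sU_simps)
qed

section \<open>The twisted module\<close>

text \<open>The isomorphism \<open>\<phi>\<close> is conjugation by \<open>R\<^sup>0\<close>; in particular it is injective.\<close>

lemma loc_phi:
  assumes h: "h \<in> HM"
  shows "loc H (phi H M h) = R0inv * loc H h * R0"
proof -
  have "R0 * loc H (phi H M h) = (\<Sum>w\<in>WP M. T w * E (rat (hc h w)) * R0)"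
    unfolding phi_def loc_add(4) sum_distrib_left
  proof (rule sum.cong[OF HOL.refl])
    fix w assume w: "w \<in> WP M"
    have "loc H (emb H (sact H (inv c) (coeff_of H h w))) = E (ract (inv c) (rat (hc h w)))"
      using ract_rat[OF icW] by (simp add: loc_emb hc_def)
    then show "R0 * loc H (tw H (inv c \<circ> w \<circ> c) * emb H (sact H (inv c) (coeff_of H h w))) =
        T w * E (rat (hc h w)) * R0"
      by (simp only: hom_loc mult.assoc E_R0 T_R0[OF w, THEN assoc_tail])
  qed
  also have "\<dots> = loc H h * R0"
    by (subst hecke_par_expand[OF M h])
      (simp only: loc_add(4) hom_loc loc_emb sum_distrib_right)
  finally have "R0inv * R0 * loc H (phi H M h) = R0inv * loc H h * R0"
    by (simp only: mult.assoc)
  then show ?thesis by (simp add: R0_inverse)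
qed

lemma inj_phi: "inj_on (phi H M) HM"
proof (rule inj_onI)
  fix h h' assume h: "h \<in> HM" "h' \<in> HM" "phi H M h = phi H M h'"
  have "R0inv * loc H h * R0 = R0inv * loc H h' * R0" using loc_phi h by metis
  then have "R0 * (R0inv * loc H h * R0) * R0inv = R0 * (R0inv * loc H h' * R0) * R0inv" by simp
  then have "(R0 * R0inv) * loc H h * (R0 * R0inv) = (R0 * R0inv) * loc H h' * (R0 * R0inv)"
    by (simp only: mult.assoc)
  then have "loc H h = loc H h'" by (simp add: R0_inverse)
  then show "h = h'" by (rule loc_inj)
qed

lemma a_twist_phi: "h \<in> HM \<Longrightarrow> a_twist H M \<sigma> (phi H M h) = \<sigma> h"
  by (simp add: a_twist_def inv_into_f_f[OF inj_phi])

lemma a_twist_tw: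
  assumes z: "z \<in> WP M"
  shows "a_twist H M \<sigma> (tw H (inv c \<circ> z \<circ> c)) = \<sigma> (tw H z)"
proof -
  have "loc H (phi H M (tw H z)) = R0inv * (T z * R0)"
    using loc_phi[OF tw_hecke[OF z]] by (simp only: mult.assoc)
  also have "\<dots> = (R0inv * R0) * T (inv c \<circ> z \<circ> c)" by (simp only: T_R0[OF z] mult.assoc)
  finally have "phi H M (tw H z) = tw H (inv c \<circ> z \<circ> c)"
    by (intro loc_inj) (simp only: R0_inverse mult_1_left)
  then show ?thesis using a_twist_phi[OF tw_hecke[OF z]] by simp
qed

lemma a_twist_emb: "a_twist H M \<sigma> (emb H p) = S (sact H c p)"
proof -
  have "loc H (phi H M (emb H (sact H c p))) = R0inv * (E (rat (sact H c p)) * R0)"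
    using loc_phi[OF emb_hecke] by (simp only: mult.assoc loc_emb)
  also have "\<dots> = (R0inv * R0) * E (ract (inv c) (rat (sact H c p)))" by (simp only: E_R0 mult.assoc)
  also have "\<dots> = loc H (emb H p)"
    using ract_rat[OF icW] sact_inv(2)[OF cW] by (simp add: R0_inverse loc_emb)
  finally have "phi H M (emb H (sact H c p)) = emb H p" by (rule loc_inj)
  then show ?thesis using a_twist_phi[OF emb_hecke] by metis
qed

lemma rat_act_a_twist: "rat_act H (a_twist H M \<sigma>) (ract (inv c) r) u = rat_act H \<sigma> r u"
proof -
  have "(\<exists>p q. q \<noteq> 0 \<and> ract (inv c) r = Fract p q \<and> bij (S (sact H c q)) \<and>
        S (sact H c q) u' = S (sact H c p) u) \<longleftrightarrow>
      (\<exists>p q. q \<noteq> 0 \<and> r = Fract p q \<and> bij (S q) \<and> S q u' = S p u)" (is "?L \<longleftrightarrow> ?R") for u'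
  proof
    assume ?L
    then obtain p q where pq: "q \<noteq> 0" "ract (inv c) r = rat p / rat q" "bij (S (sact H c q))"
      "S (sact H c q) u' = S (sact H c p) u"
      using Fract_rat by metis
    have q0: "sact H c q \<noteq> 0" using pq(1) sact_eq_0_iff[OF cW] by blast
    have "r = ract c (ract (inv c) r)" using ract_inv(1)[OF cW] by simp
    also have "\<dots> = Fract (sact H c p) (sact H c q)"
      unfolding pq(2) using ract_frac[OF cW pq(1)] Fract_rat[OF q0] by metis
    finally show ?R using q0 pq by blast
  next
    assume ?R
    then obtain p q where pq: "q \<noteq> 0" "r = rat p / rat q" "bij (S q)" "S q u' = S p u"
      using Fract_rat by metis
    have q0: "sact H (inv c) q \<noteq> 0" using pq(1) sact_eq_0_iff[OF icW] by blast
    have e: "sact H c (sact H (inv c) x) = x" for x using sact_inv(1)[OF cW] .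
    have "ract (inv c) r = Fract (sact H (inv c) p) (sact H (inv c) q)"
      unfolding pq(2) using ract_frac[OF icW pq(1)] Fract_rat[OF q0] by metis
    then show ?L using q0 pq e by (intro exI[of _ "sact H (inv c) p"] exI[of _ "sact H (inv c) q"]) simp
  qed
  then show ?thesis unfolding rat_act_def a_twist_emb by presburger
qed

text \<open>In terms of \<open>mu\<close> the twisted module disappears from the definition of the form: what is left is
\<open>\<sigma>\<close> itself, divided by the scalar through which the denominator acts.\<close>

lemma rhecke_act_eps:
  "rhecke_act H Md (a_twist H M \<sigma>) (eps H Md (loc H (tw H (inv c) * h) * R0)) v =
    sU (1 / ev dpol cc) (\<sigma> (mu h) v)"
proof -
  let ?g = "eps H Md (loc H (tw H (inv c) * h) * R0)"
  have "rhecke_act H Md (a_twist H M \<sigma>) ?g v =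
      (\<Sum>z\<in>WP M. a_twist H M \<sigma> (tw H (inv c \<circ> z \<circ> c)) (rat_act H (a_twist H M \<sigma>) (cf ?g (inv c \<circ> z \<circ> c)) v))"
    unfolding rhecke_act_def
    by (rule sum.reindex_bij_witness[of _ "\<lambda>z. inv c \<circ> z \<circ> c" "\<lambda>w. c \<circ> w \<circ> inv c"])
      (use conj_c[OF M] conj_inv_c[OF M] cW in \<open>auto simp: comp_assoc\<close>)
  also have "\<dots> = (\<Sum>z\<in>WP M. sU (1 / ev dpol cc) (\<sigma> (tw H z * emb H (hc (mu h) z)) v))"
  proof (rule sum.cong[OF HOL.refl])
    fix z assume z: "z \<in> WP M"
    have "rat_act H \<sigma> (rat (hc (mu h) z) / rat dpol) v = sU (1 / ev dpol cc) (S (hc (mu h) z) v)"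
      by (rule rat_act_eq[OF dpol_nonzero bij_dpol S_dpol])
    then show "a_twist H M \<sigma> (tw H (inv c \<circ> z \<circ> c)) (rat_act H (a_twist H M \<sigma>) (cf ?g (inv c \<circ> z \<circ> c)) v) =
        sU (1 / ev dpol cc) (\<sigma> (tw H z * emb H (hc (mu h) z)) v)"
      unfolding a_twist_tw[OF z] cf_eps_mu[OF z] rat_act_a_twist
      using \<sigma>_simps(2,5) tw_hecke[OF z] emb_hecke by simp
  qed
  also have "\<dots> = sU (1 / ev dpol cc) (\<Sum>z\<in>WP M. \<sigma> (tw H z * emb H (hc (mu h) z)) v)"
    by (rule additive_simps(4)[of "sU (1 / ev dpol cc)", OF sU_simps(1), symmetric])
  also have "(\<Sum>z\<in>WP M. \<sigma> (tw H z * emb H (hc (mu h) z)) v) = \<sigma> (mu h) v"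
  proof -
    have "\<sigma> (\<Sum>z\<in>WP M. tw H z * emb H (hc (mu h) z)) v = (\<Sum>z\<in>WP M. \<sigma> (tw H z * emb H (hc (mu h) z)) v)"
      by (rule \<sigma>_sum) (use hecke_closed(2) tw_hecke emb_hecke in blast)
    then show ?thesis using hecke_par_expand[OF M mu(1), of h] by simp
  qed
  finally show ?thesis .
qed

end

context induced
begin

section \<open>Existence and uniqueness of the induced form\<close>

lemma b_simps: "b (u + u') v = b u v + b u' v" "b u (v + v') = b u v + b u v'"
  "b (sU a u) v = a * b u v" "b u (sU a v) = cnj a * b u v"
  and b_cnj: "b v u = cnj (b u v)"
  using herm unfolding hermitian_form_def sesquilinear_def by blast+

lemma b_zero: "b 0 v = 0"
  using b_simps(1)[of 0 0 v] by simp

text \<open>Hermitian symmetry moves the star operation to the first argument, so that it is never applied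
twice.\<close>

lemma b_adjoint: "m \<in> HM \<Longrightarrow> b (\<sigma> (star H m) u) v = b u (\<sigma> m v)"
proof -
  assume m: "m \<in> HM"
  have "b (\<sigma> (star H m) u) v = cnj (b v (\<sigma> (star H m) u))" by (rule b_cnj)
  also have "b v (\<sigma> (star H m) u) = b (\<sigma> m v) u"
    using inv_b m by (simp add: star_invariant_def)
  finally show ?thesis using b_cnj[of "\<sigma> m v" u] by simp
qed

text \<open>The value prescribed for the induced form on a pair of elementary tensors, after \<open>\<epsilon>\<close> and the twisted
module have been eliminated by means of \<open>rhecke_act_eps\<close>.\<close>

definition form_val :: "'h \<Rightarrow> 'u \<Rightarrow> 'h \<Rightarrow> 'u \<Rightarrow> complex" where
  "form_val h1 v1 h2 v2 = 1 / ev dpol cc * b (\<sigma> (mu (star H h2 * h1)) v1) v2"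

lemma form_val_eq: "b (rhecke_act H Md (a_twist H M \<sigma>)
      (eps H Md (loc H (tw H (inv c) * star H h2 * h1) * R0)) v1) v2 = form_val h1 v1 h2 v2"
  using rhecke_act_eps[of "star H h2 * h1" v1] by (simp add: form_val_def mult.assoc b_simps)

lemma form_val_left:
  "form_val (h + h') u h2 v = form_val h u h2 v + form_val h' u h2 v"
  "form_val h (u + u') h2 v = form_val h u h2 v + form_val h u' h2 v"
  "m \<in> HM \<Longrightarrow> form_val (h * m) u h2 v = form_val h (\<sigma> m u) h2 v"
  by (simp_all add: form_val_def mu_add \<sigma>_simps mu(1) b_simps mu_right ring_distribs mult.assoc[symmetric])

lemma form_val_right:
  "form_val h1 u (h + h') v = form_val h1 u h v + form_val h1 u h' v"
  "form_val h1 u h (v + v') = form_val h1 u h v + form_val h1 u h v'"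
  "m \<in> HM \<Longrightarrow> form_val h1 u (h * m) v = form_val h1 u h (\<sigma> m v)"
  by (simp_all add: form_val_def mu_add \<sigma>_simps mu(1) b_simps mu_left star_hecke[OF M] star_simps
      b_adjoint ring_distribs mult.assoc)

lemma form_val_scale: "form_val (emb H (cst a) * h1) u h2 v = a * form_val h1 u h2 v"
  "form_val h1 u (emb H (cst a) * h2) v = cnj a * form_val h1 u h2 v"
proof -
  have comm: "h * emb H (cst a) = emb H (cst a) * h" for h a
  proof (rule loc_inj)
    have "E (rat (cst a)) * m = m * E (rat (cst a))" if "m \<in> rhecke_par H (simples H)" for m
      by (rule commute_invariant[OF order.refl _ that])
        (simp add: WP_simples ract_rat sact_simps linear_W)
    moreover have "loc H h \<in> rhecke_par H (simples H)"
      by (subst rhecke_par_iff[OF order.refl]) (use cf_outside WP_simples in blast)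
    ultimately show "loc H (h * emb H (cst a)) = loc H (emb H (cst a) * h)"
      by (simp add: hom_loc loc_emb)
  qed
  have "star H h2 * (emb H (cst a) * h1) = emb H (cst a) * (star H h2 * h1)"
    by (simp only: mult.assoc[symmetric] comm)
  then show "form_val (emb H (cst a) * h1) u h2 v = a * form_val h1 u h2 v"
    by (simp add: form_val_def mu_left emb_hecke \<sigma>_simps mu(1) b_simps)
  have "star H (emb H (cst a) * h2) * h1 = emb H (cst (cnj a)) * (star H h2 * h1)"
    by (simp only: star_simps(3) mult.assoc)
  then show "form_val h1 u (emb H (cst a) * h2) v = cnj a * form_val h1 u h2 v"
    by (simp add: form_val_def mu_left emb_hecke \<sigma>_simps mu(1) b_simps)
qed

lemma vsX: "vector_space sX"
  using tp by (simp add: is_tensor_product_def)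

lemma tens_scale: "tens (emb H (cst a) * h) u = sX a (tens h u)"
  using tp by (simp add: is_tensor_product_def)

lemma relation_zero:
  "x \<in> tensor_relations HM \<sigma> \<Longrightarrow> formal_eval sX tens x = 0"
  using tp by (simp add: is_tensor_product_def)

lemma tens_simps:
  "tens (h + h') u = tens h u + tens h' u" "tens h (u + u') = tens h u + tens h u'"
  "m \<in> HM \<Longrightarrow> tens (h * m) u = tens h (\<sigma> m u)"
proof -
  let ?s = "\<lambda>h u. Poly_Mapping.single (h, u) (1::int)"
  note F = formal_eval_diff[OF vsX] formal_eval_single[OF vsX]
  have "?s (h + h') u - ?s h u - ?s h' u \<in> tensor_relations HM \<sigma>"
    unfolding tensor_relations_def by (rule subgroup_gen.incl) blast
  from relation_zero[OF this, unfolded F] show "tens (h + h') u = tens h u + tens h' u"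
    by (simp add: algebra_simps)
  have "?s h (u + u') - ?s h u - ?s h u' \<in> tensor_relations HM \<sigma>"
    unfolding tensor_relations_def by (rule subgroup_gen.incl) blast
  from relation_zero[OF this, unfolded F] show "tens h (u + u') = tens h u + tens h u'"
    by (simp add: algebra_simps)
  show "tens (h * m) u = tens h (\<sigma> m u)" if m: "m \<in> HM"
  proof -
    have "?s (h * m) u - ?s h (\<sigma> m u) \<in> tensor_relations HM \<sigma>"
      unfolding tensor_relations_def by (rule subgroup_gen.incl) (use m in blast)
    from relation_zero[OF this] show ?thesis by (simp add: F)
  qed
qed

lemma tens_zero: "tens 0 u = 0"
  using tens_simps(1)[of 0 0 u] by simp

lemma tens_sum: "tens (\<Sum>i\<in>A. f i) u = (\<Sum>i\<in>A. tens (f i) u)"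
  using additive_simps(4)[of "\<lambda>h. tens h u", OF tens_simps(1)] .

lemma tens_induct:
  assumes "\<And>h u. Q (tens h u)" "\<And>x y. Q x \<Longrightarrow> Q y \<Longrightarrow> Q (x + y)"
  shows "Q x"
proof -
  have "surj (formal_eval sX tens)" using tp by (simp add: is_tensor_product_def)
  then obtain c where c: "x = formal_eval sX tens c" by (metis surjD)
  have z: "Q 0" using assms(1)[of 0 0] by (simp add: tens_zero)
  have "Q (\<Sum>(h, u)\<in>A. sX (of_int (Poly_Mapping.lookup c (h, u))) (tens h u))" if "finite A" for A
    using that
  proof (induction A rule: finite_induct)
    case empty
    show ?case using z by simp
  next
    case (insert a A)
    obtain h u where a: "a = (h, u)" by (cases a)
    have "Q (sX (of_int (Poly_Mapping.lookup c (h, u))) (tens h u))"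
      using assms(1) by (simp only: tens_scale[symmetric])
    then show ?case using insert assms(2) by (simp add: a)
  qed
  then show ?thesis unfolding c formal_eval_def by simp
qed

text \<open>The prescribed values are balanced in the first argument because \<open>mu\<close> is right linear, and in the
second because it is left linear and the form on \<open>U\<close> is invariant.  So they factor through the
tensor product first in one variable and then in the other.\<close>

lemma induced_form_exists:
  "\<exists>B. sesquilinear sX B \<and> (\<forall>h1 h2 v1 v2. B (tens h1 v1) (tens h2 v2) = form_val h1 v1 h2 v2)"
proof -
  have "\<exists>f. (\<forall>x y. f (x + y) = f x + f y) \<and> (\<forall>h u. f (tens h u) = form_val h u h2 v2)" for h2 v2
    by (rule tensor_lift[OF tp]) (rule form_val_left; assumption?)+
  then obtain \<phi> where \<phi>: "\<And>h2 v2 x y. \<phi> h2 v2 (x + y) = \<phi> h2 v2 x + \<phi> h2 v2 y"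
    "\<And>h2 v2 h u. \<phi> h2 v2 (tens h u) = form_val h u h2 v2"
    by metis
  have \<phi>add: "\<phi> (h + h') v x = \<phi> h v x + \<phi> h' v x" for h h' v x
    by (induction x rule: tens_induct) (simp_all add: \<phi> form_val_right)
  have \<phi>add': "\<phi> h (v + v') x = \<phi> h v x + \<phi> h v' x" for h v v' x
    by (induction x rule: tens_induct) (simp_all add: \<phi> form_val_right)
  have \<phi>bal: "\<phi> (h * m) v x = \<phi> h (\<sigma> m v) x" if "m \<in> HM" for h m v x
    by (induction x rule: tens_induct) (simp_all add: \<phi> form_val_right that)
  have \<phi>sc: "\<phi> (emb H (cst a) * h) v x = cnj a * \<phi> h v x" for a h v x
    by (induction x rule: tens_induct) (simp_all add: \<phi> form_val_scale ring_distribs)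
  have \<phi>scX: "\<phi> h v (sX a x) = a * \<phi> h v x" for a h v x
  proof (induction x rule: tens_induct)
    case (1 k u)
    show ?case by (simp add: \<phi> form_val_scale flip: tens_scale)
  next
    case (2 x y)
    interpret vector_space sX by (rule vsX)
    show ?case using 2 by (simp add: scale_right_distrib \<phi> ring_distribs)
  qed
  have "\<exists>f. (\<forall>y y'. f (y + y') = f y + f y') \<and> (\<forall>h u. f (tens h u) = cnj (\<phi> h u x))" for x
    by (rule tensor_lift[OF tp]) (simp_all add: \<phi>add \<phi>add' \<phi>bal)
  then obtain \<psi> where \<psi>: "\<And>x y y'. \<psi> x (y + y') = \<psi> x y + \<psi> x y'"
    "\<And>x h u. \<psi> x (tens h u) = cnj (\<phi> h u x)"
    by metis
  define B where "B x y = cnj (\<psi> x y)" for x y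
  have "B (x + x') y = B x y + B x' y" for x x' y
    unfolding B_def by (induction y rule: tens_induct) (simp_all add: \<psi> \<phi>)
  moreover have "B x (y + y') = B x y + B x y'" for x y y'
    by (simp add: B_def \<psi>)
  moreover have "B (sX a x) y = a * B x y" for a x y
    unfolding B_def by (induction y rule: tens_induct) (simp_all add: \<psi> \<phi>scX ring_distribs)
  moreover have "B x (sX a y) = cnj a * B x y" for a x y
  proof (induction y rule: tens_induct)
    case (1 k u)
    show ?case by (simp add: B_def \<psi> \<phi>sc flip: tens_scale)
  next
    case (2 y y')
    interpret vector_space sX by (rule vsX)
    show ?case using 2 by (simp add: scale_right_distrib \<psi> B_def ring_distribs)
  qed
  moreover have "B (tens h1 v1) (tens h2 v2) = form_val h1 v1 h2 v2" for h1 v1 h2 v2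
    by (simp add: B_def \<psi> \<phi>)
  ultimately show ?thesis
    unfolding sesquilinear_def by (intro exI[of _ B] conjI allI)
qed

lemma induced_form_tens:
  "induced_form H M \<sigma> b sX tens (tens h1 v1) (tens h2 v2) = form_val h1 v1 h2 v2"
proof -
  let ?Q = "\<lambda>B. sesquilinear sX B \<and> (\<forall>h1 h2 v1 v2. B (tens h1 v1) (tens h2 v2) = form_val h1 v1 h2 v2)"
  have "\<exists>!B. ?Q B"
  proof (rule ex_ex1I)
    show "\<exists>B. ?Q B" by (rule induced_form_exists)
    fix B B' assume B: "?Q B" and B': "?Q B'"
    have "B x y = B' x y" for x y
    proof (induction x rule: tens_induct)
      case (1 h u)
      show ?case
        by (induction y rule: tens_induct) (use B B' in \<open>simp_all add: sesquilinear_def\<close>)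
    next
      case (2 x x')
      then show ?case using B B' by (simp add: sesquilinear_def)
    qed
    then show "B = B'" by blast
  qed
  from theI'[OF this] have "?Q (induced_form H M \<sigma> b sX tens)"
    unfolding induced_form_def form_val_eq .
  then show ?thesis by blast
qed

section \<open>Values on the intertwiner basis\<close>

text \<open>Since a common denominator of the coefficients of \<open>cR x\<close> acts invertibly on \<open>U\<close>, the vector
  \<open>cR x \<otimes> v\<close> is an honest tensor \<open>h \<otimes> v'\<close>.  No rational element has to be moved across the form.\<close>

lemma cR_tens_integral:
  assumes x: "x \<in> J M"
  obtains h q v' where "loc H h = cR x * E (rat q)" "bij (S q)" "S q v' = v"
    "cR_tens H \<sigma> tens x v = tens h v'"
proof -
  have def: "rat_defined H \<sigma> (cf (cR x) y)" if "y \<in> W" for y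
    using reg x that unfolding regular_parameter_def by blast
  have "\<exists>q. q \<noteq> 0 \<and> bij (S q) \<and> (\<forall>y\<in>A. \<exists>p. cf (cR x) y * rat q = rat p)"
    if "finite A" "A \<subseteq> W" for A
    using that
  proof (induction A rule: finite_induct)
    case empty
    show ?case using bij_S_one by (intro exI[of _ 1]) simp
  next
    case (insert y A)
    then obtain q where q: "q \<noteq> 0" "bij (S q)" "\<forall>y\<in>A. \<exists>p. cf (cR x) y * rat q = rat p" by auto
    obtain p' q' where pq: "q' \<noteq> 0" "cf (cR x) y = rat p' / rat q'" "bij (S q')"
      using def[of y] insert Fract_rat unfolding rat_defined_def by (metis insert_subset)
    have "\<exists>p. cf (cR x) z * rat (q * q') = rat p" if z: "z \<in> insert y A" for z
    proof (cases "z = y")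
      case True
      have "cf (cR x) z * rat (q * q') = rat (p' * q)"
        using pq True by (simp add: rat_simps rat_eq_0_iff)
      then show ?thesis by blast
    next
      case False
      then obtain p where p: "cf (cR x) z * rat q = rat p" using q z by blast
      have "cf (cR x) z * rat (q * q') = rat (p * q')"
        by (simp add: rat_simps p[symmetric] mult.assoc)
      then show ?thesis by blast
    qed
    then show ?case using q pq bij_S_mult by (intro exI[of _ "q * q'"]) simp
  qed
  from this[OF finite_W order.refl] obtain q where q: "q \<noteq> 0" "bij (S q)"
    "\<forall>y\<in>W. \<exists>p. cf (cR x) y * rat q = rat p" by blast
  from q(3) obtain p where p: "\<And>y. y \<in> W \<Longrightarrow> cf (cR x) y * rat q = rat (p y)" by metis
  obtain v' where v': "S q v' = v" using q(2) by (metis bij_is_surj surjD)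
  define h where "h = (\<Sum>y\<in>W. tw H y * emb H (p y))"
  have "loc H h = (\<Sum>y\<in>W. T y * E (cf (cR x) y * rat q))"
    unfolding h_def loc_add(4) by (rule sum.cong) (simp_all add: hom_loc loc_emb p)
  also have "\<dots> = (\<Sum>y\<in>W. T y * E (cf (cR x) y)) * E (rat q)"
    by (simp only: hom_E sum_distrib_right mult.assoc)
  also have "\<dots> = cR x * E (rat q)" by (simp only: cf_expand[symmetric])
  finally have lh: "loc H h = cR x * E (rat q)" .
  have "cR_tens H \<sigma> tens x v = (\<Sum>y\<in>W. tens (tw H y * emb H (p y)) v')"
    unfolding cR_tens_def
  proof (rule sum.cong[OF HOL.refl])
    fix y assume y: "y \<in> W"
    have "cf (cR x) y = rat (p y) / rat q"
      using p[OF y] q(1) by (simp add: rat_eq_0_iff nonzero_eq_divide_eq)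
    moreover have "rat_act H \<sigma> (rat (p y) / rat q) v = S (p y) v'"
      by (rule rat_act_eq[OF q(1,2)]) (use S_commute[of q "p y" v'] v' in simp)
    ultimately show "tens (tw H y) (rat_act H \<sigma> (cf (cR x) y) v) = tens (tw H y * emb H (p y)) v'"
      by (simp add: tens_simps emb_hecke)
  qed
  also have "\<dots> = tens h v'" unfolding h_def by (rule tens_sum[symmetric])
  finally show thesis using that lh q(2) v' by blast
qed

text \<open>The numerator of \<open>F0\<close>, matching \<open>dpol\<close>: a root with \<open>k = 0\<close> contributes \<open>- \<beta> / \<beta> = - 1\<close>.\<close>

definition npol :: "'d sym" where
  "npol = (\<Prod>\<beta>\<in>P - RP M. if kpar H \<beta> = 0 then - 1 else - root_fn H \<beta>)"

lemma F0_npol: "F0 = rat npol / rat dpol"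
  unfolding F0_def npol_def dpol_def rat_prod prod_dividef[symmetric]
proof (rule prod.cong[OF HOL.refl])
  fix \<beta> assume "\<beta> \<in> P - RP M"
  then have "\<beta> \<in> roots H" using P_roots by auto
  then show "- rroot H \<beta> / (rk H \<beta> + rroot H \<beta>) =
      rat (if kpar H \<beta> = 0 then - 1 else - root_fn H \<beta>) / rat (dfac \<beta>)"
    using rroot_nonzero[of \<beta>] by (auto simp: dfac_def rk_def rroot_def rat_simps cst_simps)
qed

lemma npol_invariant:
  assumes w: "w \<in> WP M"
  shows "sact H w npol = npol"
proof -
  have wW: "w \<in> W" using w WP_W[OF M] by blast
  have "ract w (rat npol) = rat npol"
    unfolding npol_def rat_prod
    by (rule prod_complement_invariant[OF M w])
      (use wW linear_W[OF wW] in \<open>auto simp: ract_rat sact_simps sact_root_fn kpar_weyl\<close>)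
  then show ?thesis using wW by (simp add: ract_rat rat_eq_iff)
qed

lemma f_cc_eq: "ev dpol cc \<noteq> 0 \<Longrightarrow> f_cc H M cc = ev npol cc / ev dpol cc"
proof -
  assume d: "ev dpol cc \<noteq> 0"
  have dp: "ev dpol cc = (\<Prod>\<beta>\<in>P - RP M. ev (dfac \<beta>) cc)"
    by (simp add: dpol_def sym_prod_eval)
  have np: "ev npol cc = (\<Prod>\<beta>\<in>P - RP M. if kpar H \<beta> = 0 then - 1 else - ev (root_fn H \<beta>) cc)"
    unfolding npol_def sym_prod_eval by (rule prod.cong) auto
  have set: "P - pos_roots_par H M = P - RP M" by (auto simp: pos_roots_par_def)
  have "f_cc H M cc = (\<Prod>\<beta>\<in>P - RP M. - f_factor H \<beta> cc)"
    unfolding f_cc_def set by (subst prod_uminus) simp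
  also have "\<dots> = (\<Prod>\<beta>\<in>P - RP M. (if kpar H \<beta> = 0 then - 1 else - ev (root_fn H \<beta>) cc) / ev (dfac \<beta>) cc)"
  proof (rule prod.cong[OF HOL.refl])
    fix \<beta> assume b: "\<beta> \<in> P - RP M"
    then have bR: "\<beta> \<in> roots H" using P_roots by auto
    have nz: "ev (dfac \<beta>) cc \<noteq> 0" using d b finite_P unfolding dp by (subst (asm) prod_zero_iff) auto
    show "- f_factor H \<beta> cc = (if kpar H \<beta> = 0 then - 1 else - ev (root_fn H \<beta>) cc) / ev (dfac \<beta>) cc"
    proof (cases "kpar H \<beta> = 0")
      case True
      then have "rroot H \<beta> / (rk H \<beta> + rroot H \<beta>) = Fract 1 1"
        using rroot_nonzero[OF bR] by (simp add: rk_def cst_simps rat_simps One_fract_def)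
      then have "f_factor H \<beta> cc = 1" unfolding f_factor_def using rat_ev_Fract[of 1 cc 1] by simp
      then show ?thesis using True by (simp add: dfac_def)
    next
      case False
      have "of_real (kpar H \<beta>) + cpair H (\<beta>, 0) cc \<noteq> 0"
        using nz False by (simp add: dfac_def ev_root_fn)
      from f_factor_eq[OF rd this] show ?thesis using False by (simp add: dfac_def ev_root_fn)
    qed
  qed
  finally show ?thesis unfolding np dp prod_dividef .
qed

text \<open>The adjoint of \<open>cR y\<close> times \<open>cR x\<close> is a multiple of the intertwiner of \<open>y\<inverse> x\<close>, and for minimal
representatives this element lies in \<open>W\<^sub>M\<close> only if \<open>x = y\<close>.\<close>

lemma mu_value:
  assumes x: "x \<in> J M" and y: "y \<in> J M"
    and hx: "loc H hx = cR x * E (rat qx)" and hy: "loc H hy = cR y * E (rat qy)"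
    and q': "star H (emb H qy) = emb H q'"
  shows "x \<noteq> y \<Longrightarrow> mu (star H hy * hx) = 0"
    "x = y \<Longrightarrow> loc H (mu (star H hy * hx)) = E (rat q' * G x * rat npol * rat qx)"
proof -
  have W: "x \<in> W" "y \<in> W" "inv y \<in> W" "inv y \<circ> x \<in> W"
    using x y J_iff[OF M] inv_W comp_W by auto
  have l: "loc H (star H hy * hx) = E (rat q' * G y) * (cR (inv y \<circ> x) * E (rat qx))"
    using loc_star[OF W(2) hy q'] hx cR_comp[OF W(3,1)] by (simp only: hom_loc mult.assoc)
  show "mu (star H hy * hx) = 0" if ne: "x \<noteq> y"
  proof (rule loc_inj)
    have "inv y \<circ> x \<notin> WP M" using J_unique[OF M x y] ne by blast
    then have "Psi (cR (inv y \<circ> x) * E (rat qx)) = 0" using Psi_cR[OF W(4)] by simp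
    then have "loc H (mu (star H hy * hx)) = 0" unfolding mu l Psi_E_left by simp
    then show "loc H (mu (star H hy * hx)) = loc H 0" by (simp add: loc_add)
  qed
  show "loc H (mu (star H hy * hx)) = E (rat q' * G x * rat npol * rat qx)" if e: "x = y"
  proof -
    have "inv y \<circ> x = id" using e W by simp
    then have "Psi (cR (inv y \<circ> x) * E (rat qx)) = E F0 * E (rat qx)"
      using Psi_cR[OF id_W, of "rat qx"] id_WP by (simp only: cR_id mult_1_left if_True)
    then have "loc H (mu (star H hy * hx)) = E (rat q' * G y * (F0 * rat qx) * rat dpol)"
      unfolding mu l Psi_E_left by (simp only: hom_E mult.assoc)
    moreover have "F0 * rat dpol = rat npol"
      using dpol_nonzero by (simp add: F0_npol rat_eq_0_iff)
    moreover have "rat q' * G y * (F0 * rat qx) * rat dpol = rat q' * G y * (F0 * rat dpol) * rat qx"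
      by (simp only: mult_ac)
    ultimately show ?thesis using e by (simp only:)
  qed
qed

theorem induced_form_intertwiners:
  assumes x: "x \<in> J M" and y: "y \<in> J M"
  shows "induced_form H M \<sigma> b sX tens (cR_tens H \<sigma> tens x v1) (cR_tens H \<sigma> tens y v2) =
    (if x \<noteq> y then 0 else f_cc H M cc * b (rat_act H \<sigma> (G x) v1) v2)"
proof -
  obtain hx qx u1 where X: "loc H hx = cR x * E (rat qx)" "bij (S qx)" "S qx u1 = v1"
    "cR_tens H \<sigma> tens x v1 = tens hx u1"
    using cR_tens_integral[OF x] by metis
  obtain hy qy u2 where Y: "loc H hy = cR y * E (rat qy)" "bij (S qy)" "S qy u2 = v2"
    "cR_tens H \<sigma> tens y v2 = tens hy u2"
    using cR_tens_integral[OF y] by metis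
  obtain q' where q': "star H (emb H qy) = emb H q'" using star_emb by blast
  let ?m = "mu (star H hy * hx)"
  have form: "induced_form H M \<sigma> b sX tens (cR_tens H \<sigma> tens x v1) (cR_tens H \<sigma> tens y v2) =
      1 / ev dpol cc * b (\<sigma> ?m u1) u2"
    by (simp only: X(4) Y(4) induced_form_tens form_val_def)
  note mv = mu_value[OF x y X(1) Y(1) q']
  show ?thesis
  proof (cases "x = y")
    case False
    then show ?thesis unfolding form mv(1)[OF False] by (simp add: \<sigma>_zero b_zero)
  next
    case True
    \<comment> \<open>A root with \<open>k = 0\<close> contributes the factor \<open>1\<close>; left as \<open>\<gamma> / \<gamma>\<close> it would put \<open>\<gamma>\<close>, which need
      not act invertibly, into the denominator.\<close>
    define g1 where "g1 = (\<Prod>\<gamma>\<in>Inv x. if kpar H \<gamma> = 0 then 1 else root_fn H \<gamma> - cst (of_real (kpar H \<gamma>)))"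
    define g2 where "g2 = (\<Prod>\<gamma>\<in>Inv x. dfac \<gamma>)"
    have Ix: "Inv x \<subseteq> P - RP M" using x J_iff[OF M] pos_not_neg by (auto simp: Inv_def)
    have g2: "g2 \<noteq> 0" "bij (S g2)"
    proof -
      show "g2 \<noteq> 0" unfolding g2_def
        using dfac_nonzero P_roots Ix finite_Inv by (subst prod_zero_iff) auto
      show "bij (S g2)" unfolding g2_def using bij_dfac Ix finite_Inv by (intro bij_S_prod) auto
    qed
    have Gx: "G x = rat g1 / rat g2"
      unfolding G_def g1_def g2_def rat_prod prod_dividef[symmetric]
    proof (rule prod.cong[OF HOL.refl])
      fix \<gamma> assume "\<gamma> \<in> Inv x"
      then have "\<gamma> \<in> roots H" using P_roots by (auto simp: Inv_def)
      then show "(rroot H \<gamma> - rk H \<gamma>) / (rroot H \<gamma> + rk H \<gamma>) =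
          rat (if kpar H \<gamma> = 0 then 1 else root_fn H \<gamma> - cst (of_real (kpar H \<gamma>))) / rat (dfac \<gamma>)"
        using rroot_nonzero[of \<gamma>]
        by (auto simp: dfac_def rk_def rroot_def rat_simps cst_simps add.commute)
    qed
    define w where "w = rat_act H \<sigma> (G x) v1"
    obtain w' where w': "S g2 w' = S g1 v1" using g2(2) by (metis bij_is_surj surjD)
    have w: "S g2 w = S g1 v1" unfolding w_def Gx rat_act_eq[OF g2 w'] by (rule w')
    define p where "p = hc ?m id"
    have "cf (loc H ?m) id = rat q' * G x * rat npol * rat qx"
      unfolding mv(2)[OF True] using cf_E[OF id_W] by (simp only: if_True simp_thms)
    then have rp: "rat p = rat q' * G x * rat npol * rat qx" by (simp only: cf_loc p_def)
    have "loc H ?m = loc H (emb H p)" unfolding mv(2)[OF True] loc_emb rp ..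
    then have m: "?m = emb H p" by (rule loc_inj)
    have "rat g2 \<noteq> 0" using g2 by (simp add: rat_eq_0_iff)
    then have "rat (g2 * p) = rat (q' * g1 * npol * qx)" by (simp add: rat_simps rp Gx)
    then have "g2 * p = q' * g1 * npol * qx" by (simp add: rat_eq_iff)
    then have "S g2 (S p u1) = S (q' * g1 * npol * qx) u1" by (simp add: S_mult[symmetric])
    also have "\<dots> = S q' (S g1 (S npol v1))" by (simp only: S_mult X(3))
    also have "\<dots> = S npol (S q' (S g1 v1))" using S_commute by metis
    also have "\<dots> = S g2 (S npol (S q' w))" unfolding w[symmetric] using S_commute by metis
    finally have "S p u1 = S npol (S q' w)" using g2(2) by (meson bij_is_inj injD)
    also have "\<dots> = sU (ev npol cc) (S q' w)" using S_central npol_invariant by blast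
    finally have Sp: "S p u1 = sU (ev npol cc) (S q' w)" .
    \<comment> \<open>The denominator that was absorbed into the second vector comes back through the form.\<close>
    have adj: "b (S q' w) u2 = b w v2"
      using b_adjoint[OF emb_hecke, of qy w u2] by (simp add: q' Y(3))
    have "1 / ev dpol cc * b (\<sigma> ?m u1) u2 = ev npol cc / ev dpol cc * b w v2"
      by (simp add: m Sp b_simps adj)
    also have "\<dots> = f_cc H M cc * b w v2"
    proof (cases "ev dpol cc = 0")
      case True
      then have "w = 0" using dpol_cc[of w] by blast
      then show ?thesis by (simp add: b_zero)
    qed (simp add: f_cc_eq)
    finally show ?thesis unfolding form using True by (simp add: w_def)
  qed
qed

end

theorem corollary3p9p3:
  fixes H :: "('v::real_vector, 'd::real_vector, 'h::ring_1, 'g::ring_1) rat_hecke_data"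
    and M :: "'v set"
    and sU :: "complex \<Rightarrow> 'u::ab_group_add \<Rightarrow> 'u"
    and \<sigma> \<sigma>0 :: "'h \<Rightarrow> 'u \<Rightarrow> 'u"
    and \<nu> cc :: "'d cpx"
    and b :: "'u \<Rightarrow> 'u \<Rightarrow> complex"
    and sX :: "complex \<Rightarrow> 'x::ab_group_add \<Rightarrow> 'x"
    and tens :: "'h \<Rightarrow> 'u \<Rightarrow> 'x"
    and x y :: "'v \<Rightarrow> 'v"
    and v1 v2 :: 'u
  assumes "graded_hecke_algebra H" and "star_operation H" and "rational_hecke H"
    and "M \<subseteq> simples H"
    and "hecke_rep H (hecke_par H M) sU \<sigma>" and "finite_dim sU"
    and "hecke_rep H (hecke_par0 H M) sU \<sigma>0" and "is_twist H M sU \<sigma>0 \<nu> \<sigma>"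
    and "central_character H M sU \<sigma> cc"
    and "hermitian_form sU b" and "star_invariant H (hecke_par H M) \<sigma> b"
    and "is_tensor_product H (hecke_par H M) \<sigma> sX tens"
    and "regular_parameter H M sU \<sigma> sX tens \<nu>"
    and "x \<in> min_reps H M" and "y \<in> min_reps H M"
  shows "induced_form H M \<sigma> b sX tens (cR_tens H \<sigma> tens x v1) (cR_tens H \<sigma> tens y v2) =
    (if x \<noteq> y then 0
     else f_cc H M cc *
       b (rat_act H \<sigma>
            (\<Prod>\<alpha>\<in>{\<alpha> \<in> pos_roots H. - x \<alpha> \<in> pos_roots H}.
               (rroot H \<alpha> - rk H \<alpha>) / (rroot H \<alpha> + rk H \<alpha>)) v1) v2)"
proof -
  have "root_datum H" using assms(1) by (simp add: graded_hecke_algebra_def)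
  then interpret induced H M sU \<sigma> \<nu> cc b sX tens
    using assms by unfold_locales
  show ?thesis
    using induced_form_intertwiners[of x y v1 v2] assms(14,15)
    by (simp only: G_def Inv_def)
qed

end
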